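(* Let $r\geq 1$. The restriction of the map $N\colon \operatorname{Aut}\mathbb{C}\mathbf{Q}_r\to \mathrm{GL}_r(\mathcal{A}_1)$, $\psi\mapsto N^\psi$, to the subgroup $P_r$ induces an isomorphism of groups $P_r\to \mathrm{GL}_r(\mathbb{C}[a])$, where $\mathrm{GL}_r(\mathbb{C}[a])\subseteq \mathrm{GL}_r(\mathcal{A}_1)$ via $\mathbb{C}[a]\subseteq\mathcal{A}_1$.
   Context: $\mathbf{Q}_r$ is the quiver with two vertices $1,2$, two loops $a,a^*$ at $1$, $r$ arrows $b_1,\dots,b_r\colon 1\to 2$ and $r$ arrows $d_1,\dots,d_r\colon 2\to 1$. $\mathbb{C}\mathbf{Q}_r$ is its path algebra, with paths composed like linear maps (right to left), so that $d_\alpha b_\beta$ is a cycle at $1$; $e_1,e_2$ are the trivial paths. $\operatorname{Aut}\mathbb{C}\mathbf{Q}_r$ is the group of $\mathbb{C}$-algebra automorphisms of $\mathbb{C}\mathbf{Q}_r$ fixing $e_1$ and $e_2$, with product $\sigma\psi=\sigma\circ\psi$. $\mathcal{A}_1=e_1\mathbb{C}\mathbf{Q}_re_1$ is the free associative algebra (with unit $e_1$) on $a$, $a^*$ and $e_{\alpha\beta}=d_\alpha b_\beta$ ($\alpha,\beta=1,\dots,r$), and $e_2\mathbb{C}\mathbf{Q}_re_1$ is a free right $\mathcal{A}_1$-module with basis $b_1,\dots,b_r$. For $\psi\in\operatorname{Aut}\mathbb{C}\mathbf{Q}_r$, $N^\psi\in\mathrm{GL}_r(\mathcal{A}_1)$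 is the unique matrix such that $\psi(b_\alpha)=\sum_{\beta} b_\beta N^\psi_{\beta\alpha}$ for all $\alpha$. Notation: $x_i=-d_{2i-1}$, $x_i^*=b_{2i-1}$ for $i=1,\dots,\lceil r/2\rceil$; $y_j=b_{2j}$, $y_j^*=d_{2j}$ for $j=1,\dots,\lfloor r/2\rfloor$. Let $c_r=[a,a^*]+\sum_i[x_i,x_i^*]+\sum_j[y_j,y_j^*]$; an automorphism is symplectic if it fixes $c_r$. Let $\mathcal{I}_r$ be the two-sided ideal generated by $e_2$, all $d_\alpha$ and all $b_\alpha$; then $\mathbb{C}\mathbf{Q}_r/\mathcal{I}_r\simeq\mathbb{C}\langle a,a^*\rangle$. An automorphism is reduced if it induces the identity on this quotient. An automorphism is affine if it sends each arrow to a linear combination of arrows and trivial paths (a polynomial of degree at most $1$ in the arrows). $\mathrm{Aff}_c^{\mathrm{red}}$ is the group of automorphisms that are affine, symplectic and reduced. For $p\in\mathbb{C}[a]$ and $r\ge 2$ put $b_{11}=x_1y_1$ and let $\Lambda(p(a)b_{11})$ be the symplectic automorphism acting by $a^*\mapsto a^*+\frac{\partial}{\partial a}(p(a)x_1y_1)$, $x_1^*\mapsto x_1^*+y_1p(a)$, $y_1^*\mapsto y_1^*+p(a)x_1$ and fixing all other arrows. Here $\frac{\partial}{\partial a}$ is the necklace derivative: it is linear, and on a cyclic word $\eta_1\cdots\eta_\ell$ in the letters $a$, $b_{11}$ it equals $\sum_{k:\eta_k=a}\eta_{k+1}\cdots\eta_\ell\eta_1\cdots\eta_{k-1}$. $\mathrm{Tri}^\ell_c=\{\Lambda(p(a)b_{11})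 : p\in\mathbb{C}[a]\}$ (the trivial group if $r=1$, when there is no arrow $y_1$). $P_r$ is the subgroup of $\operatorname{Aut}\mathbb{C}\mathbf{Q}_r$ generated by $\mathrm{Tri}^\ell_c$ and $\mathrm{Aff}_c^{\mathrm{red}}$. *)

theory Defs
  imports
    "HOL-Library.Poly_Mapping"
    "HOL-Computational_Algebra.Polynomial"
    "HOL-Algebra.Bij"
    "HOL-Algebra.Generated_Groups"
    "HOL-Algebra.QuotRing"
    "HOL-Algebra.Module"
    "Graph_Theory.Arc_Walk"
begin

section \<open>The path algebra of a quiver\<close>

text \<open>
  A quiver is a directed multigraph with loops. A path from \<open>u\<close> to \<open>v\<close> is a triple
  \<open>(u, p, v)\<close>, where \<open>p\<close> lists the arrows in the order in which they are traversed. Since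
  paths are multiplied like linear maps, the product \<open>x \<cdot> y\<close> traverses \<open>y\<close> first.
\<close>

type_synonym ('v, 'e) path = "'v \<times> 'e list \<times> 'v"

definition paths :: "('v, 'e) pre_digraph \<Rightarrow> ('v, 'e) path set" where
  "paths G = {(u, p, v). pre_digraph.awalk G u p v}"

definition path_mult ::
  "('v, 'e) path \<Rightarrow> ('v, 'e) path \<Rightarrow> (('v, 'e) path \<Rightarrow>\<^sub>0 complex)" where
  "path_mult x y = (case (x, y) of ((u, p, v), (u', q, v')) \<Rightarrow>
     if u = v' then Poly_Mapping.single (u', q @ p, v) 1 else 0)"

definition scale :: "complex \<Rightarrow> ('k \<Rightarrow>\<^sub>0 complex) \<Rightarrow> ('k \<Rightarrow>\<^sub>0 complex)" where
  "scale c f = Poly_Mapping.map ((*) c) f"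

definition path_algebra ::
  "('v, 'e) pre_digraph \<Rightarrow> (complex, ('v, 'e) path \<Rightarrow>\<^sub>0 complex) module" where
  "path_algebra G =
    \<lparr> carrier = {f. Poly_Mapping.keys f \<subseteq> paths G},
      mult = (\<lambda>f g. \<Sum>x \<in> Poly_Mapping.keys f. \<Sum>y \<in> Poly_Mapping.keys g.
        scale (Poly_Mapping.lookup f x * Poly_Mapping.lookup g y) (path_mult x y)),
      one = (\<Sum>v \<in> verts G. Poly_Mapping.single (v, [], v) 1),
      zero = 0,
      add = (+),
      smult = scale \<rparr>"

definition trivial_path :: "'v \<Rightarrow> (('v, 'e) path \<Rightarrow>\<^sub>0 complex)" where
  "trivial_path v = Poly_Mapping.single (v, [], v) 1"

definition arrow_path ::
  "('v, 'e) pre_digraph \<Rightarrow> 'e \<Rightarrow> (('v, 'e) path \<Rightarrow>\<^sub>0 complex)" where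
  "arrow_path G e = Poly_Mapping.single (tail G e, [e], head G e) 1"

definition commutator :: "('x, 'm) ring_scheme \<Rightarrow> 'x \<Rightarrow> 'x \<Rightarrow> 'x" where
  "commutator R x y = (x \<otimes>\<^bsub>R\<^esub> y) \<ominus>\<^bsub>R\<^esub> (y \<otimes>\<^bsub>R\<^esub> x)"


section \<open>Matrices over a ring\<close>

definition mat_monoid :: "nat \<Rightarrow> ('x, 'm) ring_scheme \<Rightarrow> (nat \<times> nat \<Rightarrow> 'x) monoid" where
  "mat_monoid n R =
    \<lparr> carrier = {1..n} \<times> {1..n} \<rightarrow>\<^sub>E carrier R,
      mult = (\<lambda>M N. \<lambda>(i, k) \<in> {1..n} \<times> {1..n}.
        \<Oplus>\<^bsub>R\<^esub>j \<in> {1..n}. M (i, j) \<otimes>\<^bsub>R\<^esub> N (j, k)),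
      one = (\<lambda>(i, j) \<in> {1..n} \<times> {1..n}. if i = j then \<one>\<^bsub>R\<^esub> else \<zero>\<^bsub>R\<^esub>) \<rparr>"

definition GL :: "nat \<Rightarrow> ('x, 'm) ring_scheme \<Rightarrow> (nat \<times> nat \<Rightarrow> 'x) monoid" where
  "GL n R = units_of (mat_monoid n R)"


section \<open>The quiver and its automorphisms\<close>

datatype vertex = V1 | V2

datatype arrow = Arr_a | Arr_a_star | Arr_b nat | Arr_d nat

fun arrow_tail :: "arrow \<Rightarrow> vertex" where
  "arrow_tail Arr_a = V1"
| "arrow_tail Arr_a_star = V1"
| "arrow_tail (Arr_b _) = V1"
| "arrow_tail (Arr_d _) = V2"

fun arrow_head :: "arrow \<Rightarrow> vertex" where
  "arrow_head Arr_a = V1"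
| "arrow_head Arr_a_star = V1"
| "arrow_head (Arr_b _) = V2"
| "arrow_head (Arr_d _) = V1"

definition Qr :: "nat \<Rightarrow> (vertex, arrow) pre_digraph" where
  "Qr r = \<lparr> verts = {V1, V2},
           arcs = {Arr_a, Arr_a_star} \<union> Arr_b ` {1..r} \<union> Arr_d ` {1..r},
           tail = arrow_tail,
           head = arrow_head \<rparr>"

type_synonym qelem = "(vertex, arrow) path \<Rightarrow>\<^sub>0 complex"

abbreviation CQ :: "nat \<Rightarrow> (complex, qelem) module" where
  "CQ r \<equiv> path_algebra (Qr r)"

abbreviation e1 :: qelem where "e1 \<equiv> trivial_path V1"
abbreviation e2 :: qelem where "e2 \<equiv> trivial_path V2"

definition el_a :: "nat \<Rightarrow> qelem" where "el_a r = arrow_path (Qr r) Arr_a"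
definition el_a_star :: "nat \<Rightarrow> qelem" where "el_a_star r = arrow_path (Qr r) Arr_a_star"
definition el_b :: "nat \<Rightarrow> nat \<Rightarrow> qelem" where "el_b r \<alpha> = arrow_path (Qr r) (Arr_b \<alpha>)"
definition el_d :: "nat \<Rightarrow> nat \<Rightarrow> qelem" where "el_d r \<alpha> = arrow_path (Qr r) (Arr_d \<alpha>)"

definition AutCQ :: "nat \<Rightarrow> (qelem \<Rightarrow> qelem) monoid" where
  "AutCQ r = BijGroup (carrier (CQ r))
    \<lparr> carrier := {\<psi> \<in> Bij (carrier (CQ r)).
        \<psi> \<in> ring_hom (CQ r) (CQ r) \<and>
        (\<forall>c. \<forall>x \<in> carrier (CQ r). \<psi> (c \<odot>\<^bsub>CQ r\<^esub> x) = c \<odot>\<^bsub>CQ r\<^esub> \<psi> x) \<and>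
        \<psi> e1 = e1 \<and> \<psi> e2 = e2} \<rparr>"

definition A1 :: "nat \<Rightarrow> (complex, qelem) module" where
  "A1 r = (CQ r)
    \<lparr> carrier := {e1 \<otimes>\<^bsub>CQ r\<^esub> x \<otimes>\<^bsub>CQ r\<^esub> e1 | x. x \<in> carrier (CQ r)},
      one := e1 \<rparr>"

definition poly_at_a :: "nat \<Rightarrow> complex poly \<Rightarrow> qelem" where
  "poly_at_a r p =
    (\<Oplus>\<^bsub>A1 r\<^esub>k \<in> {..degree p}. coeff p k \<odot>\<^bsub>A1 r\<^esub> (el_a r [^]\<^bsub>A1 r\<^esub> k))"

text \<open>
  The subring \<open>\<complex>[a]\<close> of \<open>A1 r\<close>. As it inherits the operations of \<open>A1 r\<close>, the embedding of
  \<open>GL r (C_a r)\<close> into \<open>GL r (A1 r)\<close> is an inclusion of carriers.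
\<close>

definition C_a :: "nat \<Rightarrow> (complex, qelem) module" where
  "C_a r = (A1 r) \<lparr> carrier := {poly_at_a r p | p. True} \<rparr>"

definition N_mat :: "nat \<Rightarrow> (qelem \<Rightarrow> qelem) \<Rightarrow> (nat \<times> nat \<Rightarrow> qelem)" where
  "N_mat r \<psi> = (THE M. M \<in> carrier (mat_monoid r (A1 r)) \<and>
     (\<forall>\<alpha> \<in> {1..r}. \<psi> (el_b r \<alpha>) = (\<Oplus>\<^bsub>CQ r\<^esub>\<beta> \<in> {1..r}. el_b r \<beta> \<otimes>\<^bsub>CQ r\<^esub> M (\<beta>, \<alpha>))))"


section \<open>Symplectic, reduced and affine automorphisms\<close>

definition el_x :: "nat \<Rightarrow> nat \<Rightarrow> qelem" where "el_x r i = \<ominus>\<^bsub>CQ r\<^esub> el_d r (2 * i - 1)"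
definition el_x_star :: "nat \<Rightarrow> nat \<Rightarrow> qelem" where "el_x_star r i = el_b r (2 * i - 1)"
definition el_y :: "nat \<Rightarrow> nat \<Rightarrow> qelem" where "el_y r j = el_b r (2 * j)"
definition el_y_star :: "nat \<Rightarrow> nat \<Rightarrow> qelem" where "el_y_star r j = el_d r (2 * j)"

text \<open>\<open>(r + 1) div 2\<close> and \<open>r div 2\<close> are the ceiling and the floor of \<open>r / 2\<close>.\<close>

definition el_c :: "nat \<Rightarrow> qelem" where
  "el_c r = commutator (CQ r) (el_a r) (el_a_star r)
    \<oplus>\<^bsub>CQ r\<^esub> (\<Oplus>\<^bsub>CQ r\<^esub>i \<in> {1..(r + 1) div 2}. commutator (CQ r) (el_x r i) (el_x_star r i))
    \<oplus>\<^bsub>CQ r\<^esub> (\<Oplus>\<^bsub>CQ r\<^esub>j \<in> {1..r div 2}. commutator (CQ r) (el_y r j) (el_y_star r j))"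

definition symplectic_aut :: "nat \<Rightarrow> (qelem \<Rightarrow> qelem) \<Rightarrow> bool" where
  "symplectic_aut r \<psi> \<longleftrightarrow> \<psi> (el_c r) = el_c r"

definition ideal_I :: "nat \<Rightarrow> qelem set" where
  "ideal_I r = Idl\<^bsub>CQ r\<^esub> ({e2} \<union> el_d r ` {1..r} \<union> el_b r ` {1..r})"

definition reduced_aut :: "nat \<Rightarrow> (qelem \<Rightarrow> qelem) \<Rightarrow> bool" where
  "reduced_aut r \<psi> \<longleftrightarrow>
     (\<forall>z \<in> carrier (CQ r). ideal_I r +>\<^bsub>CQ r\<^esub> \<psi> z = ideal_I r +>\<^bsub>CQ r\<^esub> z)"

definition affine_aut :: "nat \<Rightarrow> (qelem \<Rightarrow> qelem) \<Rightarrow> bool" where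
  "affine_aut r \<psi> \<longleftrightarrow> (\<forall>\<eta> \<in> arcs (Qr r).
     Poly_Mapping.keys (\<psi> (arrow_path (Qr r) \<eta>)) \<subseteq> {(u, p, v) \<in> paths (Qr r). length p \<le> 1})"

definition Aff_c_red :: "nat \<Rightarrow> (qelem \<Rightarrow> qelem) set" where
  "Aff_c_red r = {\<psi> \<in> carrier (AutCQ r). affine_aut r \<psi> \<and> symplectic_aut r \<psi> \<and> reduced_aut r \<psi>}"


section \<open>The automorphisms \<open>\<Lambda>(p(a) b\<^sub>1\<^sub>1)\<close>\<close>

datatype letter = Letter_a | Letter_b11

text \<open>
  The necklace derivative with respect to \<open>a\<close> on linear combinations of words in the letters
  \<open>a\<close> and \<open>b\<^sub>1\<^sub>1\<close>; its value on a word depends only on the word up to rotation.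
\<close>

definition necklace_deriv_a ::
  "(letter list \<Rightarrow>\<^sub>0 complex) \<Rightarrow> (letter list \<Rightarrow>\<^sub>0 complex)" where
  "necklace_deriv_a f = (\<Sum>w \<in> Poly_Mapping.keys f.
     \<Sum>k \<in> {k. k < length w \<and> w ! k = Letter_a}.
       Poly_Mapping.single (drop (Suc k) w @ take k w) (Poly_Mapping.lookup f w))"

fun letter_val :: "nat \<Rightarrow> letter \<Rightarrow> qelem" where
  "letter_val r Letter_a = el_a r"
| "letter_val r Letter_b11 = el_x r 1 \<otimes>\<^bsub>CQ r\<^esub> el_y r 1"

definition word_val :: "nat \<Rightarrow> letter list \<Rightarrow> qelem" where
  "word_val r w = foldr (\<lambda>l z. letter_val r l \<otimes>\<^bsub>CQ r\<^esub> z) w e1"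

definition letters_val :: "nat \<Rightarrow> (letter list \<Rightarrow>\<^sub>0 complex) \<Rightarrow> qelem" where
  "letters_val r f =
    (\<Oplus>\<^bsub>CQ r\<^esub>w \<in> Poly_Mapping.keys f. Poly_Mapping.lookup f w \<odot>\<^bsub>CQ r\<^esub> word_val r w)"

definition p_b11 :: "complex poly \<Rightarrow> (letter list \<Rightarrow>\<^sub>0 complex)" where
  "p_b11 p =
    (\<Sum>k \<le> degree p. Poly_Mapping.single (replicate k Letter_a @ [Letter_b11]) (coeff p k))"

text \<open>
  An automorphism is determined by its values on the arrows, so the following description is
  unique; the arrows \<open>Arr_b 1\<close> and \<open>Arr_d 2\<close> are \<open>x\<^sub>1\<^sup>*\<close> and \<open>y\<^sub>1\<^sup>*\<close>. It is only used for \<open>r \<ge> 2\<close>.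
\<close>

definition Lambda :: "nat \<Rightarrow> complex poly \<Rightarrow> (qelem \<Rightarrow> qelem)" where
  "Lambda r p = (THE \<psi>. \<psi> \<in> carrier (AutCQ r) \<and> symplectic_aut r \<psi> \<and>
     \<psi> (el_a_star r) = el_a_star r \<oplus>\<^bsub>CQ r\<^esub> letters_val r (necklace_deriv_a (p_b11 p)) \<and>
     \<psi> (el_x_star r 1) = el_x_star r 1 \<oplus>\<^bsub>CQ r\<^esub> (el_y r 1 \<otimes>\<^bsub>CQ r\<^esub> poly_at_a r p) \<and>
     \<psi> (el_y_star r 1) = el_y_star r 1 \<oplus>\<^bsub>CQ r\<^esub> (poly_at_a r p \<otimes>\<^bsub>CQ r\<^esub> el_x r 1) \<and>
     (\<forall>\<eta> \<in> arcs (Qr r) - {Arr_a_star, Arr_b 1, Arr_d 2}.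
        \<psi> (arrow_path (Qr r) \<eta>) = arrow_path (Qr r) \<eta>))"

definition Tri_l_c :: "nat \<Rightarrow> (qelem \<Rightarrow> qelem) set" where
  "Tri_l_c r = (if 2 \<le> r then {Lambda r p | p. True} else {\<one>\<^bsub>AutCQ r\<^esub>})"

definition P_group :: "nat \<Rightarrow> (qelem \<Rightarrow> qelem) monoid" where
  "P_group r = (AutCQ r) \<lparr> carrier := generate (AutCQ r) (Tri_l_c r \<union> Aff_c_red r) \<rparr>"

end

theory Submission
  imports "Jordan_Normal_Form.Determinant" Defs
begin

text \<open>
  The element \<open>c\<^sub>r\<close> equals \<open>[a, a\<^sup>*] + \<Sum> (b\<^sub>\<alpha> d\<^sub>\<alpha> - d\<^sub>\<alpha> b\<^sub>\<alpha>)\<close>. The automorphisms that are symplectic,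
  reduced, fix \<open>a\<close> and act on the \<open>b\<^sub>\<alpha>\<close> by a matrix in \<open>GL\<^sub>r(\<complex>[a])\<close> form a group containing the
  generators of \<open>P\<^sub>r\<close>, and on this group \<open>N\<close> is multiplicative because \<open>\<complex>[a]\<close> is fixed.
  It is also injective there: the component of \<open>c\<^sub>r\<close> at the vertex 2 determines the images of the
  \<open>d\<^sub>\<alpha>\<close>, and the component at the vertex 1 then determines the image of \<open>a\<^sup>*\<close> up to an element
  commuting with \<open>a\<close>, that is, up to a polynomial in \<open>a\<close>, which vanishes by reducedness.
  For surjectivity, the affine automorphisms realise \<open>GL\<^sub>r(\<complex>)\<close> and \<open>\<Lambda>(p(a) b\<^sub>1\<^sub>1)\<close> realises the
  elementary matrix \<open>1 + p E\<^sub>2\<^sub>1\<close>; conjugating by permutation matrices gives all elementary matrices,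
  and these together with the constant diagonal matrices generate \<open>GL\<^sub>r(\<complex>[a])\<close>, since \<open>\<complex>[a]\<close> is
  Euclidean.
\<close>

section \<open>Linear extension and the path product\<close>

text \<open>For a matrix A over \<complex>[a] with inverse B, replacing the row of the
  \<open>b\<close> by its product with A and the column of the \<open>d\<close> by its product with
  B preserves the sum of the \<open>b\<^sub>\<alpha> d\<^sub>\<alpha>\<close>, but in general not
  that of the \<open>d\<^sub>\<alpha> b\<^sub>\<alpha>\<close>, since polynomials in
  \<open>a\<close> do not commute with the cycles \<open>d\<^sub>\<alpha> b\<^sub>\<beta>\<close>.
  Hence \<open>a\<^sup>*\<close> must move as well, by some q at the vertex 1 whose commutator with
  \<open>a\<close> is this defect. A formula for q is required only on generators: q = 0 serves
  constant matrices, whose entries move freely past all arrows, and the necklace derivative serves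
  \<open>1 + p E\<^sub>2\<^sub>1\<close>; composition supplies the remaining matrices. Reducedness
  is what makes the kernel trivial: the map sending \<open>a\<^sup>*\<close> to
  \<open>a\<^sup>* + f(a)\<close> and fixing all other arrows is symplectic and has the identity
  matrix.\<close>

definition lin_ext :: "('k \<Rightarrow> ('l \<Rightarrow>\<^sub>0 complex)) \<Rightarrow> ('k \<Rightarrow>\<^sub>0 complex) \<Rightarrow> ('l \<Rightarrow>\<^sub>0 complex)" where
  "lin_ext h f = (\<Sum>x\<in>Poly_Mapping.keys f. scale (Poly_Mapping.lookup f x) (h x))"

lemma lookup_scale [simp]: "Poly_Mapping.lookup (scale c f) x = c * Poly_Mapping.lookup f x"
  by (simp add: scale_def Poly_Mapping.map.rep_eq when_def)

lemma scale_simps [simp]: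
  "scale c 0 = 0" "scale 0 f = 0" "scale 1 f = f" "scale c (scale d f) = scale (c * d) f"
  "scale c (Poly_Mapping.single x d) = Poly_Mapping.single x (c * d)"
  by (auto intro!: poly_mapping_eqI simp: lookup_single when_def)

lemma scale_add_right: "scale c (f + g) = scale c f + scale c g"
  and scale_add_left: "scale (c + d) f = scale c f + scale d f"
  and scale_minus_left: "scale (- c) f = - scale c f"
  and scale_diff_right: "scale c (f - g) = scale c f - scale c g"
  by (auto intro!: poly_mapping_eqI simp: lookup_add lookup_minus algebra_simps)

lemma scale_sum_right: "scale c (sum F A) = (\<Sum>x\<in>A. scale c (F x))"
  by (induction A rule: infinite_finite_induct) (auto simp: scale_add_right)

lemma keys_scale_subset: "Poly_Mapping.keys (scale c f) \<subseteq> Poly_Mapping.keys f"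
  by (auto simp: in_keys_iff)

lemma lin_ext_superset:
  assumes "finite S" "Poly_Mapping.keys f \<subseteq> S"
  shows "lin_ext h f = (\<Sum>x\<in>S. scale (Poly_Mapping.lookup f x) (h x))"
  unfolding lin_ext_def
  by (rule sum.mono_neutral_left) (use assms in \<open>auto simp: in_keys_iff\<close>)

lemma lin_ext_single [simp]: "lin_ext h (Poly_Mapping.single x c) = scale c (h x)"
  by (subst lin_ext_superset[of "{x}"]) auto

lemma lin_ext_add: "lin_ext h (f + g) = lin_ext h f + lin_ext h g"
proof -
  let ?S = "Poly_Mapping.keys f \<union> Poly_Mapping.keys g"
  have "Poly_Mapping.keys (f + g) \<subseteq> ?S" by (rule Poly_Mapping.keys_add)
  then show ?thesis
    by (simp add: lin_ext_superset[of ?S] lookup_add scale_add_left sum.distrib)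
qed

lemma lin_ext_scale: "lin_ext h (scale c f) = scale c (lin_ext h f)"
  by (simp add: lin_ext_superset[OF _ keys_scale_subset] scale_sum_right)
    (simp add: lin_ext_def scale_sum_right)

lemma lin_ext_cong:
  "(\<And>x. x \<in> Poly_Mapping.keys f \<Longrightarrow> h x = h' x) \<Longrightarrow> lin_ext h f = lin_ext h' f"
  by (simp add: lin_ext_def)

lemma poly_mapping_eq_lin_ext: "lin_ext (\<lambda>x. Poly_Mapping.single x 1) f = f"
proof (rule poly_mapping_eqI)
  fix k
  show "Poly_Mapping.lookup (lin_ext (\<lambda>x. Poly_Mapping.single x 1) f) k = Poly_Mapping.lookup f k"
    by (cases "k \<in> Poly_Mapping.keys f")
      (auto simp: lin_ext_def lookup_sum lookup_single when_def in_keys_iff sum.delta)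
qed

section \<open>Linear maps and their determination by values on basis elements\<close>

definition linear_map :: "(('k \<Rightarrow>\<^sub>0 complex) \<Rightarrow> ('l \<Rightarrow>\<^sub>0 complex)) \<Rightarrow> bool" where
  "linear_map F \<longleftrightarrow> (\<forall>f g. F (f + g) = F f + F g) \<and> (\<forall>c f. F (scale c f) = scale c (F f))"

lemma linear_map_lin_ext: "linear_map (lin_ext h)"
  by (simp add: linear_map_def lin_ext_add lin_ext_scale)

lemma linear_mapD:
  assumes "linear_map F"
  shows "F (f + g) = F f + F g" "F (scale c f) = scale c (F f)"
  using assms by (auto simp: linear_map_def)

lemma linear_map_simps:
  assumes "linear_map F"
  shows "F 0 = 0" "F (- f) = - F f" "F (f - g) = F f - F g"
    "F (sum H A) = (\<Sum>x\<in>A. F (H x))"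
proof -
  show 0: "F 0 = 0"
    using linear_mapD(2)[OF assms, of 0 0] by simp
  show m: "F (- f) = - F f" for f
    using linear_mapD(2)[OF assms, of "-1" f] by (simp add: scale_minus_left)
  show "F (f - g) = F f - F g"
    using linear_mapD(1)[OF assms, of f "- g"] by (simp add: m)
  show "F (sum H A) = (\<Sum>x\<in>A. F (H x))"
    by (induction A rule: infinite_finite_induct) (auto simp: 0 linear_mapD(1)[OF assms])
qed

lemma linear_map_eq_lin_ext:
  assumes "linear_map F"
  shows "F f = lin_ext (\<lambda>x. F (Poly_Mapping.single x 1)) f"
proof -
  have "F f = F (lin_ext (\<lambda>x. Poly_Mapping.single x 1) f)"
    by (simp add: poly_mapping_eq_lin_ext)
  also have "\<dots> = lin_ext (\<lambda>x. F (Poly_Mapping.single x 1)) f"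
    unfolding lin_ext_def by (simp add: linear_map_simps[OF assms] linear_mapD[OF assms]
        del: scale_simps(5))
  finally show ?thesis .
qed

text \<open>Agreement is asked for only on the keys of \<open>f\<close>, so for \<open>f\<close> in
  a path algebra one may assume that the basis element is a genuine path. All multilinear identities
  below are reduced to single paths in this way.\<close>

lemma linear_map_eqI:
  assumes "linear_map F" "linear_map F'"
    and "\<And>x. x \<in> Poly_Mapping.keys f \<Longrightarrow> F (Poly_Mapping.single x 1) = F' (Poly_Mapping.single x 1)"
  shows "F f = F' f"
  unfolding linear_map_eq_lin_ext[OF assms(1), of f] linear_map_eq_lin_ext[OF assms(2), of f]
  by (rule lin_ext_cong) (rule assms(3))

section \<open>The product of paths, extended bilinearly\<close>

definition pmul ::
  "(('v, 'e) path \<Rightarrow>\<^sub>0 complex) \<Rightarrow> (('v, 'e) path \<Rightarrow>\<^sub>0 complex) \<Rightarrow> (('v, 'e) path \<Rightarrow>\<^sub>0 complex)"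
  (infixl \<open>\<star>\<close> 70) where
  "f \<star> g = lin_ext (\<lambda>x. lin_ext (path_mult x) g) f"

lemma pmul_eq_sum:
  "f \<star> g = (\<Sum>x \<in> Poly_Mapping.keys f. \<Sum>y \<in> Poly_Mapping.keys g.
        scale (Poly_Mapping.lookup f x * Poly_Mapping.lookup g y) (path_mult x y))"
  by (simp add: pmul_def lin_ext_def scale_sum_right)

lemma linear_map_pmul_left: "linear_map (\<lambda>f. f \<star> g)"
  unfolding pmul_def by (rule linear_map_lin_ext)

lemma linear_map_pmul_right: "linear_map (\<lambda>g. f \<star> g)"
  unfolding linear_map_def pmul_def
  by (auto simp: lin_ext_def [of _ f] lin_ext_add lin_ext_scale scale_add_right
      scale_sum_right sum.distrib ac_simps)

lemmas pmul_linear [simp] =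
  linear_map_simps(1,2)[OF linear_map_pmul_left] linear_map_simps(1,2)[OF linear_map_pmul_right]
  linear_mapD(2)[OF linear_map_pmul_left] linear_mapD(2)[OF linear_map_pmul_right]

lemmas pmul_distrib =
  linear_mapD(1)[OF linear_map_pmul_left] linear_map_simps(3)[OF linear_map_pmul_left]
  linear_mapD(1)[OF linear_map_pmul_right] linear_map_simps(3)[OF linear_map_pmul_right]

lemmas sum_pmul = linear_map_simps(4)[OF linear_map_pmul_left]
  and pmul_sum = linear_map_simps(4)[OF linear_map_pmul_right]

lemma pmul_single [simp]:
  "Poly_Mapping.single x c \<star> Poly_Mapping.single y d = scale (c * d) (path_mult x y)"
  by (simp add: pmul_def)

lemma path_mult_simp:
  "path_mult (u, p, v) (u', q, v') = (if u = v' then Poly_Mapping.single (u', q @ p, v) 1 else 0)"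
  by (simp add: path_mult_def)

text \<open>\<open>path_mult\<close> concatenates arbitrary triples with matching end vertices, so
  associativity holds for all finitely supported functions; linearity in each of the three factors
  reduces it to concatenation of lists.\<close>

lemma pmul_assoc: "(f \<star> g) \<star> h = f \<star> (g \<star> h)"
proof (rule linear_map_eqI[of "\<lambda>f. (f \<star> g) \<star> h" "\<lambda>f. f \<star> (g \<star> h)"])
  fix x :: "('a, 'b) path"
  let ?s = "\<lambda>z. Poly_Mapping.single (z :: ('a, 'b) path) (1 :: complex)"
  show "(?s x \<star> g) \<star> h = ?s x \<star> (g \<star> h)"
  proof (rule linear_map_eqI[of "\<lambda>g. (?s x \<star> g) \<star> h" "\<lambda>g. ?s x \<star> (g \<star> h)"])
    fix y
    show "(?s x \<star> ?s y) \<star> h = ?s x \<star> (?s y \<star> h)"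
    proof (rule linear_map_eqI[of "\<lambda>h. (?s x \<star> ?s y) \<star> h" "\<lambda>h. ?s x \<star> (?s y \<star> h)"])
      fix z
      show "(?s x \<star> ?s y) \<star> ?s z = ?s x \<star> (?s y \<star> ?s z)"
        by (cases x; cases y; cases z) (simp add: path_mult_simp)
    qed (auto simp: linear_map_def pmul_distrib)
  qed (auto simp: linear_map_def pmul_distrib)
qed (auto simp: linear_map_def pmul_distrib)

lemma keys_pmul:
  assumes "z \<in> Poly_Mapping.keys (f \<star> g)"
  obtains u q w p v where "z = (u, q @ p, v)" "(w, p, v) \<in> Poly_Mapping.keys f"
    "(u, q, w) \<in> Poly_Mapping.keys g"
proof -
  have "Poly_Mapping.lookup (f \<star> g) z \<noteq> 0" using assms by (simp add: in_keys_iff)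
  then obtain x y where xy: "x \<in> Poly_Mapping.keys f" "y \<in> Poly_Mapping.keys g"
    "Poly_Mapping.lookup (path_mult x y) z \<noteq> 0"
    by (auto simp: pmul_eq_sum lookup_sum elim!: sum.not_neutral_contains_not_neutral)
  obtain w p v u q w' where "x = (w, p, v)" "y = (u, q, w')" by (metis prod_cases3)
  with xy that show thesis
    by (auto simp: path_mult_simp lookup_single when_def split: if_splits)
qed

abbreviation coef :: "('k \<Rightarrow>\<^sub>0 complex) \<Rightarrow> 'k \<Rightarrow> complex" where
  "coef \<equiv> Poly_Mapping.lookup"

text \<open>Words list the arrows in order of traversal, so a left factor \<open>p\<close> becomes a
  suffix of the word and a right factor, as in \<open>coef_pmul_single\<close>, a prefix.\<close>

lemma coef_single_pmul:
  "coef (Poly_Mapping.single (s, p, t) 1 \<star> m) (u, w, v) =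
     (if v = t \<and> (\<exists>w'. w = w' @ p) then coef m (u, take (length w - length p) w, s) else 0)"
proof -
  \<comment> \<open>\<open>linear_map_eqI\<close> compares maps into finitely supported functions,
    so the scalar coefficient is wrapped as a multiple of one fixed basis element.\<close>
  let ?L = "\<lambda>m. Poly_Mapping.single (u, w, v) (coef (Poly_Mapping.single (s, p, t) 1 \<star> m) (u, w, v))"
  let ?R = "\<lambda>m. Poly_Mapping.single (u, w, v) (if v = t \<and> (\<exists>w'. w = w' @ p) then coef m (u, take (length w - length p) w, s) else 0)"
  have "?L m = ?R m"
  proof (rule linear_map_eqI[of ?L ?R])
    show "linear_map ?L" "linear_map ?R"
      by (auto simp: linear_map_def pmul_distrib lookup_add single_add)
    fix x
    show "?L (Poly_Mapping.single x 1) = ?R (Poly_Mapping.single x 1)"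
      by (cases x) (auto simp: path_mult_simp lookup_single when_def)
  qed
  from arg_cong[OF this, of "\<lambda>f. coef f (u, w, v)"] show ?thesis by simp
qed

lemma coef_pmul_single:
  "coef (m \<star> Poly_Mapping.single (s, p, t) 1) (u, w, v) =
     (if u = s \<and> (\<exists>w'. w = p @ w') then coef m (t, drop (length p) w, v) else 0)"
proof -
  let ?L = "\<lambda>m. Poly_Mapping.single (u, w, v) (coef (m \<star> Poly_Mapping.single (s, p, t) 1) (u, w, v))"
  let ?R = "\<lambda>m. Poly_Mapping.single (u, w, v) (if u = s \<and> (\<exists>w'. w = p @ w') then coef m (t, drop (length p) w, v) else 0)"
  have "?L m = ?R m"
  proof (rule linear_map_eqI[of ?L ?R])
    show "linear_map ?L" "linear_map ?R"
      by (auto simp: linear_map_def pmul_distrib lookup_add single_add)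
    fix x
    show "?L (Poly_Mapping.single x 1) = ?R (Poly_Mapping.single x 1)"
      by (cases x) (auto simp: path_mult_simp lookup_single when_def)
  qed
  from arg_cong[OF this, of "\<lambda>f. coef f (u, w, v)"] show ?thesis by simp
qed

section \<open>The path algebra as a ring\<close>

text \<open>The definitions sum in the algebraic structures \<open>CQ r\<close>, \<open>A1 r\<close>
  and \<open>C_a r\<close>; this lets the proofs compute with type-class sums in all three.\<close>

lemma finsum_eq_sum:
  fixes F :: "'i \<Rightarrow> 'x :: comm_monoid_add"
  assumes "abelian_monoid R" "add R = (+)" "zero R = 0" "F \<in> A \<rightarrow> carrier R"
  shows "finsum R F A = sum F A"
proof -
  interpret abelian_monoid R by fact
  show ?thesis using assms(4)
    by (induction A rule: infinite_finite_induct) (auto simp: assms(2,3))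
qed

lemma Qr_simps [simp]:
  "tail (Qr r) = arrow_tail" "head (Qr r) = arrow_head" "verts (Qr r) = {V1, V2}"
  "arcs (Qr r) = {Arr_a, Arr_a_star} \<union> Arr_b ` {1..r} \<union> Arr_d ` {1..r}"
  by (simp_all add: Qr_def)

lemma vertex_UNIV: "v \<in> {V1, V2}"
  by (cases v) auto

fun qcas :: "vertex \<Rightarrow> arrow list \<Rightarrow> vertex \<Rightarrow> bool" where
  "qcas u [] v \<longleftrightarrow> u = v"
| "qcas u (e # p) v \<longleftrightarrow> arrow_tail e = u \<and> qcas (arrow_head e) p v"

lemma cas_Qr: "pre_digraph.cas (Qr r) u p v = qcas u p v"
  by (induction p arbitrary: u) (auto simp: pre_digraph.cas.simps)

lemma qcas_append: "qcas u (p @ q) v \<longleftrightarrow> (\<exists>w. qcas u p w \<and> qcas w q v)"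
  by (induction p arbitrary: u) auto

lemma mem_paths_Qr: "(u, p, v) \<in> paths (Qr r) \<longleftrightarrow> set p \<subseteq> arcs (Qr r) \<and> qcas u p v"
  using vertex_UNIV[of u] by (auto simp: paths_def pre_digraph.awalk_def cas_Qr)

lemma CQ_simps [simp]:
  "mult (CQ r) = (\<star>)" "add (CQ r) = (+)" "zero (CQ r) = 0" "Module.smult (CQ r) = scale"
  "one (CQ r) = e1 + e2"
  by (auto simp: path_algebra_def pmul_eq_sum fun_eq_iff trivial_path_def)

lemma carrier_CQ: "f \<in> carrier (CQ r) \<longleftrightarrow> Poly_Mapping.keys f \<subseteq> paths (Qr r)"
  by (simp add: path_algebra_def)

lemma trivial_path_mult [simp]:
  "trivial_path u \<star> trivial_path v = (if u = v then trivial_path u else 0)"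
  by (simp add: trivial_path_def path_mult_simp)

lemma trivial_path_mult' [simp]:
  "trivial_path u \<star> (trivial_path v \<star> f) = (if u = v then trivial_path u \<star> f else 0)"
  by (simp add: pmul_assoc[symmetric])

lemma one_pmul: "(e1 + e2) \<star> f = (f :: qelem)"
proof (rule linear_map_eqI[of "\<lambda>f. (e1 + e2) \<star> f" "\<lambda>f. f"])
  fix x
  show "(e1 + e2) \<star> Poly_Mapping.single x 1 = Poly_Mapping.single x 1"
    by (cases x; cases "snd (snd x)") (auto simp: pmul_distrib trivial_path_def path_mult_simp)
qed (auto simp: linear_map_def pmul_distrib scale_add_right)

lemma pmul_one: "f \<star> (e1 + e2) = (f :: qelem)"
proof (rule linear_map_eqI[of "\<lambda>f. f \<star> (e1 + e2)" "\<lambda>f. f"])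
  fix x
  show "Poly_Mapping.single x 1 \<star> (e1 + e2) = Poly_Mapping.single x 1"
    by (cases x; cases "fst x") (auto simp: pmul_distrib trivial_path_def path_mult_simp)
qed (auto simp: linear_map_def pmul_distrib scale_add_right)

lemma carrier_closed [simp]:
  "0 \<in> carrier (CQ r)"
  "f \<in> carrier (CQ r) \<Longrightarrow> g \<in> carrier (CQ r) \<Longrightarrow> f + g \<in> carrier (CQ r)"
  "f \<in> carrier (CQ r) \<Longrightarrow> - f \<in> carrier (CQ r)"
  "f \<in> carrier (CQ r) \<Longrightarrow> g \<in> carrier (CQ r) \<Longrightarrow> f - g \<in> carrier (CQ r)"
  "f \<in> carrier (CQ r) \<Longrightarrow> scale c f \<in> carrier (CQ r)"
  unfolding carrier_CQ
  using Poly_Mapping.keys_add[of f g] Poly_Mapping.keys_add[of f "- g"] keys_scale_subset[of c f]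
  by (auto simp: keys.rep_eq)

lemma carrier_sum [simp]:
  "(\<And>x. x \<in> A \<Longrightarrow> F x \<in> carrier (CQ r)) \<Longrightarrow> sum F A \<in> carrier (CQ r)"
  by (induction A rule: infinite_finite_induct) auto

lemma carrier_pmul [simp]:
  assumes "f \<in> carrier (CQ r)" "g \<in> carrier (CQ r)"
  shows "f \<star> g \<in> carrier (CQ r)"
  unfolding carrier_CQ
proof
  fix z assume "z \<in> Poly_Mapping.keys (f \<star> g)"
  then obtain u q w p v where z: "z = (u, q @ p, v)" "(w, p, v) \<in> Poly_Mapping.keys f"
    "(u, q, w) \<in> Poly_Mapping.keys g" by (rule keys_pmul)
  then have "(w, p, v) \<in> paths (Qr r)" "(u, q, w) \<in> paths (Qr r)"
    using assms by (auto simp: carrier_CQ)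
  then show "z \<in> paths (Qr r)"
    unfolding z mem_paths_Qr by (auto simp: qcas_append)
qed

lemma carrier_single:
  "Poly_Mapping.single (u, p, v) 1 \<in> carrier (CQ r) \<longleftrightarrow> set p \<subseteq> arcs (Qr r) \<and> qcas u p v"
  by (simp add: carrier_CQ mem_paths_Qr del: Qr_simps)

lemma carrier_trivial [simp]: "trivial_path v \<in> carrier (CQ r)"
  by (simp add: trivial_path_def carrier_single)

lemma abelian_groupI_add:
  fixes R :: "('x :: ab_group_add, 'm) ring_scheme"
  assumes "add R = (+)" "zero R = 0" "0 \<in> carrier R"
    "\<And>f g. f \<in> carrier R \<Longrightarrow> g \<in> carrier R \<Longrightarrow> f + g \<in> carrier R"
    "\<And>f. f \<in> carrier R \<Longrightarrow> - f \<in> carrier R"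
  shows "abelian_group R"
  by (rule abelian_groupI) (use assms in \<open>auto simp: ac_simps intro: bexI[of _ "- _"]\<close>)

lemma ring_CQ: "ring (CQ r)"
proof (rule ringI)
  show "abelian_group (CQ r)" by (rule abelian_groupI_add) auto
  show "monoid (CQ r)" by (rule monoidI) (auto simp: pmul_assoc one_pmul pmul_one)
qed (auto simp: pmul_distrib)

lemma abelian_monoid_CQ: "abelian_monoid (CQ r)"
  using ring_CQ by (simp add: ring_def abelian_group_def)

lemma a_inv_CQ:
  assumes "f \<in> carrier (CQ r)"
  shows "\<ominus>\<^bsub>CQ r\<^esub> f = - f"
proof -
  interpret ring "CQ r" by (rule ring_CQ)
  show ?thesis by (rule minus_equality) (use assms in auto)
qed

lemma commutator_CQ:
  assumes "f \<in> carrier (CQ r)" "g \<in> carrier (CQ r)"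
  shows "commutator (CQ r) f g = f \<star> g - g \<star> f"
  using assms by (simp add: commutator_def a_minus_def a_inv_CQ)

lemma finsum_CQ: "F \<in> A \<rightarrow> carrier (CQ r) \<Longrightarrow> finsum (CQ r) F A = sum F A"
  by (rule finsum_eq_sum) (auto simp: abelian_monoid_CQ)


section \<open>Homomorphisms out of the path algebra\<close>

definition arr :: "arrow \<Rightarrow> qelem" where
  "arr \<eta> = Poly_Mapping.single (arrow_tail \<eta>, [\<eta>], arrow_head \<eta>) 1"

lemma arrow_path_Qr: "arrow_path (Qr r) = arr"
  by (simp add: arrow_path_def arr_def fun_eq_iff)

lemma carrier_arr [simp]: "\<eta> \<in> arcs (Qr r) \<Longrightarrow> arr \<eta> \<in> carrier (CQ r)"
  by (simp add: arr_def carrier_single del: Qr_simps)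

lemma trivial_arr: "trivial_path u \<star> arr \<eta> = (if u = arrow_head \<eta> then arr \<eta> else 0)"
  and arr_trivial: "arr \<eta> \<star> trivial_path u = (if u = arrow_tail \<eta> then arr \<eta> else 0)"
  by (auto simp: trivial_path_def arr_def path_mult_simp)

lemma single_Cons_path:
  "arrow_tail e = u \<Longrightarrow>
    Poly_Mapping.single (u, e # p, v) 1 = Poly_Mapping.single (arrow_head e, p, v) 1 \<star> arr e"
  by (simp add: arr_def path_mult_simp)

text \<open>The conditions of \<open>AutCQ\<close> without bijectivity and without fixing the value
  outside the carrier. Maps such as \<open>path_hom A\<close> can then be composed freely and are
  restricted only when an element of \<open>AutCQ r\<close> is formed.\<close>

definition endo :: "nat \<Rightarrow> (qelem \<Rightarrow> qelem) \<Rightarrow> bool" where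
  "endo r \<psi> \<longleftrightarrow> \<psi> \<in> ring_hom (CQ r) (CQ r) \<and>
        (\<forall>c. \<forall>x \<in> carrier (CQ r). \<psi> (scale c x) = scale c (\<psi> x)) \<and>
        \<psi> e1 = e1 \<and> \<psi> e2 = e2"

lemma AutCQ_iff: "\<psi> \<in> carrier (AutCQ r) \<longleftrightarrow> \<psi> \<in> Bij (carrier (CQ r)) \<and> endo r \<psi>"
  by (auto simp: AutCQ_def endo_def)

lemma endoI:
  assumes "\<And>f. f \<in> carrier (CQ r) \<Longrightarrow> \<psi> f \<in> carrier (CQ r)"
    "\<And>f g. f \<in> carrier (CQ r) \<Longrightarrow> g \<in> carrier (CQ r) \<Longrightarrow> \<psi> (f + g) = \<psi> f + \<psi> g"
    "\<And>f g. f \<in> carrier (CQ r) \<Longrightarrow> g \<in> carrier (CQ r) \<Longrightarrow> \<psi> (f \<star> g) = \<psi> f \<star> \<psi> g"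
    "\<And>c f. f \<in> carrier (CQ r) \<Longrightarrow> \<psi> (scale c f) = scale c (\<psi> f)"
    "\<And>u. \<psi> (trivial_path u) = trivial_path u"
  shows "endo r \<psi>"
  using assms by (auto simp: endo_def ring_hom_def)

lemma endoD:
  assumes "endo r \<psi>"
  shows "f \<in> carrier (CQ r) \<Longrightarrow> \<psi> f \<in> carrier (CQ r)"
    "f \<in> carrier (CQ r) \<Longrightarrow> g \<in> carrier (CQ r) \<Longrightarrow> \<psi> (f + g) = \<psi> f + \<psi> g"
    "f \<in> carrier (CQ r) \<Longrightarrow> g \<in> carrier (CQ r) \<Longrightarrow> \<psi> (f \<star> g) = \<psi> f \<star> \<psi> g"
    "f \<in> carrier (CQ r) \<Longrightarrow> \<psi> (scale c f) = scale c (\<psi> f)"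
    "\<psi> (trivial_path u) = trivial_path u"
  using assms by (cases u; auto simp: endo_def ring_hom_def)+

lemma endo_simps:
  assumes "endo r \<psi>"
  shows "\<psi> 0 = 0" "f \<in> carrier (CQ r) \<Longrightarrow> \<psi> (- f) = - \<psi> f"
    "f \<in> carrier (CQ r) \<Longrightarrow> g \<in> carrier (CQ r) \<Longrightarrow> \<psi> (f - g) = \<psi> f - \<psi> g"
    "(\<And>x. x \<in> A \<Longrightarrow> F x \<in> carrier (CQ r)) \<Longrightarrow> \<psi> (sum F A) = (\<Sum>x\<in>A. \<psi> (F x))"
proof -
  show 0: "\<psi> 0 = 0" using endoD(4)[OF assms, of 0 0] by simp
  show m: "f \<in> carrier (CQ r) \<Longrightarrow> \<psi> (- f) = - \<psi> f" for f
    using endoD(4)[OF assms, of f "-1"] by (simp add: scale_minus_left)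
  show "f \<in> carrier (CQ r) \<Longrightarrow> g \<in> carrier (CQ r) \<Longrightarrow> \<psi> (f - g) = \<psi> f - \<psi> g"
    using endoD(2)[OF assms, of f "- g"] by (simp add: m)
  show "(\<And>x. x \<in> A \<Longrightarrow> F x \<in> carrier (CQ r)) \<Longrightarrow> \<psi> (sum F A) = (\<Sum>x\<in>A. \<psi> (F x))"
    by (induction A rule: infinite_finite_induct) (auto simp: 0 endoD(2)[OF assms])
qed

lemma endo_comp:
  assumes "endo r \<psi>" "endo r \<phi>"
  shows "endo r (\<lambda>x. \<psi> (\<phi> x))"
  by (rule endoI) (use assms in \<open>auto simp: endoD\<close>)

lemma endo_id: "endo r (\<lambda>x. x)"
  by (rule endoI) auto

lemma endo_cong:
  assumes "endo r \<psi>" "\<And>f. f \<in> carrier (CQ r) \<Longrightarrow> \<phi> f = \<psi> f"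
  shows "endo r \<phi>"
  by (rule endoI) (use assms in \<open>auto simp: endoD\<close>)

text \<open>The arrow traversed first is the rightmost factor. The end vertex is not an argument,
  because the start vertex and the word determine it on a genuine path.\<close>

fun word_ev :: "(arrow \<Rightarrow> qelem) \<Rightarrow> vertex \<Rightarrow> arrow list \<Rightarrow> qelem" where
  "word_ev A u [] = trivial_path u"
| "word_ev A u (e # p) = word_ev A (arrow_head e) p \<star> A e"

definition path_hom :: "(arrow \<Rightarrow> qelem) \<Rightarrow> qelem \<Rightarrow> qelem" where
  "path_hom A = lin_ext (\<lambda>(u, p, v). word_ev A u p)"

text \<open>The uniqueness half of the universal property of the path algebra: a path is a product
  of arrows, and the empty path is an idempotent, which is fixed.\<close>

lemma endo_eq_path_hom:
  assumes "endo r \<psi>" "f \<in> carrier (CQ r)"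
  shows "\<psi> f = path_hom (\<lambda>\<eta>. \<psi> (arr \<eta>)) f"
proof -
  let ?A = "\<lambda>\<eta>. \<psi> (arr \<eta>)"
  have word: "\<psi> (Poly_Mapping.single (u, p, v) 1) = word_ev ?A u p"
    if "set p \<subseteq> arcs (Qr r)" "qcas u p v" for u p v
    using that
  proof (induction p arbitrary: u)
    case Nil
    then show ?case using endoD(5)[OF assms(1), of u] by (simp add: trivial_path_def)
  next
    case (Cons e p)
    then have "\<psi> (Poly_Mapping.single (u, e # p, v) 1)
      = \<psi> (Poly_Mapping.single (arrow_head e, p, v) 1 \<star> arr e)"
      by (simp add: single_Cons_path)
    also have "\<dots> = \<psi> (Poly_Mapping.single (arrow_head e, p, v) 1) \<star> \<psi> (arr e)"
      by (rule endoD(3)[OF assms(1)]) (use Cons.prems in \<open>auto simp: carrier_single\<close>)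
    finally show ?case using Cons by simp
  qed
  have keys: "x \<in> paths (Qr r)" if "x \<in> Poly_Mapping.keys f" for x
    using that assms(2) by (auto simp: carrier_CQ)
  have car: "Poly_Mapping.single x 1 \<in> carrier (CQ r)" if "x \<in> Poly_Mapping.keys f" for x
    using keys[OF that] by (cases x) (simp add: carrier_CQ)
  have "\<psi> f = \<psi> (lin_ext (\<lambda>x. Poly_Mapping.single x 1) f)"
    by (simp add: poly_mapping_eq_lin_ext)
  also have "\<dots> = (\<Sum>x\<in>Poly_Mapping.keys f. scale (coef f x) (\<psi> (Poly_Mapping.single x 1)))"
    unfolding lin_ext_def using car
    by (simp add: endo_simps[OF assms(1)] endoD[OF assms(1)] del: scale_simps(5))
  also have "\<dots> = path_hom ?A f"
    unfolding path_hom_def lin_ext_def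
    by (rule sum.cong) (use keys word in \<open>auto simp: mem_paths_Qr simp del: Qr_simps\<close>)
  finally show ?thesis .
qed

lemma path_hom_cong:
  assumes "\<And>\<eta>. \<eta> \<in> arcs (Qr r) \<Longrightarrow> A \<eta> = B \<eta>" "f \<in> carrier (CQ r)"
  shows "path_hom A f = path_hom B f"
proof -
  have "word_ev A u p = word_ev B u p" if "set p \<subseteq> arcs (Qr r)" for u p
    using that by (induction p arbitrary: u) (auto simp: assms(1) simp del: Qr_simps)
  then show ?thesis
    unfolding path_hom_def using assms(2)
    by (intro lin_ext_cong) (auto simp: carrier_CQ mem_paths_Qr simp del: Qr_simps)
qed

lemma endo_eqI:
  assumes "endo r \<psi>" "endo r \<phi>" "\<And>\<eta>. \<eta> \<in> arcs (Qr r) \<Longrightarrow> \<psi> (arr \<eta>) = \<phi> (arr \<eta>)"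
    "f \<in> carrier (CQ r)"
  shows "\<psi> f = \<phi> f"
  using endo_eq_path_hom[OF assms(1,4)] endo_eq_path_hom[OF assms(2,4)]
    path_hom_cong[of r "\<lambda>\<eta>. \<psi> (arr \<eta>)" "\<lambda>\<eta>. \<phi> (arr \<eta>)", OF assms(3,4)] by simp

text \<open>The existence half of the universal property. The two idempotent conditions place the
  image of each arrow in the corner of the algebra given by its head and tail; they make images of
  non-composable arrows multiply to zero.\<close>

locale arrow_images =
  fixes r :: nat and A :: "arrow \<Rightarrow> qelem"
  assumes A_carrier: "\<eta> \<in> arcs (Qr r) \<Longrightarrow> A \<eta> \<in> carrier (CQ r)"
    and A_head: "\<eta> \<in> arcs (Qr r) \<Longrightarrow> trivial_path (arrow_head \<eta>) \<star> A \<eta> = A \<eta>"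
    and A_tail: "\<eta> \<in> arcs (Qr r) \<Longrightarrow> A \<eta> \<star> trivial_path (arrow_tail \<eta>) = A \<eta>"
begin

lemma word_ev_carrier: "set p \<subseteq> arcs (Qr r) \<Longrightarrow> word_ev A u p \<in> carrier (CQ r)"
  by (induction p arbitrary: u) (auto simp: A_carrier simp del: Qr_simps)

lemma word_ev_trivial:
  "set p \<subseteq> arcs (Qr r) \<Longrightarrow> qcas u p v \<Longrightarrow> word_ev A u p \<star> trivial_path u = word_ev A u p"
  by (cases p) (auto simp: A_tail pmul_assoc simp del: Qr_simps)

lemma trivial_word_ev:
  "set p \<subseteq> arcs (Qr r) \<Longrightarrow> qcas u p v \<Longrightarrow> trivial_path v \<star> word_ev A u p = word_ev A u p"
  by (induction p arbitrary: u) (auto simp: pmul_assoc[symmetric] simp del: Qr_simps)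

lemma word_ev_append:
  "set q \<subseteq> arcs (Qr r) \<Longrightarrow> set p \<subseteq> arcs (Qr r) \<Longrightarrow> qcas u q w \<Longrightarrow> qcas w p v \<Longrightarrow>
    word_ev A u (q @ p) = word_ev A w p \<star> word_ev A u q"
  by (induction q arbitrary: u)
    (auto simp: pmul_assoc[symmetric] word_ev_trivial simp del: Qr_simps)

lemma linear_path_hom: "linear_map (path_hom A)"
  unfolding path_hom_def by (rule linear_map_lin_ext)

lemma path_hom_single: "path_hom A (Poly_Mapping.single (u, p, v) 1) = word_ev A u p"
  by (simp add: path_hom_def)

lemma path_hom_carrier:
  assumes "f \<in> carrier (CQ r)"
  shows "path_hom A f \<in> carrier (CQ r)"
  unfolding path_hom_def lin_ext_def
proof (rule carrier_sum)
  fix x assume "x \<in> Poly_Mapping.keys f"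
  then have "x \<in> paths (Qr r)" using assms by (auto simp: carrier_CQ)
  then show "scale (coef f x) (case x of (u, p, v) \<Rightarrow> word_ev A u p) \<in> carrier (CQ r)"
    by (cases x) (auto simp: mem_paths_Qr intro!: carrier_closed(5) word_ev_carrier simp del: Qr_simps)
qed

lemma path_hom_path_mult:
  assumes "x \<in> paths (Qr r)" "y \<in> paths (Qr r)"
  shows "path_hom A (path_mult x y)
    = path_hom A (Poly_Mapping.single x 1) \<star> path_hom A (Poly_Mapping.single y 1)"
proof -
  obtain u p v u' q v' where xy: "x = (u, p, v)" "y = (u', q, v')" by (metis prod_cases3)
  have p: "set p \<subseteq> arcs (Qr r)" "qcas u p v" and q: "set q \<subseteq> arcs (Qr r)" "qcas u' q v'"
    using assms by (simp_all add: xy mem_paths_Qr del: Qr_simps)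
  show ?thesis
  proof (cases "u = v'")
    case True
    then show ?thesis using p q by (simp add: xy path_mult_simp path_hom_single word_ev_append del: Qr_simps)
  next
    case False
    \<comment> \<open>The product of paths that do not compose is zero, so the images must also
      multiply to zero: inserting the idempotents at the meeting ends exhibits the factor
      \<open>trivial_path u \<star> trivial_path v'\<close>.\<close>
    have "word_ev A u p \<star> word_ev A u' q
      = (word_ev A u p \<star> trivial_path u) \<star> (trivial_path v' \<star> word_ev A u' q)"
      by (simp add: word_ev_trivial[OF p] trivial_word_ev[OF q])
    also have "\<dots> = 0" using False by (simp add: pmul_assoc)
    finally show ?thesis using False
      by (simp add: xy path_mult_simp path_hom_single linear_map_simps[OF linear_path_hom])
  qed
qed

lemma path_hom_pmul:
  assumes "f \<in> carrier (CQ r)" "g \<in> carrier (CQ r)"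
  shows "path_hom A (f \<star> g) = path_hom A f \<star> path_hom A g"
proof (rule linear_map_eqI[of "\<lambda>f. path_hom A (f \<star> g)" "\<lambda>f. path_hom A f \<star> path_hom A g"])
  fix x assume "x \<in> Poly_Mapping.keys f"
  then have x: "x \<in> paths (Qr r)" using assms by (auto simp: carrier_CQ)
  show "path_hom A (Poly_Mapping.single x 1 \<star> g) = path_hom A (Poly_Mapping.single x 1) \<star> path_hom A g"
  proof (rule linear_map_eqI[of "\<lambda>g. path_hom A (Poly_Mapping.single x 1 \<star> g)"
        "\<lambda>g. path_hom A (Poly_Mapping.single x 1) \<star> path_hom A g"])
    fix y assume "y \<in> Poly_Mapping.keys g"
    then have y: "y \<in> paths (Qr r)" using assms by (auto simp: carrier_CQ)
    show "path_hom A (Poly_Mapping.single x 1 \<star> Poly_Mapping.single y 1)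
      = path_hom A (Poly_Mapping.single x 1) \<star> path_hom A (Poly_Mapping.single y 1)"
      using path_hom_path_mult[OF x y] by simp
  qed (auto simp: linear_map_def pmul_distrib linear_mapD[OF linear_path_hom])
qed (auto simp: linear_map_def pmul_distrib linear_mapD[OF linear_path_hom])

lemma path_hom_trivial: "path_hom A (trivial_path u) = trivial_path u"
  by (simp add: trivial_path_def path_hom_single)

lemma endo_path_hom: "endo r (path_hom A)"
  by (rule endoI) (auto simp: path_hom_carrier path_hom_pmul path_hom_trivial linear_mapD[OF linear_path_hom])

lemma path_hom_arr: "\<eta> \<in> arcs (Qr r) \<Longrightarrow> path_hom A (arr \<eta>) = A \<eta>"
  by (simp add: arr_def path_hom_single A_head del: Qr_simps)

end

section \<open>Automorphisms and the group they form\<close>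

text \<open>Both composites are endomorphisms, so it suffices to compare them with the identity on
  arrows. The restriction is needed because elements of \<open>Bij\<close> are undefined outside the
  carrier.\<close>

lemma automorphismI:
  assumes "endo r \<psi>" "endo r \<phi>"
    and "\<And>\<eta>. \<eta> \<in> arcs (Qr r) \<Longrightarrow> \<psi> (\<phi> (arr \<eta>)) = arr \<eta>"
    and "\<And>\<eta>. \<eta> \<in> arcs (Qr r) \<Longrightarrow> \<phi> (\<psi> (arr \<eta>)) = arr \<eta>"
  shows "restrict \<psi> (carrier (CQ r)) \<in> carrier (AutCQ r)"
proof -
  have 1: "\<psi> (\<phi> f) = f" "\<phi> (\<psi> f) = f" if "f \<in> carrier (CQ r)" for f
    using endo_eqI[OF endo_comp[OF assms(1,2)] endo_id assms(3) that]
      endo_eqI[OF endo_comp[OF assms(2,1)] endo_id assms(4) that] by auto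
  have "bij_betw \<psi> (carrier (CQ r)) (carrier (CQ r))"
    by (rule bij_betw_byWitness[of _ \<phi>]) (use 1 assms in \<open>auto simp: endoD\<close>)
  moreover have "endo r (restrict \<psi> (carrier (CQ r)))"
    by (rule endo_cong[OF assms(1)]) simp
  ultimately show ?thesis
    by (simp add: AutCQ_iff Bij_def)
qed

lemma AutCQ_eqI:
  assumes "\<psi> \<in> carrier (AutCQ r)" "\<phi> \<in> carrier (AutCQ r)"
    "\<And>\<eta>. \<eta> \<in> arcs (Qr r) \<Longrightarrow> \<psi> (arr \<eta>) = \<phi> (arr \<eta>)"
  shows "\<psi> = \<phi>"
  using assms endo_eqI[of r \<psi> \<phi>]
  by (auto simp: AutCQ_iff Bij_def intro!: extensionalityI[of \<psi> "carrier (CQ r)"])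

lemma AutCQ_mult:
  assumes "\<psi> \<in> carrier (AutCQ r)" "\<phi> \<in> carrier (AutCQ r)"
  shows "\<psi> \<otimes>\<^bsub>AutCQ r\<^esub> \<phi> = compose (carrier (CQ r)) \<psi> \<phi>"
  using assms by (simp add: AutCQ_iff) (simp add: AutCQ_def BijGroup_def)

lemma AutCQ_one: "\<one>\<^bsub>AutCQ r\<^esub> = (\<lambda>x\<in>carrier (CQ r). x)"
  by (simp add: AutCQ_def BijGroup_def)

lemma endo_inv_into:
  assumes "\<psi> \<in> carrier (AutCQ r)"
  shows "endo r (restrict (inv_into (carrier (CQ r)) \<psi>) (carrier (CQ r)))"
proof -
  let ?C = "carrier (CQ r)" and ?i = "inv_into (carrier (CQ r)) \<psi>"
  have b: "bij_betw \<psi> ?C ?C" and e: "endo r \<psi>" using assms by (auto simp: AutCQ_iff Bij_def)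
  have i: "?i f \<in> ?C" "\<psi> (?i f) = f" if "f \<in> ?C" for f
    using b that by (auto simp: bij_betw_def inv_into_into f_inv_into_f)
  have j: "?i f = g" if "g \<in> ?C" "\<psi> g = f" for f g
    using b that by (auto simp: bij_betw_def)
  have "endo r ?i"
    by (rule endoI) (auto intro!: j simp: i endoD[OF e])
  then show ?thesis by (rule endo_cong) simp
qed

lemma group_AutCQ: "group (AutCQ r)"
proof -
  let ?C = "carrier (CQ r)"
  have "subgroup (carrier (AutCQ r)) (BijGroup ?C)"
  proof (rule group.subgroupI[OF group_BijGroup])
    show "carrier (AutCQ r) \<subseteq> carrier (BijGroup ?C)"
      by (auto simp: AutCQ_iff BijGroup_def)
    have "\<one>\<^bsub>BijGroup ?C\<^esub> \<in> carrier (AutCQ r)"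
      using id_Bij[of ?C] endo_cong[OF endo_id, of r "\<lambda>x\<in>?C. x"]
      by (simp add: AutCQ_iff BijGroup_def)
    then show "carrier (AutCQ r) \<noteq> {}" by auto
  next
    fix \<psi> assume a: "\<psi> \<in> carrier (AutCQ r)"
    then have "\<psi> \<in> Bij ?C" by (simp add: AutCQ_iff)
    then show "inv\<^bsub>BijGroup ?C\<^esub> \<psi> \<in> carrier (AutCQ r)"
      using endo_inv_into[OF a] restrict_inv_into_Bij[of \<psi> ?C]
      by (simp add: inv_BijGroup AutCQ_iff)
  next
    fix \<psi> \<phi> assume a: "\<psi> \<in> carrier (AutCQ r)" "\<phi> \<in> carrier (AutCQ r)"
    then have "endo r \<psi>" "endo r \<phi>" by (auto simp: AutCQ_iff)
    then have "endo r (compose ?C \<psi> \<phi>)"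
      by (rule endo_cong[OF endo_comp]) (simp add: compose_def)
    with a show "\<psi> \<otimes>\<^bsub>BijGroup ?C\<^esub> \<phi> \<in> carrier (AutCQ r)"
      by (simp add: AutCQ_iff BijGroup_def compose_Bij)
  qed
  then have "group (BijGroup ?C\<lparr>carrier := carrier (AutCQ r)\<rparr>)"
    by (rule group.subgroup_imp_group[OF group_BijGroup])
  then show ?thesis by (simp add: AutCQ_def)
qed

lemma AutCQ_inv:
  assumes "\<psi> \<in> carrier (AutCQ r)" "f \<in> carrier (CQ r)"
  shows "(inv\<^bsub>AutCQ r\<^esub> \<psi>) (\<psi> f) = f" "\<psi> ((inv\<^bsub>AutCQ r\<^esub> \<psi>) f) = f"
proof -
  interpret group "AutCQ r" by (rule group_AutCQ)
  have i: "inv\<^bsub>AutCQ r\<^esub> \<psi> \<in> carrier (AutCQ r)" using assms by simp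
  have "(inv\<^bsub>AutCQ r\<^esub> \<psi> \<otimes>\<^bsub>AutCQ r\<^esub> \<psi>) f = f" "(\<psi> \<otimes>\<^bsub>AutCQ r\<^esub> inv\<^bsub>AutCQ r\<^esub> \<psi>) f = f"
    using assms by (simp_all add: AutCQ_one)
  then show "(inv\<^bsub>AutCQ r\<^esub> \<psi>) (\<psi> f) = f" "\<psi> ((inv\<^bsub>AutCQ r\<^esub> \<psi>) f) = f"
    using assms i by (simp_all add: AutCQ_mult compose_def)
qed

section \<open>Polynomials in \<open>a\<close>\<close>

text \<open>The value of \<open>p\<close> at the loop \<open>a\<close>, written with explicit paths
  rather than ring powers so that coefficients can be read off; \<open>poly_at_a_eq\<close>
  identifies it with \<open>poly_at_a\<close>.\<close>

definition poly_path :: "complex poly \<Rightarrow> qelem" where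
  "poly_path p = (\<Sum>k\<le>degree p. Poly_Mapping.single (V1, replicate k Arr_a, V1) (coeff p k))"

lemma coef_poly_path:
  "coef (poly_path p) (u, w, v) =
    (if u = V1 \<and> v = V1 \<and> w = replicate (length w) Arr_a then coeff p (length w) else 0)"
proof (cases "u = V1 \<and> v = V1 \<and> w = replicate (length w) Arr_a")
  case True
  then have eq: "(V1, replicate k Arr_a, V1) = (u, w, v) \<longleftrightarrow> k = length w" for k
    by auto
  have "coef (poly_path p) (u, w, v) = (\<Sum>k\<le>degree p. if k = length w then coeff p k else 0)"
    unfolding poly_path_def lookup_sum
    by (rule sum.cong) (simp_all only: lookup_single when_def eq)
  also have "\<dots> = coeff p (length w)"
    by (simp add: coeff_eq_0)
  finally show ?thesis using True by simp
next
  case False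
  then have neq: "(V1, replicate k Arr_a, V1) \<noteq> (u, w, v)" for k
    by (metis length_replicate prod.inject)
  show ?thesis
    using False neq by (auto simp: poly_path_def lookup_sum lookup_single_not_eq intro!: sum.neutral)
qed

lemma poly_path_eqI:
  "(\<And>u w v. coef (poly_path p) (u, w, v) = coef f (u, w, v)) \<Longrightarrow> poly_path p = f"
  by (rule poly_mapping_eqI) auto

lemma poly_path_simps [simp]:
  "poly_path 0 = 0" "poly_path (p + q) = poly_path p + poly_path q"
  "poly_path (Polynomial.smult c p) = scale c (poly_path p)" "poly_path (- p) = - poly_path p"
  "poly_path (p - q) = poly_path p - poly_path q"
  by (auto intro!: poly_path_eqI simp: coef_poly_path lookup_add lookup_minus)

lemma poly_path_sum: "poly_path (sum F A) = (\<Sum>x\<in>A. poly_path (F x))"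
  by (induction A rule: infinite_finite_induct) auto

lemma poly_path_inject: "poly_path p = poly_path q \<longleftrightarrow> p = q"
proof
  assume eq: "poly_path p = poly_path q"
  show "p = q"
  proof (rule poly_eqI)
    fix n
    show "coeff p n = coeff q n"
      using arg_cong[OF eq, of "\<lambda>f. coef f (V1, replicate n Arr_a, V1)"]
      by (simp add: coef_poly_path)
  qed
qed simp

lemma poly_path_const [simp]: "poly_path [:c:] = scale c e1"
  by (auto simp: poly_path_def trivial_path_def)

lemma poly_path_one [simp]: "poly_path 1 = e1"
  using poly_path_const[of 1] by (simp add: one_pCons)

text \<open>The Horner step, which carries the inductions over polynomials that follow.\<close>

lemma poly_path_pCons: "poly_path (pCons c p) = scale c e1 + arr Arr_a \<star> poly_path p"
proof (rule poly_path_eqI)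
  fix u w v
  show "coef (poly_path (pCons c p)) (u, w, v) = coef (scale c e1 + arr Arr_a \<star> poly_path p) (u, w, v)"
  proof (cases w rule: rev_cases)
    case Nil
    then show ?thesis
      by (auto simp: coef_poly_path lookup_add arr_def coef_single_pmul trivial_path_def lookup_single when_def)
  next
    case (snoc w' e)
    have "(w' @ [e] = Arr_a # replicate (length w') Arr_a) \<longleftrightarrow> (e = Arr_a \<and> w' = replicate (length w') Arr_a)"
      unfolding replicate_append_same[symmetric] by auto
    then show ?thesis
      by (auto simp: snoc coef_poly_path lookup_add arr_def coef_single_pmul trivial_path_def lookup_single when_def)
  qed
qed

lemma e1_poly_path [simp]: "e1 \<star> poly_path p = poly_path p"
  by (induction p) (auto simp: poly_path_pCons pmul_distrib pmul_assoc[symmetric] trivial_arr)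

lemma poly_path_mult [simp]: "poly_path (p * q) = poly_path p \<star> poly_path q"
  by (induction p) (auto simp: poly_path_pCons mult_pCons_left pmul_distrib pmul_assoc)

lemma poly_path_e1 [simp]: "poly_path p \<star> e1 = poly_path p"
  using poly_path_mult[of p 1] by simp

lemma arr_a_eq: "arr Arr_a = poly_path [:0, 1:]"
  by (simp add: poly_path_pCons arr_trivial)

lemma poly_path_arr_a: "poly_path p \<star> arr Arr_a = arr Arr_a \<star> poly_path p"
  unfolding arr_a_eq poly_path_mult[symmetric] by (simp add: mult.commute)

lemma carrier_poly_path [simp]: "poly_path p \<in> carrier (CQ r)"
  by (induction p) (auto simp: poly_path_pCons)

lemma endo_poly_path:
  assumes "endo r \<psi>" "\<psi> (arr Arr_a) = arr Arr_a"
  shows "\<psi> (poly_path p) = poly_path p"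
  by (induction p) (auto simp: poly_path_pCons endoD[OF assms(1)] endo_simps[OF assms(1)] assms(2))

section \<open>The algebra \<open>A1 r\<close> and its subring \<complex>[a]\<close>

lemma A1_simps [simp]:
  "mult (A1 r) = (\<star>)" "add (A1 r) = (+)" "zero (A1 r) = 0" "Module.smult (A1 r) = scale"
  "one (A1 r) = e1"
  by (simp_all add: A1_def)

lemma carrier_A1:
  "f \<in> carrier (A1 r) \<longleftrightarrow> f \<in> carrier (CQ r) \<and> e1 \<star> f = f \<and> f \<star> e1 = f"
proof
  assume "f \<in> carrier (A1 r)"
  then obtain x where "x \<in> carrier (CQ r)" "f = e1 \<star> x \<star> e1" by (auto simp: A1_def)
  then show "f \<in> carrier (CQ r) \<and> e1 \<star> f = f \<and> f \<star> e1 = f" by (simp add: pmul_assoc)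
next
  assume "f \<in> carrier (CQ r) \<and> e1 \<star> f = f \<and> f \<star> e1 = f"
  then show "f \<in> carrier (A1 r)" by (auto simp: A1_def intro!: exI[of _ f])
qed

lemma abelian_monoid_A1: "abelian_monoid (A1 r)"
  by (rule abelian_group.axioms, rule abelian_groupI_add) (auto simp: carrier_A1 pmul_distrib)

lemma pow_A1: "arr Arr_a [^]\<^bsub>A1 r\<^esub> (k::nat) = Poly_Mapping.single (V1, replicate k Arr_a, V1) 1"
proof (induction k)
  case 0
  show ?case by (simp add: nat_pow_def trivial_path_def)
next
  case (Suc k)
  have "arr Arr_a [^]\<^bsub>A1 r\<^esub> Suc k = (arr Arr_a [^]\<^bsub>A1 r\<^esub> k) \<star> arr Arr_a"
    by (simp add: nat_pow_def)
  also have "\<dots> = Poly_Mapping.single (V1, replicate (Suc k) Arr_a, V1) 1"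
    unfolding Suc by (simp add: arr_def path_mult_simp)
  finally show ?case .
qed

lemma poly_at_a_eq: "poly_at_a r p = poly_path p"
proof -
  have s: "Poly_Mapping.single (V1, replicate k Arr_a, V1) c \<in> carrier (A1 r)" for k and c :: complex
  proof -
    have "poly_path (monom c k) = Poly_Mapping.single (V1, replicate k Arr_a, V1) c"
    proof (rule poly_path_eqI)
      fix u w v
      show "coef (poly_path (monom c k)) (u, w, v)
        = coef (Poly_Mapping.single (V1, replicate k Arr_a, V1) c) (u, w, v)"
        by (auto simp: coef_poly_path lookup_single when_def)
    qed
    then show ?thesis
      by (metis carrier_A1 carrier_poly_path e1_poly_path poly_path_e1)
  qed
  show ?thesis
    unfolding poly_at_a_def poly_path_def el_a_def arrow_path_Qr
    by (subst finsum_eq_sum) (auto simp: abelian_monoid_A1 pow_A1 s)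
qed

lemma C_a_simps [simp]:
  "mult (C_a r) = (\<star>)" "add (C_a r) = (+)" "zero (C_a r) = 0" "Module.smult (C_a r) = scale"
  "one (C_a r) = e1" "carrier (C_a r) = range poly_path"
  by (auto simp: C_a_def poly_at_a_eq)

lemma abelian_monoid_C_a: "abelian_monoid (C_a r)"
  by (rule abelian_group.axioms, rule abelian_groupI_add)
    (auto simp: poly_path_simps[symmetric] simp del: poly_path_simps)


section \<open>Matrices over \<open>\<complex>[a]\<close>\<close>

abbreviation bb :: "nat \<Rightarrow> qelem" where "bb \<beta> \<equiv> arr (Arr_b (Suc \<beta>))"
abbreviation dd :: "nat \<Rightarrow> qelem" where "dd \<beta> \<equiv> arr (Arr_d (Suc \<beta>))"

text \<open>Matrices of polynomials are taken with indices starting at 0, unlike the arrows.\<close>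

definition embed_mat :: "nat \<Rightarrow> complex poly mat \<Rightarrow> (nat \<times> nat \<Rightarrow> qelem)" where
  "embed_mat r A = (\<lambda>(i, j) \<in> {1..r} \<times> {1..r}. poly_path (A $$ (i - 1, j - 1)))"

lemma eq_embed_matI:
  assumes "M \<in> carrier (mat_monoid r R)"
    "\<And>i j. i \<in> {1..r} \<Longrightarrow> j \<in> {1..r} \<Longrightarrow> M (i, j) = poly_path (A $$ (i - 1, j - 1))"
  shows "M = embed_mat r A"
proof (rule extensionalityI)
  show "M \<in> extensional ({1..r} \<times> {1..r})" using assms(1) by (simp add: mat_monoid_def PiE_iff)
  show "embed_mat r A \<in> extensional ({1..r} \<times> {1..r})" by (simp add: embed_mat_def)
qed (use assms(2) in \<open>auto simp: embed_mat_def\<close>)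

lemma carrier_mat_monoid_C_a: "carrier (mat_monoid r (C_a r)) = embed_mat r ` carrier_mat r r"
proof
  show "embed_mat r ` carrier_mat r r \<subseteq> carrier (mat_monoid r (C_a r))"
    by (auto simp: mat_monoid_def embed_mat_def split: if_splits)
  show "carrier (mat_monoid r (C_a r)) \<subseteq> embed_mat r ` carrier_mat r r"
  proof
    fix M assume M: "M \<in> carrier (mat_monoid r (C_a r))"
    define A where "A = mat r r (\<lambda>(i, j). SOME p. M (Suc i, Suc j) = poly_path p)"
    have "poly_path (A $$ (i - 1, j - 1)) = M (i, j)" if "i \<in> {1..r}" "j \<in> {1..r}" for i j
    proof -
      have "\<exists>p. M (i, j) = poly_path p" using M that by (fastforce simp: mat_monoid_def PiE_iff)
      then show ?thesis using that someI_ex[of "\<lambda>p. M (i, j) = poly_path p"] by (auto simp: A_def)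
    qed
    then have "M = embed_mat r A"
      by (intro eq_embed_matI[OF M]) simp
    moreover have "A \<in> carrier_mat r r" by (simp add: A_def)
    ultimately show "M \<in> embed_mat r ` carrier_mat r r" by blast
  qed
qed

lemma embed_mat_inject:
  assumes "A \<in> carrier_mat r r" "B \<in> carrier_mat r r" "embed_mat r A = embed_mat r B"
  shows "A = B"
proof (rule eq_matI)
  fix i j assume "i < dim_row B" "j < dim_col B"
  then show "A $$ (i, j) = B $$ (i, j)"
    using fun_cong[OF assms(3), of "(Suc i, Suc j)"] assms(1,2)
    by (simp add: embed_mat_def poly_path_inject)
qed (use assms in auto)

lemma index_mult_mat_sum:
  assumes "A \<in> carrier_mat r r" "B \<in> carrier_mat r r" "i < r" "j < r"
  shows "(A * B) $$ (i, j) = (\<Sum>k<r. A $$ (i, k) * B $$ (k, j))"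
  using assms by (simp add: scalar_prod_def lessThan_atLeast0)

lemma embed_mat_mult:
  assumes "A \<in> carrier_mat r r" "B \<in> carrier_mat r r"
  shows "embed_mat r A \<otimes>\<^bsub>mat_monoid r (C_a r)\<^esub> embed_mat r B = embed_mat r (A * B)"
proof
  fix x :: "nat \<times> nat"
  obtain i k where x: "x = (i, k)" by (metis prod.exhaust)
  show "(embed_mat r A \<otimes>\<^bsub>mat_monoid r (C_a r)\<^esub> embed_mat r B) x = embed_mat r (A * B) x"
  proof (cases "i \<in> {1..r} \<and> k \<in> {1..r}")
    case True
    let ?F = "\<lambda>j. embed_mat r A (i, j) \<star> embed_mat r B (j, k)"
    have F: "?F j = poly_path (A $$ (i - 1, j - 1) * B $$ (j - 1, k - 1))" if "j \<in> {1..r}" for j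
      using that True by (simp add: embed_mat_def)
    have "finsum (C_a r) ?F {1..r} = sum ?F {1..r}"
      by (rule finsum_eq_sum) (simp_all add: abelian_monoid_C_a F Pi_iff del: poly_path_mult)
    also have "\<dots> = (\<Sum>j\<in>{1..r}. poly_path (A $$ (i - 1, j - 1) * B $$ (j - 1, k - 1)))"
      by (rule sum.cong) (simp_all only: F)
    also have "\<dots> = (\<Sum>j<r. poly_path (A $$ (i - 1, j) * B $$ (j, k - 1)))"
      by (rule sum.reindex_bij_witness[of _ Suc "\<lambda>j. j - 1"]) auto
    also have "\<dots> = poly_path ((A * B) $$ (i - 1, k - 1))"
      using True by (subst index_mult_mat_sum[OF assms]) (auto simp: poly_path_sum)
    finally show ?thesis using True by (simp add: x mat_monoid_def embed_mat_def)
  qed (auto simp: x mat_monoid_def embed_mat_def)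
qed

lemma embed_mat_one: "embed_mat r (1\<^sub>m r) = \<one>\<^bsub>mat_monoid r (C_a r)\<^esub>"
  by (auto simp: embed_mat_def mat_monoid_def fun_eq_iff restrict_def)

text \<open>Units correspond because the embedding of polynomial matrices is injective and respects
  products and the unit. This gives access to matrix theory over the commutative ring of
  polynomials.\<close>

lemma carrier_GL_C_a:
  "carrier (GL r (C_a r)) = embed_mat r `
    {A \<in> carrier_mat r r. \<exists>B \<in> carrier_mat r r. A * B = 1\<^sub>m r \<and> B * A = 1\<^sub>m r}"
proof -
  have one: "embed_mat r A = \<one>\<^bsub>mat_monoid r (C_a r)\<^esub> \<longleftrightarrow> A = 1\<^sub>m r" if "A \<in> carrier_mat r r" for A
    using embed_mat_inject[OF that one_carrier_mat] by (auto simp: embed_mat_one)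
  show ?thesis
    unfolding GL_def units_of_carrier Units_def carrier_mat_monoid_C_a
    by (auto simp: embed_mat_mult one intro!: imageI)
qed

lemma mult_GL: "mult (GL r R) = mult (mat_monoid r R)"
  by (simp add: GL_def units_of_def)

text \<open>A relation in place of the definite description \<open>N_mat\<close>. As in
  \<open>N_mat\<close>, column \<alpha> holds the coordinates of the image of
  \<open>bb \<alpha>\<close>, so composition multiplies matrices in the same order.\<close>

definition has_matrix :: "nat \<Rightarrow> (qelem \<Rightarrow> qelem) \<Rightarrow> complex poly mat \<Rightarrow> bool" where
  "has_matrix r \<psi> A \<longleftrightarrow> A \<in> carrier_mat r r \<and>
    (\<forall>\<alpha><r. \<psi> (bb \<alpha>) = (\<Sum>\<beta><r. bb \<beta> \<star> poly_path (A $$ (\<beta>, \<alpha>))))"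

lemma carrier_bb [simp]: "\<beta> < r \<Longrightarrow> bb \<beta> \<in> carrier (CQ r)"
  and carrier_dd [simp]: "\<beta> < r \<Longrightarrow> dd \<beta> \<in> carrier (CQ r)"
  by (rule carrier_arr; auto)+

lemma carrier_loops [simp]: "arr Arr_a \<in> carrier (CQ r)" "arr Arr_a_star \<in> carrier (CQ r)"
  by (rule carrier_arr; simp)+

lemma trivial_bb [simp]: "e2 \<star> bb \<beta> = bb \<beta>" "e1 \<star> bb \<beta> = 0" "bb \<beta> \<star> e1 = bb \<beta>" "bb \<beta> \<star> e2 = 0"
  and trivial_dd [simp]: "e1 \<star> dd \<beta> = dd \<beta>" "e2 \<star> dd \<beta> = 0" "dd \<beta> \<star> e2 = dd \<beta>" "dd \<beta> \<star> e1 = 0"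
  by (simp_all add: trivial_arr arr_trivial)

lemma carrier_bb_sum [simp]:
    "(\<And>\<beta>. \<beta> < r \<Longrightarrow> m \<beta> \<in> carrier (CQ r)) \<Longrightarrow> (\<Sum>\<beta><r. bb \<beta> \<star> m \<beta>) \<in> carrier (CQ r)"
  and carrier_dd_sum [simp]:
    "(\<And>\<beta>. \<beta> < r \<Longrightarrow> m \<beta> \<in> carrier (CQ r)) \<Longrightarrow> (\<Sum>\<beta><r. m \<beta> \<star> dd \<beta>) \<in> carrier (CQ r)"
  by (auto intro!: carrier_sum carrier_pmul carrier_bb carrier_dd)

lemma endo_bb_sum:
    "endo r \<psi> \<Longrightarrow> (\<And>\<beta>. \<beta> < r \<Longrightarrow> m \<beta> \<in> carrier (CQ r)) \<Longrightarrow>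
      \<psi> (\<Sum>\<beta><r. bb \<beta> \<star> m \<beta>) = (\<Sum>\<beta><r. \<psi> (bb \<beta>) \<star> \<psi> (m \<beta>))"
  and endo_dd_sum:
    "endo r \<psi> \<Longrightarrow> (\<And>\<beta>. \<beta> < r \<Longrightarrow> m \<beta> \<in> carrier (CQ r)) \<Longrightarrow>
      \<psi> (\<Sum>\<beta><r. m \<beta> \<star> dd \<beta>) = (\<Sum>\<beta><r. \<psi> (m \<beta>) \<star> \<psi> (dd \<beta>))"
  by (subst endo_simps(4)[of r]; auto simp: endoD(3) intro!: carrier_pmul carrier_bb carrier_dd)+

text \<open>Freeness of the right module with basis the \<open>b\<close>: the last arrow of a path
  in the sum tells from which summand it comes. The condition with \<open>e1\<close> excludes terms
  ending at the vertex 2, which every \<open>bb \<beta>\<close> annihilates.\<close>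

lemma bb_independent:
  assumes "(\<Sum>\<beta><r. bb \<beta> \<star> m \<beta>) = 0" "\<And>\<beta>. \<beta> < r \<Longrightarrow> e1 \<star> m \<beta> = m \<beta>" "\<gamma> < r"
  shows "m \<gamma> = 0"
proof (rule poly_mapping_eqI)
  fix x :: "(vertex, arrow) path"
  obtain u w v where x: "x = (u, w, v)" by (metis prod_cases3)
  show "coef (m \<gamma>) x = coef 0 x"
  proof (cases v)
    case V1
    have "coef (\<Sum>\<beta><r. bb \<beta> \<star> m \<beta>) (u, w @ [Arr_b (Suc \<gamma>)], V2)
      = (\<Sum>\<beta><r. if \<beta> = \<gamma> then coef (m \<beta>) (u, w, V1) else 0)"
      unfolding lookup_sum by (rule sum.cong) (auto simp: arr_def coef_single_pmul)
    then show ?thesis using assms(1,3) by (simp add: x V1)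
  next
    case V2
    have "coef (e1 \<star> m \<gamma>) (u, w, V2) = 0"
      by (simp add: trivial_path_def coef_single_pmul)
    then show ?thesis using assms(2,3) by (simp add: x V2)
  qed
qed

text \<open>Freeness makes the definite description meaningful. A competing matrix may have any
  entries in \<open>A1 r\<close>, so uniqueness is proved over that algebra and not only over
  \<complex>[a].\<close>

lemma N_mat_eq:
  assumes "has_matrix r \<psi> A"
  shows "N_mat r \<psi> = embed_mat r A"
  unfolding N_mat_def
proof (rule the_equality)
  have b: "el_b r \<beta> = bb (\<beta> - 1)" if "\<beta> \<in> {1..r}" for \<beta>
    using that by (simp add: el_b_def arrow_path_Qr)
  have fs: "finsum (CQ r) (\<lambda>\<beta>. el_b r \<beta> \<star> M (\<beta>, \<alpha>)) {1..r} = (\<Sum>\<beta><r. bb \<beta> \<star> M (Suc \<beta>, \<alpha>))"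
    if "M \<in> carrier (mat_monoid r (A1 r))" "\<alpha> \<in> {1..r}" for M \<alpha>
  proof -
    have "M (\<beta>, \<alpha>) \<in> carrier (A1 r)" if "\<beta> \<in> {1..r}" for \<beta>
      using that \<open>\<alpha> \<in> _\<close> \<open>M \<in> _\<close> by (auto simp: mat_monoid_def PiE_iff)
    then have "finsum (CQ r) (\<lambda>\<beta>. el_b r \<beta> \<star> M (\<beta>, \<alpha>)) {1..r} = (\<Sum>\<beta>\<in>{1..r}. el_b r \<beta> \<star> M (\<beta>, \<alpha>))"
      by (intro finsum_CQ) (auto simp: carrier_A1 el_b_def arrow_path_Qr intro!: carrier_pmul carrier_arr)
    also have "\<dots> = (\<Sum>\<beta><r. bb \<beta> \<star> M (Suc \<beta>, \<alpha>))"
      using sum.atLeast1_atMost_eq[of "\<lambda>\<beta>. el_b r \<beta> \<star> M (\<beta>, \<alpha>)" r] by (simp add: b)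
    finally show ?thesis .
  qed
  have E: "embed_mat r A \<in> carrier (mat_monoid r (A1 r))"
    by (auto simp: mat_monoid_def embed_mat_def carrier_A1)
  have sol: "\<psi> (el_b r \<alpha>) = (\<Sum>\<beta><r. bb \<beta> \<star> embed_mat r A (Suc \<beta>, \<alpha>))" if "\<alpha> \<in> {1..r}" for \<alpha>
  proof -
    have "\<psi> (bb (\<alpha> - 1)) = (\<Sum>\<beta><r. bb \<beta> \<star> poly_path (A $$ (\<beta>, \<alpha> - 1)))"
      using assms that unfolding has_matrix_def by (cases \<alpha>) auto
    also have "\<dots> = (\<Sum>\<beta><r. bb \<beta> \<star> embed_mat r A (Suc \<beta>, \<alpha>))"
      by (rule sum.cong) (use that in \<open>auto simp: embed_mat_def\<close>)
    finally show ?thesis using that by (simp add: b)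
  qed
  show "embed_mat r A \<in> carrier (mat_monoid r (A1 r)) \<and>
    (\<forall>\<alpha>\<in>{1..r}. \<psi> (el_b r \<alpha>) =
      (\<Oplus>\<^bsub>CQ r\<^esub>\<beta>\<in>{1..r}. el_b r \<beta> \<otimes>\<^bsub>CQ r\<^esub> embed_mat r A (\<beta>, \<alpha>)))"
    using E sol fs by simp
  fix M assume M: "M \<in> carrier (mat_monoid r (A1 r)) \<and>
    (\<forall>\<alpha>\<in>{1..r}. \<psi> (el_b r \<alpha>) = (\<Oplus>\<^bsub>CQ r\<^esub>\<beta>\<in>{1..r}. el_b r \<beta> \<otimes>\<^bsub>CQ r\<^esub> M (\<beta>, \<alpha>)))"
  have "M (\<beta>, \<alpha>) = embed_mat r A (\<beta>, \<alpha>)" if "\<alpha> \<in> {1..r}" "\<beta> \<in> {1..r}" for \<alpha> \<beta>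
  proof -
    let ?m = "\<lambda>\<beta>. M (Suc \<beta>, \<alpha>) - embed_mat r A (Suc \<beta>, \<alpha>)"
    have "(\<Sum>\<beta><r. bb \<beta> \<star> M (Suc \<beta>, \<alpha>)) = (\<Sum>\<beta><r. bb \<beta> \<star> embed_mat r A (Suc \<beta>, \<alpha>))"
      using M fs[of M \<alpha>] sol[of \<alpha>] that by simp
    then have "(\<Sum>\<beta><r. bb \<beta> \<star> ?m \<beta>) = 0"
      by (simp add: pmul_distrib sum_subtractf)
    moreover have "e1 \<star> ?m \<beta> = ?m \<beta>" if "\<beta> < r" for \<beta>
    proof -
      have "M (Suc \<beta>, \<alpha>) \<in> carrier (A1 r)" "embed_mat r A (Suc \<beta>, \<alpha>) \<in> carrier (A1 r)"
        using M E that \<open>\<alpha> \<in> _\<close> by (auto simp: mat_monoid_def PiE_iff)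
      then show ?thesis by (simp add: carrier_A1 pmul_distrib)
    qed
    ultimately have "?m (\<beta> - 1) = 0" by (rule bb_independent) (use that in auto)
    then show ?thesis using that by simp
  qed
  then show "M = embed_mat r A"
    using M by (intro eq_embed_matI[of _ _ "A1 r"]) (auto simp: embed_mat_def)
qed

lemma bb_mat_mult:
  assumes "A \<in> carrier_mat r r" "B \<in> carrier_mat r r" "\<alpha> < r"
  shows "(\<Sum>\<beta><r. (\<Sum>\<gamma><r. bb \<gamma> \<star> poly_path (A $$ (\<gamma>, \<beta>))) \<star> poly_path (B $$ (\<beta>, \<alpha>)))
    = (\<Sum>\<gamma><r. bb \<gamma> \<star> poly_path ((A * B) $$ (\<gamma>, \<alpha>)))"
proof -
  have "(\<Sum>\<beta><r. (\<Sum>\<gamma><r. bb \<gamma> \<star> poly_path (A $$ (\<gamma>, \<beta>))) \<star> poly_path (B $$ (\<beta>, \<alpha>)))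
    = (\<Sum>\<gamma><r. \<Sum>\<beta><r. bb \<gamma> \<star> poly_path (A $$ (\<gamma>, \<beta>) * B $$ (\<beta>, \<alpha>)))"
    by (subst sum.swap) (simp add: sum_pmul pmul_assoc)
  also have "\<dots> = (\<Sum>\<gamma><r. bb \<gamma> \<star> poly_path ((A * B) $$ (\<gamma>, \<alpha>)))"
    using assms(3) by (intro sum.cong refl) (auto simp: index_mult_mat_sum[OF assms(1,2)] poly_path_sum pmul_sum)
  finally show ?thesis .
qed

lemma dd_mat_mult:
  assumes "A \<in> carrier_mat r r" "B \<in> carrier_mat r r" "\<alpha> < r"
  shows "(\<Sum>\<beta><r. poly_path (A $$ (\<alpha>, \<beta>)) \<star> (\<Sum>\<gamma><r. poly_path (B $$ (\<beta>, \<gamma>)) \<star> dd \<gamma>))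
    = (\<Sum>\<gamma><r. poly_path ((A * B) $$ (\<alpha>, \<gamma>)) \<star> dd \<gamma>)"
proof -
  have "(\<Sum>\<beta><r. poly_path (A $$ (\<alpha>, \<beta>)) \<star> (\<Sum>\<gamma><r. poly_path (B $$ (\<beta>, \<gamma>)) \<star> dd \<gamma>))
    = (\<Sum>\<gamma><r. \<Sum>\<beta><r. poly_path (A $$ (\<alpha>, \<beta>) * B $$ (\<beta>, \<gamma>)) \<star> dd \<gamma>)"
    by (subst sum.swap) (simp add: pmul_sum pmul_assoc)
  also have "\<dots> = (\<Sum>\<gamma><r. poly_path ((A * B) $$ (\<alpha>, \<gamma>)) \<star> dd \<gamma>)"
    using assms(3) by (intro sum.cong refl) (auto simp: index_mult_mat_sum[OF assms(1,2)] poly_path_sum sum_pmul)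
  finally show ?thesis .
qed

lemma bb_one_mat: "\<alpha> < r \<Longrightarrow> (\<Sum>\<gamma><r. bb \<gamma> \<star> poly_path (if \<gamma> = \<alpha> then 1 else 0)) = bb \<alpha>"
  by (subst sum.cong[OF refl, of _ _ "\<lambda>\<gamma>. if \<gamma> = \<alpha> then bb \<gamma> else 0"]) auto

lemma dd_one_mat: "\<alpha> < r \<Longrightarrow> (\<Sum>\<gamma><r. poly_path (if \<alpha> = \<gamma> then 1 else 0) \<star> dd \<gamma>) = dd \<alpha>"
  by (subst sum.cong[OF refl, of _ _ "\<lambda>\<gamma>. if \<gamma> = \<alpha> then dd \<gamma> else 0"]) auto

text \<open>An endomorphism acts on the coefficients as well as on the \<open>b\<close>, so in
  general the entries of \<open>B\<close> would be replaced by their images; here they are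
  polynomials in the fixed loop \<open>a\<close>.\<close>

lemma endo_apply_bb_sum:
  assumes "endo r \<psi>" "\<psi> (arr Arr_a) = arr Arr_a" "has_matrix r \<psi> A" "B \<in> carrier_mat r r" "\<alpha> < r"
  shows "\<psi> (\<Sum>\<beta><r. bb \<beta> \<star> poly_path (B $$ (\<beta>, \<alpha>))) = (\<Sum>\<gamma><r. bb \<gamma> \<star> poly_path ((A * B) $$ (\<gamma>, \<alpha>)))"
proof -
  have "\<psi> (\<Sum>\<beta><r. bb \<beta> \<star> poly_path (B $$ (\<beta>, \<alpha>)))
    = (\<Sum>\<beta><r. (\<Sum>\<gamma><r. bb \<gamma> \<star> poly_path (A $$ (\<gamma>, \<beta>))) \<star> poly_path (B $$ (\<beta>, \<alpha>)))"
    using assms(3) by (simp add: endo_bb_sum[OF assms(1)]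
        endo_poly_path[OF assms(1,2)] has_matrix_def)
  also have "\<dots> = (\<Sum>\<gamma><r. bb \<gamma> \<star> poly_path ((A * B) $$ (\<gamma>, \<alpha>)))"
    by (rule bb_mat_mult) (use assms in \<open>auto simp: has_matrix_def\<close>)
  finally show ?thesis .
qed

lemma has_matrix_comp:
  assumes "endo r \<psi>" "\<psi> (arr Arr_a) = arr Arr_a" "has_matrix r \<psi> A" "has_matrix r \<phi> B"
  shows "has_matrix r (\<lambda>x. \<psi> (\<phi> x)) (A * B)"
  using assms(3,4) endo_apply_bb_sum[OF assms(1-3)] by (auto simp: has_matrix_def)


section \<open>The automorphism attached to a pair of inverse matrices\<close>

text \<open>Sends the row of the \<open>b\<close> to its product with \<open>A\<close> on the right and the column of the \<open>d\<close> to its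
  product with \<open>B\<close> on the left, so that for \<open>A B = 1\<close> the sum of the \<open>b\<^sub>\<alpha> d\<^sub>\<alpha>\<close>, which is \<open>e2 c\<^sub>r\<close>, is preserved.\<close>

definition twist_image :: "nat \<Rightarrow> complex poly mat \<Rightarrow> complex poly mat \<Rightarrow> qelem \<Rightarrow> arrow \<Rightarrow> qelem" where
  "twist_image r A B q \<eta> = (case \<eta> of
     Arr_a \<Rightarrow> arr Arr_a
   | Arr_a_star \<Rightarrow> arr Arr_a_star + q
   | Arr_b n \<Rightarrow> (\<Sum>\<beta><r. bb \<beta> \<star> poly_path (A $$ (\<beta>, n - 1)))
   | Arr_d n \<Rightarrow> (\<Sum>\<beta><r. poly_path (B $$ (n - 1, \<beta>)) \<star> dd \<beta>))"

definition twist_hom :: "nat \<Rightarrow> complex poly mat \<Rightarrow> complex poly mat \<Rightarrow> qelem \<Rightarrow> qelem \<Rightarrow> qelem" where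
  "twist_hom r A B q = path_hom (twist_image r A B q)"

lemma arcs_cases [consumes 1, case_names a a_star b d]:
  assumes "\<eta> \<in> arcs (Qr r)"
  obtains "\<eta> = Arr_a" | "\<eta> = Arr_a_star" | \<alpha> where "\<alpha> < r" "\<eta> = Arr_b (Suc \<alpha>)"
    | \<alpha> where "\<alpha> < r" "\<eta> = Arr_d (Suc \<alpha>)"
proof -
  have "\<exists>\<alpha><r. n = Suc \<alpha>" if "n \<in> {1..r}" for n using that by (cases n) auto
  then show thesis using assms that by (auto; blast)
qed

text \<open>Membership of \<open>q\<close> in \<open>A1 r\<close> makes the image of
  \<open>a\<^sup>*\<close> a combination of cycles at the vertex 1, as \<open>arrow_images\<close>
  demands.\<close>

lemma
  assumes "q \<in> carrier (A1 r)"
  shows twist_endo: "endo r (twist_hom r A B q)"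
    and twist_a: "twist_hom r A B q (arr Arr_a) = arr Arr_a"
    and twist_a_star: "twist_hom r A B q (arr Arr_a_star) = arr Arr_a_star + q"
    and twist_bb: "\<alpha> < r \<Longrightarrow> twist_hom r A B q (bb \<alpha>) = (\<Sum>\<beta><r. bb \<beta> \<star> poly_path (A $$ (\<beta>, \<alpha>)))"
    and twist_dd: "\<alpha> < r \<Longrightarrow> twist_hom r A B q (dd \<alpha>) = (\<Sum>\<beta><r. poly_path (B $$ (\<alpha>, \<beta>)) \<star> dd \<beta>)"
proof -
  interpret arrow_images r "twist_image r A B q"
  proof
    fix \<eta> assume "\<eta> \<in> arcs (Qr r)"
    then show "twist_image r A B q \<eta> \<in> carrier (CQ r)"
      using assms by (cases rule: arcs_cases) (auto simp: twist_image_def carrier_A1)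
    show "trivial_path (arrow_head \<eta>) \<star> twist_image r A B q \<eta> = twist_image r A B q \<eta>"
      using assms by (cases \<eta>) (auto simp: twist_image_def carrier_A1 pmul_distrib pmul_sum
          pmul_assoc[symmetric] trivial_arr)
    show "twist_image r A B q \<eta> \<star> trivial_path (arrow_tail \<eta>) = twist_image r A B q \<eta>"
      using assms by (cases \<eta>) (auto simp: twist_image_def carrier_A1 pmul_distrib sum_pmul
          pmul_assoc arr_trivial)
  qed
  show "endo r (twist_hom r A B q)" unfolding twist_hom_def by (rule endo_path_hom)
  show "twist_hom r A B q (arr Arr_a) = arr Arr_a"
    "twist_hom r A B q (arr Arr_a_star) = arr Arr_a_star + q"
    by (simp_all add: twist_hom_def path_hom_arr) (simp_all add: twist_image_def)
  show "\<alpha> < r \<Longrightarrow> twist_hom r A B q (bb \<alpha>) = (\<Sum>\<beta><r. bb \<beta> \<star> poly_path (A $$ (\<beta>, \<alpha>)))"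
    unfolding twist_hom_def by (subst path_hom_arr) (auto simp: twist_image_def)
  show "\<alpha> < r \<Longrightarrow> twist_hom r A B q (dd \<alpha>) = (\<Sum>\<beta><r. poly_path (B $$ (\<alpha>, \<beta>)) \<star> dd \<beta>)"
    unfolding twist_hom_def by (subst path_hom_arr) (auto simp: twist_image_def)
qed

definition twist_aut :: "nat \<Rightarrow> complex poly mat \<Rightarrow> complex poly mat \<Rightarrow> qelem \<Rightarrow> qelem \<Rightarrow> qelem" where
  "twist_aut r A B q = restrict (twist_hom r A B q) (carrier (CQ r))"

text \<open>The inverse exchanges \<open>A\<close> and \<open>B\<close> and replaces
  \<open>q\<close> by \<open>- q\<close>. The two composites return \<open>a\<^sup>*\<close> to
  itself exactly because each map fixes \<open>q\<close>.\<close>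

lemma twist_aut_carrier:
  assumes A: "A \<in> carrier_mat r r" and B: "B \<in> carrier_mat r r"
    and AB: "A * B = 1\<^sub>m r" and BA: "B * A = 1\<^sub>m r" and q: "q \<in> carrier (A1 r)"
    and fix_q: "twist_hom r A B q q = q" "twist_hom r B A (- q) q = q"
  shows "twist_aut r A B q \<in> carrier (AutCQ r)"
proof -
  have q': "- q \<in> carrier (A1 r)" using q by (simp add: carrier_A1)
  \<comment> \<open>Stated for arbitrary data so that both composites are instances, the second one
    with \<open>A\<close> and \<open>B\<close> exchanged and the sign of \<open>q\<close>
    reversed.\<close>
  have inverse: "twist_hom r A B q (twist_hom r B A q' (arr \<eta>)) = arr \<eta>"
    if "\<eta> \<in> arcs (Qr r)" "A \<in> carrier_mat r r" "B \<in> carrier_mat r r" "A * B = 1\<^sub>m r"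
      "q \<in> carrier (A1 r)" "q' \<in> carrier (A1 r)" "twist_hom r A B q q' = - q" for A B q q' \<eta>
    using that(1)
  proof (cases rule: arcs_cases)
    case a
    then show ?thesis using that by (simp add: twist_a)
  next
    case a_star
    then show ?thesis using that
      by (simp add: twist_a_star endoD(2)[OF twist_endo] carrier_A1[of q'])
  next
    case (b \<alpha>)
    have "has_matrix r (twist_hom r A B q) A"
      using that by (simp add: has_matrix_def twist_bb)
    with b that show ?thesis
      by (simp add: twist_bb[OF that(6)] endo_apply_bb_sum twist_endo twist_a bb_one_mat)
  next
    case (d \<alpha>)
    have "twist_hom r A B q (\<Sum>\<beta><r. poly_path (A $$ (\<alpha>, \<beta>)) \<star> dd \<beta>)
      = (\<Sum>\<beta><r. poly_path (A $$ (\<alpha>, \<beta>)) \<star> (\<Sum>\<gamma><r. poly_path (B $$ (\<beta>, \<gamma>)) \<star> dd \<gamma>))"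
      by (simp add: endo_dd_sum[OF twist_endo[OF that(5)]]
        endo_poly_path[OF twist_endo[OF that(5)] twist_a[OF that(5)]] twist_dd[OF that(5)])
    with d that show ?thesis
      by (simp add: twist_dd[OF that(6)] dd_mat_mult dd_one_mat)
  qed
  show ?thesis
    unfolding twist_aut_def
  proof (rule automorphismI[OF twist_endo[OF q] twist_endo[OF q']])
    fix \<eta> assume "\<eta> \<in> arcs (Qr r)"
    moreover have "twist_hom r A B q (- q) = - q"
      using fix_q q by (simp add: endo_simps(2)[OF twist_endo] carrier_A1)
    ultimately show "twist_hom r A B q (twist_hom r B A (- q) (arr \<eta>)) = arr \<eta>"
      "twist_hom r B A (- q) (twist_hom r A B q (arr \<eta>)) = arr \<eta>"
      using inverse assms q' by auto
  qed
qed

lemma twist_aut_has_matrix: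
  "A \<in> carrier_mat r r \<Longrightarrow> q \<in> carrier (A1 r) \<Longrightarrow> has_matrix r (twist_aut r A B q) A"
  by (simp add: has_matrix_def twist_aut_def twist_bb)

section \<open>The moment map element\<close>

text \<open>Odd indices belong to the pairs of \<open>x\<close> and even ones to the pairs of
  \<open>y\<close>. In the induction the parity of \<open>r\<close> decides which of the two sums
  gains a term.\<close>

lemma sum_odd_plus_even:
  fixes f :: "nat \<Rightarrow> 'x :: comm_monoid_add"
  shows "(\<Sum>i\<in>{1..(r + 1) div 2}. f (2 * i - 1)) + (\<Sum>j\<in>{1..r div 2}. f (2 * j)) = (\<Sum>\<alpha>\<in>{1..r}. f \<alpha>)"
proof (induction r)
  case (Suc r)
  show ?case
  proof (cases "even r")
    case True
    then obtain k where "r = 2 * k" by (elim evenE)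
    with Suc show ?thesis by (simp add: ac_simps)
  next
    case False
    then obtain k where "r = 2 * k + 1" by (elim oddE)
    with Suc show ?thesis by (simp add: add.assoc[symmetric])
  qed
qed simp

text \<open>The sign in \<open>el_x\<close> gives the commutators of both kinds the common form b d
  - d b, so the distinction by parity disappears.\<close>

lemma el_c_eq:
  "el_c r = arr Arr_a \<star> arr Arr_a_star - arr Arr_a_star \<star> arr Arr_a
    + (\<Sum>\<alpha><r. bb \<alpha> \<star> dd \<alpha> - dd \<alpha> \<star> bb \<alpha>)"
proof -
  define f where "f \<alpha> = arr (Arr_b \<alpha>) \<star> arr (Arr_d \<alpha>) - arr (Arr_d \<alpha>) \<star> arr (Arr_b \<alpha>)" for \<alpha>
  have car: "arr (Arr_b \<alpha>) \<in> carrier (CQ r)" "arr (Arr_d \<alpha>) \<in> carrier (CQ r)" if "\<alpha> \<in> {1..r}" for \<alpha>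
    using that by (auto intro!: carrier_arr)
  have f: "f \<alpha> \<in> carrier (CQ r)" if "\<alpha> \<in> {1..r}" for \<alpha>
    using car[OF that] by (simp add: f_def)
  have x: "commutator (CQ r) (el_x r i) (el_x_star r i) = f (2 * i - 1)" "2 * i - 1 \<in> {1..r}"
    if "i \<in> {1..(r + 1) div 2}" for i
  proof -
    show i: "2 * i - 1 \<in> {1..r}" using that by auto
    show "commutator (CQ r) (el_x r i) (el_x_star r i) = f (2 * i - 1)"
      using car[OF i]
      by (simp add: el_x_def el_x_star_def el_d_def el_b_def arrow_path_Qr a_inv_CQ commutator_CQ f_def)
  qed
  have y: "commutator (CQ r) (el_y r j) (el_y_star r j) = f (2 * j)" "2 * j \<in> {1..r}"
    if "j \<in> {1..r div 2}" for j
  proof -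
    show j: "2 * j \<in> {1..r}" using that by auto
    show "commutator (CQ r) (el_y r j) (el_y_star r j) = f (2 * j)"
      using car[OF j]
      by (simp add: el_y_def el_y_star_def el_d_def el_b_def arrow_path_Qr commutator_CQ f_def)
  qed
  have "finsum (CQ r) (\<lambda>i. commutator (CQ r) (el_x r i) (el_x_star r i)) {1..(r + 1) div 2}
    = (\<Sum>i\<in>{1..(r + 1) div 2}. f (2 * i - 1))"
    by (subst finsum_CQ) (use x f in \<open>auto intro!: sum.cong\<close>)
  moreover have "finsum (CQ r) (\<lambda>j. commutator (CQ r) (el_y r j) (el_y_star r j)) {1..r div 2}
    = (\<Sum>j\<in>{1..r div 2}. f (2 * j))"
    by (subst finsum_CQ) (use y f in \<open>auto intro!: sum.cong\<close>)
  moreover have "(\<Sum>\<alpha>\<in>{1..r}. f \<alpha>) = (\<Sum>\<alpha><r. f (Suc \<alpha>))"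
    by (rule sum.reindex_bij_witness[of _ Suc "\<lambda>j. j - 1"]) auto
  ultimately show ?thesis
    unfolding el_c_def
    by (simp add: el_a_def el_a_star_def arrow_path_Qr commutator_CQ add.assoc sum_odd_plus_even[simplified])
      (simp add: f_def)
qed

lemma carrier_el_c [simp]: "el_c r \<in> carrier (CQ r)"
  unfolding el_c_eq by (intro carrier_closed carrier_sum carrier_pmul) auto

lemma e2_el_c: "e2 \<star> el_c r = (\<Sum>\<alpha><r. bb \<alpha> \<star> dd \<alpha>)"
  and e1_el_c: "e1 \<star> el_c r = arr Arr_a \<star> arr Arr_a_star - arr Arr_a_star \<star> arr Arr_a
    - (\<Sum>\<alpha><r. dd \<alpha> \<star> bb \<alpha>)"
  unfolding el_c_eq
  by (auto simp: pmul_distrib pmul_sum pmul_assoc[symmetric] trivial_arr sum_subtractf sum_negf)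

text \<open>The unit is \<open>e1 + e2\<close> and both idempotents are fixed, so the equation
  splits into its parts ending at the vertex 2 and at the vertex 1.\<close>

lemma symplectic_components:
  assumes "endo r \<psi>"
  shows "\<psi> (el_c r) = el_c r \<longleftrightarrow>
    (\<Sum>\<alpha><r. \<psi> (bb \<alpha>) \<star> \<psi> (dd \<alpha>)) = (\<Sum>\<alpha><r. bb \<alpha> \<star> dd \<alpha>) \<and>
    \<psi> (arr Arr_a) \<star> \<psi> (arr Arr_a_star) - \<psi> (arr Arr_a_star) \<star> \<psi> (arr Arr_a)
      - (\<Sum>\<alpha><r. \<psi> (dd \<alpha>) \<star> \<psi> (bb \<alpha>))
    = arr Arr_a \<star> arr Arr_a_star - arr Arr_a_star \<star> arr Arr_a - (\<Sum>\<alpha><r. dd \<alpha> \<star> bb \<alpha>)"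
proof -
  have "\<psi> (\<Sum>\<alpha><r. dd \<alpha> \<star> bb \<alpha>) = (\<Sum>\<alpha><r. \<psi> (dd \<alpha> \<star> bb \<alpha>))"
    by (rule endo_simps(4)[OF assms]) auto
  then have dsum: "\<psi> (\<Sum>\<alpha><r. dd \<alpha> \<star> bb \<alpha>) = (\<Sum>\<alpha><r. \<psi> (dd \<alpha>) \<star> \<psi> (bb \<alpha>))"
    by (simp add: endoD(3)[OF assms])
  have dcar: "(\<Sum>\<alpha><r. dd \<alpha> \<star> bb \<alpha>) \<in> carrier (CQ r)"
    by (rule carrier_sum) auto
  have 1: "e1 \<star> \<psi> (el_c r) = \<psi> (arr Arr_a) \<star> \<psi> (arr Arr_a_star) - \<psi> (arr Arr_a_star) \<star> \<psi> (arr Arr_a)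
      - (\<Sum>\<alpha><r. \<psi> (dd \<alpha>) \<star> \<psi> (bb \<alpha>))"
    using endoD(3)[OF assms, of e1 "el_c r"]
    by (simp add: endoD[OF assms] e1_el_c endo_simps[OF assms] dsum dcar)
  have 2: "e2 \<star> \<psi> (el_c r) = (\<Sum>\<alpha><r. \<psi> (bb \<alpha>) \<star> \<psi> (dd \<alpha>))"
    using endoD(3)[OF assms, of e2 "el_c r"]
    by (simp add: endoD[OF assms] e2_el_c endo_bb_sum[OF assms])
  have "\<psi> (el_c r) = el_c r \<longleftrightarrow> e1 \<star> \<psi> (el_c r) = e1 \<star> el_c r \<and> e2 \<star> \<psi> (el_c r) = e2 \<star> el_c r"
    by (metis one_pmul pmul_distrib(1))
  then show ?thesis unfolding 1 2 e1_el_c e2_el_c by blast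
qed

section \<open>Reduced automorphisms\<close>

text \<open>The end vertex is not tested, because a path of loops starting at \<open>V1\<close> ends
  there (\<open>qcas_loops\<close>). The trivial path at \<open>V1\<close> counts, the one at
  \<open>V2\<close> does not.\<close>

definition loop_path :: "(vertex, arrow) path \<Rightarrow> bool" where
  "loop_path x = (case x of (u, p, v) \<Rightarrow> u = V1 \<and> set p \<subseteq> {Arr_a, Arr_a_star})"

text \<open>An explicit ideal containing \<open>ideal_I r\<close>. It turns membership in the
  generated ideal into vanishing of the coefficients at all words in \<open>a\<close> and
  \<open>a\<^sup>*\<close>.\<close>

definition no_loop_part :: "nat \<Rightarrow> qelem set" where
  "no_loop_part r = {f \<in> carrier (CQ r). \<forall>x\<in>Poly_Mapping.keys f. \<not> loop_path x}"

lemma qcas_loops: "qcas u p v \<Longrightarrow> u = V1 \<Longrightarrow> set p \<subseteq> {Arr_a, Arr_a_star} \<Longrightarrow> v = V1"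
  by (induction p arbitrary: u) auto

text \<open>If a concatenation of two paths consists of loops at \<open>V1\<close>, then so does
  each of the two.\<close>

lemma ideal_no_loop_part: "ideal (no_loop_part r) (CQ r)"
proof (rule idealI[OF ring_CQ])
  interpret ring "CQ r" by (rule ring_CQ)
  show "subgroup (no_loop_part r) (add_monoid (CQ r))"
  proof (rule add.subgroupI)
    show "no_loop_part r \<subseteq> carrier (CQ r)" by (auto simp: no_loop_part_def)
    have "0 \<in> no_loop_part r" by (simp add: no_loop_part_def)
    then show "no_loop_part r \<noteq> {}" by blast
  next
    fix f assume "f \<in> no_loop_part r"
    then show "\<ominus>\<^bsub>CQ r\<^esub> f \<in> no_loop_part r"
      by (auto simp: no_loop_part_def a_inv_CQ in_keys_iff)
  next
    fix f g assume "f \<in> no_loop_part r" "g \<in> no_loop_part r"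
    then show "f \<oplus>\<^bsub>CQ r\<^esub> g \<in> no_loop_part r"
      using Poly_Mapping.keys_add[of f g] by (auto simp: no_loop_part_def)
  qed
next
  fix f g assume f: "f \<in> no_loop_part r" and g: "g \<in> carrier (CQ r)"
  show "g \<otimes>\<^bsub>CQ r\<^esub> f \<in> no_loop_part r"
    unfolding no_loop_part_def
  proof (intro CollectI conjI ballI notI)
    fix z assume z: "z \<in> Poly_Mapping.keys (g \<otimes>\<^bsub>CQ r\<^esub> f)" "loop_path z"
    then obtain u q w p v where "z = (u, q @ p, v)" "(u, q, w) \<in> Poly_Mapping.keys f"
      by (auto elim: keys_pmul)
    with z(2) f show False by (auto simp: no_loop_part_def loop_path_def)
  qed (use f g in \<open>auto simp: no_loop_part_def\<close>)
  show "f \<otimes>\<^bsub>CQ r\<^esub> g \<in> no_loop_part r"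
    unfolding no_loop_part_def
  proof (intro CollectI conjI ballI notI)
    fix z assume z: "z \<in> Poly_Mapping.keys (f \<otimes>\<^bsub>CQ r\<^esub> g)" "loop_path z"
    then obtain u q w p v where *: "z = (u, q @ p, v)" "(w, p, v) \<in> Poly_Mapping.keys f"
        "(u, q, w) \<in> Poly_Mapping.keys g"
      by (auto elim: keys_pmul)
    then have "qcas u q w" using g by (auto simp: carrier_CQ mem_paths_Qr simp del: Qr_simps)
    \<comment> \<open>Here the element of the ideal contributes the second half of the path, so its
      start vertex has to be located: loops lead from \<open>V1\<close> only to
      \<open>V1\<close>.\<close>
    then have "w = V1" using z(2) * by (auto simp: loop_path_def intro: qcas_loops)
    with z(2) * f show False by (auto simp: no_loop_part_def loop_path_def)
  qed (use f g in \<open>auto simp: no_loop_part_def\<close>)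
qed

lemma ideal_I_generators: "{e2} \<union> el_d r ` {1..r} \<union> el_b r ` {1..r} \<subseteq> carrier (CQ r)"
  by (auto simp: el_d_def el_b_def arrow_path_Qr intro!: carrier_arr)

lemma ideal_ideal_I: "ideal (ideal_I r) (CQ r)"
  unfolding ideal_I_def by (rule ring.genideal_ideal[OF ring_CQ ideal_I_generators])

lemma ideal_I_subset_no_loop_part: "ideal_I r \<subseteq> no_loop_part r"
  unfolding ideal_I_def
proof (rule ring.genideal_minimal[OF ring_CQ ideal_no_loop_part])
  show "{e2} \<union> el_d r ` {1..r} \<union> el_b r ` {1..r} \<subseteq> no_loop_part r"
    using ideal_I_generators[of r]
    by (auto simp: no_loop_part_def el_d_def el_b_def arrow_path_Qr trivial_path_def arr_def loop_path_def)
qed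

lemma ideal_I_bb: "\<beta> < r \<Longrightarrow> bb \<beta> \<in> ideal_I r"
  and ideal_I_dd: "\<beta> < r \<Longrightarrow> dd \<beta> \<in> ideal_I r"
proof -
  assume "\<beta> < r"
  then have "bb \<beta> \<in> el_b r ` {1..r}" "dd \<beta> \<in> el_d r ` {1..r}"
    by (auto simp: el_b_def el_d_def arrow_path_Qr intro!: image_eqI[of _ _ "Suc \<beta>"])
  then show "bb \<beta> \<in> ideal_I r" "dd \<beta> \<in> ideal_I r"
    using ring.genideal_self[OF ring_CQ ideal_I_generators[of r]] unfolding ideal_I_def by auto
qed

lemma ideal_I_carrier: "f \<in> ideal_I r \<Longrightarrow> f \<in> carrier (CQ r)"
  using ideal_I_subset_no_loop_part by (auto simp: no_loop_part_def)

lemma ideal_I_closed: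
  "0 \<in> ideal_I r"
  "f \<in> ideal_I r \<Longrightarrow> g \<in> ideal_I r \<Longrightarrow> f + g \<in> ideal_I r"
  "f \<in> ideal_I r \<Longrightarrow> - f \<in> ideal_I r"
  "f \<in> ideal_I r \<Longrightarrow> g \<in> ideal_I r \<Longrightarrow> f - g \<in> ideal_I r"
  "f \<in> ideal_I r \<Longrightarrow> g \<in> carrier (CQ r) \<Longrightarrow> f \<star> g \<in> ideal_I r"
  "f \<in> ideal_I r \<Longrightarrow> g \<in> carrier (CQ r) \<Longrightarrow> g \<star> f \<in> ideal_I r"
  "f \<in> ideal_I r \<Longrightarrow> scale c f \<in> ideal_I r"
proof -
  interpret ideal "ideal_I r" "CQ r" by (rule ideal_ideal_I)
  show "0 \<in> ideal_I r"
    using additive_subgroup.zero_closed[OF additive_subgroup_axioms] by simp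
  show add: "f \<in> ideal_I r \<Longrightarrow> g \<in> ideal_I r \<Longrightarrow> f + g \<in> ideal_I r" for f g
    using additive_subgroup.a_closed[OF additive_subgroup_axioms, of f g] by simp
  show neg: "f \<in> ideal_I r \<Longrightarrow> - f \<in> ideal_I r" for f
    using additive_subgroup.a_inv_closed[OF additive_subgroup_axioms, of f] by (simp add: a_inv_CQ ideal_I_carrier)
  show "f \<in> ideal_I r \<Longrightarrow> g \<in> ideal_I r \<Longrightarrow> f - g \<in> ideal_I r"
    using add[of f "- g"] neg[of g] by simp
  show "f \<in> ideal_I r \<Longrightarrow> g \<in> carrier (CQ r) \<Longrightarrow> f \<star> g \<in> ideal_I r"
    using I_r_closed[of f g] by simp
  show l: "f \<in> ideal_I r \<Longrightarrow> g \<in> carrier (CQ r) \<Longrightarrow> g \<star> f \<in> ideal_I r" for f g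
    using I_l_closed[of f g] by simp
  \<comment> \<open>Scaling is multiplication by a multiple of the unit.\<close>
  show "f \<in> ideal_I r \<Longrightarrow> scale c f \<in> ideal_I r"
    using l[of f "scale c (e1 + e2)"] by (simp add: one_pmul)
qed

lemma ideal_I_sum: "(\<And>x. x \<in> A \<Longrightarrow> F x \<in> ideal_I r) \<Longrightarrow> sum F A \<in> ideal_I r"
  by (induction A rule: infinite_finite_induct) (auto simp: ideal_I_closed)

lemma reduced_aut_iff:
  assumes "endo r \<psi>"
  shows "reduced_aut r \<psi> \<longleftrightarrow> (\<forall>z\<in>carrier (CQ r). \<psi> z - z \<in> ideal_I r)"
proof -
  have "(ideal_I r +>\<^bsub>CQ r\<^esub> \<psi> z = ideal_I r +>\<^bsub>CQ r\<^esub> z) \<longleftrightarrow> \<psi> z - z \<in> ideal_I r"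
    if "z \<in> carrier (CQ r)" for z
    using ring.quotient_eq_iff_same_a_r_cos[OF ring_CQ ideal_ideal_I, of "\<psi> z" r z] that
    by (simp add: endoD[OF assms] a_minus_def a_inv_CQ)
  then show ?thesis by (simp add: reduced_aut_def)
qed

text \<open>Congruence to the identity modulo an ideal passes from arrows to products and linear
  combinations.\<close>

lemma reduced_endoI:
  assumes "endo r \<psi>" "\<And>\<eta>. \<eta> \<in> arcs (Qr r) \<Longrightarrow> \<psi> (arr \<eta>) - arr \<eta> \<in> ideal_I r" "z \<in> carrier (CQ r)"
  shows "\<psi> z - z \<in> ideal_I r"
proof -
  have word: "\<psi> (Poly_Mapping.single (u, p, v) 1) - Poly_Mapping.single (u, p, v) 1 \<in> ideal_I r"
    if "set p \<subseteq> arcs (Qr r)" "qcas u p v" for u p v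
    using that
  proof (induction p arbitrary: u)
    case Nil
    then show ?case
      using endoD(5)[OF assms(1), of u] by (simp add: trivial_path_def ideal_I_closed)
  next
    case (Cons e p)
    let ?s = "Poly_Mapping.single (arrow_head e, p, v) (1::complex)"
    have car: "?s \<in> carrier (CQ r)" "arr e \<in> carrier (CQ r)"
      using Cons.prems by (auto simp: carrier_single)
    have s: "Poly_Mapping.single (u, e # p, v) 1 = ?s \<star> arr e"
      using Cons.prems by (simp add: single_Cons_path)
    \<comment> \<open>The difference of two products, written so that each summand contains one
      difference of factors.\<close>
    have "\<psi> (?s \<star> arr e) - ?s \<star> arr e = (\<psi> ?s - ?s) \<star> \<psi> (arr e) + ?s \<star> (\<psi> (arr e) - arr e)"
      using car by (simp add: endoD[OF assms(1)] pmul_distrib)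
    also have "\<dots> \<in> ideal_I r"
    proof (rule ideal_I_closed(2)[OF ideal_I_closed(5) ideal_I_closed(6)])
      show "\<psi> ?s - ?s \<in> ideal_I r" using Cons.prems by (intro Cons.IH) auto
      show "\<psi> (arr e) - arr e \<in> ideal_I r" using Cons.prems by (intro assms(2)) auto
    qed (use car in \<open>auto simp: endoD[OF assms(1)]\<close>)
    finally show ?case by (simp add: s)
  qed
  have paths: "x \<in> paths (Qr r)" if "x \<in> Poly_Mapping.keys z" for x
    using that assms(3) by (auto simp: carrier_CQ)
  have car: "Poly_Mapping.single x 1 \<in> carrier (CQ r)" if "x \<in> Poly_Mapping.keys z" for x
    using paths[OF that] by (cases x) (simp add: carrier_CQ)
  have "\<psi> z - z = \<psi> (lin_ext (\<lambda>x. Poly_Mapping.single x 1) z) - lin_ext (\<lambda>x. Poly_Mapping.single x 1) z"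
    by (simp add: poly_mapping_eq_lin_ext)
  also have "\<dots> = (\<Sum>x\<in>Poly_Mapping.keys z.
      scale (coef z x) (\<psi> (Poly_Mapping.single x 1) - Poly_Mapping.single x 1))"
    unfolding lin_ext_def using car
    by (simp add: endo_simps[OF assms(1)] endoD[OF assms(1)] sum_subtractf scale_diff_right
        del: scale_simps(5))
  also have "\<dots> \<in> ideal_I r"
  proof (intro ideal_I_sum ideal_I_closed(7))
    fix x assume "x \<in> Poly_Mapping.keys z"
    then have "x \<in> paths (Qr r)" by (rule paths)
    then show "\<psi> (Poly_Mapping.single x 1) - Poly_Mapping.single x 1 \<in> ideal_I r"
      by (cases x) (auto intro!: word simp: mem_paths_Qr simp del: Qr_simps)
  qed
  finally show ?thesis .
qed

text \<open>The two cases of the rotation argument below: either the word is a power of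
  \<open>a\<close>, or it has a last letter different from \<open>a\<close>, followed by a run of
  letters \<open>a\<close>.\<close>

lemma loop_word_cases:
  "w = replicate (length w) Arr_a \<or> (\<exists>u e k. e \<noteq> Arr_a \<and> w = u @ e # replicate k Arr_a)"
proof (induction w rule: rev_induct)
  case (snoc e w)
  show ?case
  proof (cases "e = Arr_a")
    case True
    from snoc show ?thesis
    proof
      assume "w = replicate (length w) Arr_a"
      then have "w @ [e] = replicate (length (w @ [e])) Arr_a"
        using True replicate_append_same[of "length w" Arr_a] by simp
      then show ?thesis by blast
    next
      assume "\<exists>u e k. e \<noteq> Arr_a \<and> w = u @ e # replicate k Arr_a"
      then obtain u e' k where "e' \<noteq> Arr_a" "w = u @ e' # replicate k Arr_a" by blast
      then have "e' \<noteq> Arr_a \<and> w @ [e] = u @ e' # replicate (Suc k) Arr_a"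
        using True by (simp add: replicate_append_same)
      then show ?thesis by blast
    qed
  next
    case False
    then have "e \<noteq> Arr_a \<and> w @ [e] = w @ e # replicate 0 Arr_a" by simp
    then show ?thesis by blast
  qed
qed simp

text \<open>An element commuting with \<open>a\<close> has the same coefficient at \<open>a w\<close> as at \<open>w a\<close>; rotating
  the trailing letters \<open>a\<close> of a word to its front leaves only the powers of \<open>a\<close>.\<close>

lemma commute_a_ideal_I_eq_0:
  assumes comm: "arr Arr_a \<star> q = q \<star> arr Arr_a" and q: "q \<in> ideal_I r" "q \<in> carrier (A1 r)"
  shows "q = 0"
proof -
  \<comment> \<open>Both sides of \<open>comm\<close> are compared at the word
    \<open>Arr_a # u\<close>: the factor on the right is stripped from its front, the factor on the
    left from its end.\<close>
  have step: "coef q (V1, u, V1) =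
      (if \<exists>w'. Arr_a # u = w' @ [Arr_a] then coef q (V1, take (length u) (Arr_a # u), V1) else 0)" for u
  proof -
    have "coef (q \<star> arr Arr_a) (V1, Arr_a # u, V1) = coef q (V1, u, V1)"
      by (simp add: arr_def coef_pmul_single)
    moreover have "coef (arr Arr_a \<star> q) (V1, Arr_a # u, V1) =
      (if \<exists>w'. Arr_a # u = w' @ [Arr_a] then coef q (V1, take (length u) (Arr_a # u), V1) else 0)"
      by (simp add: arr_def coef_single_pmul)
    ultimately show ?thesis using comm by simp
  qed
  have tail: "coef q (V1, u @ e # replicate k Arr_a, V1) = 0" if "e \<noteq> Arr_a" for u e k
  proof (induction k arbitrary: u)
    case 0
    have "\<not> (\<exists>w'. Arr_a # u @ [e] = w' @ [Arr_a])"
      using that by (metis append_Cons last_snoc)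
    then show ?case using step[of "u @ [e]"] by simp
  next
    case (Suc k)
    have "Arr_a # u @ e # replicate (Suc k) Arr_a = (Arr_a # u @ e # replicate k Arr_a) @ [Arr_a]"
      by (simp add: replicate_append_same)
    then have "coef q (V1, u @ e # replicate (Suc k) Arr_a, V1)
      = coef q (V1, take (length (u @ e # replicate (Suc k) Arr_a))
          ((Arr_a # u @ e # replicate k Arr_a) @ [Arr_a]), V1)"
      using step[of "u @ e # replicate (Suc k) Arr_a"] by auto
    also have "\<dots> = coef q (V1, (Arr_a # u) @ e # replicate k Arr_a, V1)"
      by simp
    finally show ?case using Suc[of "Arr_a # u"] by simp
  qed
  \<comment> \<open>Rotation says nothing about powers of \<open>a\<close>; their coefficients
    vanish because \<open>q\<close> lies in the ideal.\<close>
  have "coef q (V1, replicate n Arr_a, V1) = 0" for n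
  proof -
    have "loop_path (V1, replicate n Arr_a, V1)" by (auto simp: loop_path_def)
    moreover have "q \<in> no_loop_part r" using q ideal_I_subset_no_loop_part by blast
    ultimately show ?thesis by (auto simp: no_loop_part_def in_keys_iff)
  qed
  then have V1: "coef q (V1, w, V1) = 0" for w
    using loop_word_cases[of w] tail by metis
  have "coef (e1 \<star> q) (u, w, V2) = 0" "coef (q \<star> e1) (V2, w, v) = 0" for u w v
    by (simp_all add: trivial_path_def coef_single_pmul coef_pmul_single)
  then have V2: "coef q (u, w, V2) = 0" "coef q (V2, w, v) = 0" for u w v
    using q(2) by (simp_all add: carrier_A1)
  show ?thesis
  proof (rule poly_mapping_eqI)
    fix x :: "(vertex, arrow) path"
    obtain u w v where "x = (u, w, v)" by (metis prod_cases3)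
    then show "coef q x = coef 0 x" using V1 V2 by (cases u; cases v) auto
  qed
qed


section \<open>Automorphisms with a matrix over \<open>\<complex>[a]\<close>\<close>

definition poly_aut :: "nat \<Rightarrow> (qelem \<Rightarrow> qelem) set" where
  "poly_aut r = {\<psi> \<in> carrier (AutCQ r). \<psi> (arr Arr_a) = arr Arr_a \<and> symplectic_aut r \<psi> \<and> reduced_aut r \<psi> \<and>
     (\<exists>A \<in> carrier_mat r r. \<exists>B \<in> carrier_mat r r. A * B = 1\<^sub>m r \<and> B * A = 1\<^sub>m r \<and> has_matrix r \<psi> A)}"

lemma has_matrix_cong:
  "has_matrix r \<psi> A \<Longrightarrow> (\<And>f. f \<in> carrier (CQ r) \<Longrightarrow> \<phi> f = \<psi> f) \<Longrightarrow> has_matrix r \<phi> A"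
  by (simp add: has_matrix_def)

lemma has_matrix_mult:
  assumes "\<psi> \<in> carrier (AutCQ r)" "\<psi> (arr Arr_a) = arr Arr_a" "\<phi> \<in> carrier (AutCQ r)"
    "has_matrix r \<psi> A" "has_matrix r \<phi> B"
  shows "has_matrix r (\<psi> \<otimes>\<^bsub>AutCQ r\<^esub> \<phi>) (A * B)"
  using assms has_matrix_comp[of r \<psi> A \<phi> B]
  by (auto simp: AutCQ_iff AutCQ_mult compose_def intro: has_matrix_cong)

lemma has_matrix_inv:
  assumes \<psi>: "\<psi> \<in> carrier (AutCQ r)" "\<psi> (arr Arr_a) = arr Arr_a" "has_matrix r \<psi> A"
    and B: "B \<in> carrier_mat r r" "A * B = 1\<^sub>m r"
  shows "has_matrix r (inv\<^bsub>AutCQ r\<^esub> \<psi>) B"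
  unfolding has_matrix_def
proof (intro conjI allI impI)
  fix \<alpha> assume \<alpha>: "\<alpha> < r"
  let ?s = "\<Sum>\<beta><r. bb \<beta> \<star> poly_path (B $$ (\<beta>, \<alpha>))"
  have "\<psi> ?s = bb \<alpha>"
    using \<psi> B \<alpha> by (subst endo_apply_bb_sum[of r]) (auto simp: AutCQ_iff bb_one_mat)
  then show "(inv\<^bsub>AutCQ r\<^esub> \<psi>) (bb \<alpha>) = ?s"
    using AutCQ_inv(1)[OF \<psi>(1), of ?s] by simp
qed (rule B)

lemma subgroup_poly_aut: "subgroup (poly_aut r) (AutCQ r)"
proof (rule group.subgroupI[OF group_AutCQ])
  interpret group "AutCQ r" by (rule group_AutCQ)
  show "poly_aut r \<subseteq> carrier (AutCQ r)" by (auto simp: poly_aut_def)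
  have "endo r \<one>\<^bsub>AutCQ r\<^esub>" using one_closed by (simp add: AutCQ_iff)
  then have "\<one>\<^bsub>AutCQ r\<^esub> \<in> poly_aut r"
    by (auto simp: poly_aut_def symplectic_aut_def reduced_aut_iff ideal_I_closed has_matrix_def bb_one_mat
        intro!: bexI[of _ "1\<^sub>m r"]) (auto simp: AutCQ_one ideal_I_closed)
  then show "poly_aut r \<noteq> {}" by blast
next
  interpret group "AutCQ r" by (rule group_AutCQ)
  fix \<psi> assume \<psi>: "\<psi> \<in> poly_aut r"
  let ?i = "inv\<^bsub>AutCQ r\<^esub> \<psi>"
  from \<psi> obtain A B where AB: "A \<in> carrier_mat r r" "B \<in> carrier_mat r r" "A * B = 1\<^sub>m r"
    "B * A = 1\<^sub>m r" "has_matrix r \<psi> A" by (auto simp: poly_aut_def)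
  have \<psi>': "\<psi> \<in> carrier (AutCQ r)" "\<psi> (arr Arr_a) = arr Arr_a" "\<psi> (el_c r) = el_c r" "reduced_aut r \<psi>"
    using \<psi> by (auto simp: poly_aut_def symplectic_aut_def)
  have i: "?i \<in> carrier (AutCQ r)" using \<psi>' by simp
  have e: "endo r \<psi>" "endo r ?i" using \<psi>' i by (auto simp: AutCQ_iff)
  have "?i z - z \<in> ideal_I r" if z: "z \<in> carrier (CQ r)" for z
  proof -
    \<comment> \<open>Reducedness of \<psi> is applied at the point \<open>?i z\<close>.\<close>
    have "\<psi> (?i z) - ?i z \<in> ideal_I r"
      using \<psi>'(4) z by (simp add: reduced_aut_iff[OF e(1)] endoD(1)[OF e(2)])
    then have "- (z - ?i z) \<in> ideal_I r"
      using AutCQ_inv(2)[OF \<psi>'(1) z] by (intro ideal_I_closed(3)) simp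
    then show ?thesis by simp
  qed
  moreover have "?i (arr Arr_a) = arr Arr_a" "?i (el_c r) = el_c r"
    using AutCQ_inv(1)[OF \<psi>'(1), of "arr Arr_a"] AutCQ_inv(1)[OF \<psi>'(1), of "el_c r"] \<psi>' by simp_all
  ultimately show "?i \<in> poly_aut r"
    using has_matrix_inv[OF \<psi>'(1,2) AB(5,2,3)] AB i
    by (auto simp: poly_aut_def symplectic_aut_def reduced_aut_iff[OF e(2)])
next
  interpret group "AutCQ r" by (rule group_AutCQ)
  fix \<psi> \<phi> assume a: "\<psi> \<in> poly_aut r" "\<phi> \<in> poly_aut r"
  from a obtain A B where AB: "A \<in> carrier_mat r r" "B \<in> carrier_mat r r" "A * B = 1\<^sub>m r"
    "B * A = 1\<^sub>m r" "has_matrix r \<psi> A" by (auto simp: poly_aut_def)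
  from a obtain C D where CD: "C \<in> carrier_mat r r" "D \<in> carrier_mat r r" "C * D = 1\<^sub>m r"
    "D * C = 1\<^sub>m r" "has_matrix r \<phi> C" by (auto simp: poly_aut_def)
  have \<psi>: "\<psi> \<in> carrier (AutCQ r)" "\<psi> (arr Arr_a) = arr Arr_a" "\<psi> (el_c r) = el_c r" "reduced_aut r \<psi>"
    and \<phi>: "\<phi> \<in> carrier (AutCQ r)" "\<phi> (arr Arr_a) = arr Arr_a" "\<phi> (el_c r) = el_c r" "reduced_aut r \<phi>"
    using a by (auto simp: poly_aut_def symplectic_aut_def)
  have m: "\<psi> \<otimes>\<^bsub>AutCQ r\<^esub> \<phi> \<in> carrier (AutCQ r)" using \<psi> \<phi> by simp
  have e: "endo r \<psi>" "endo r \<phi>" "endo r (\<psi> \<otimes>\<^bsub>AutCQ r\<^esub> \<phi>)" using \<psi> \<phi> m by (auto simp: AutCQ_iff)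
  have app: "(\<psi> \<otimes>\<^bsub>AutCQ r\<^esub> \<phi>) f = \<psi> (\<phi> f)" if "f \<in> carrier (CQ r)" for f
    using that \<psi> \<phi> by (simp add: AutCQ_mult compose_def)
  have "(\<psi> \<otimes>\<^bsub>AutCQ r\<^esub> \<phi>) z - z \<in> ideal_I r" if z: "z \<in> carrier (CQ r)" for z
  proof -
    have "(\<psi> (\<phi> z) - \<phi> z) + (\<phi> z - z) \<in> ideal_I r"
      using \<psi>(4) \<phi>(4) z
      by (intro ideal_I_closed(2)) (auto simp: reduced_aut_iff[OF e(1)] reduced_aut_iff[OF e(2)] endoD(1)[OF e(2)])
    then show ?thesis by (simp add: app z)
  qed
  moreover have "(A * C) * (D * B) = 1\<^sub>m r" "(D * B) * (A * C) = 1\<^sub>m r"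
  proof -
    have "(A * C) * (D * B) = A * (C * (D * B))" "C * (D * B) = (C * D) * B"
      using AB(1,2) CD(1,2) by (auto simp: assoc_mult_mat[of _ r r _ r _ r])
    then show "(A * C) * (D * B) = 1\<^sub>m r" using AB CD by (simp only: left_mult_one_mat)
    have "(D * B) * (A * C) = D * (B * (A * C))" "B * (A * C) = (B * A) * C"
      using AB(1,2) CD(1,2) by (auto simp: assoc_mult_mat[of _ r r _ r _ r])
    then show "(D * B) * (A * C) = 1\<^sub>m r" using AB CD by (simp only: left_mult_one_mat)
  qed
  moreover have "A * C \<in> carrier_mat r r" "D * B \<in> carrier_mat r r" using AB CD by auto
  ultimately show "\<psi> \<otimes>\<^bsub>AutCQ r\<^esub> \<phi> \<in> poly_aut r"
    using has_matrix_mult[OF \<psi>(1,2) \<phi>(1) AB(5) CD(5)] m \<psi> \<phi>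
    by (auto simp: poly_aut_def symplectic_aut_def reduced_aut_iff[OF e(3)] app)
qed

lemma poly_aut_eqI:
  assumes \<psi>: "\<psi> \<in> poly_aut r" and \<phi>: "\<phi> \<in> poly_aut r" and mat: "has_matrix r \<psi> A" "has_matrix r \<phi> A"
    and AB: "A \<in> carrier_mat r r" "B \<in> carrier_mat r r" "B * A = 1\<^sub>m r"
  shows "\<psi> = \<phi>"
proof (rule AutCQ_eqI)
  have car: "\<psi> \<in> carrier (AutCQ r)" "\<phi> \<in> carrier (AutCQ r)"
    and a: "\<psi> (arr Arr_a) = arr Arr_a" "\<phi> (arr Arr_a) = arr Arr_a"
    and c: "\<psi> (el_c r) = el_c r" "\<phi> (el_c r) = el_c r"
    using \<psi> \<phi> by (auto simp: poly_aut_def symplectic_aut_def)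
  then show "\<psi> \<in> carrier (AutCQ r)" "\<phi> \<in> carrier (AutCQ r)" by auto
  have e: "endo r \<psi>" "endo r \<phi>" using car by (auto simp: AutCQ_iff)
  have b: "\<psi> (bb \<alpha>) = \<phi> (bb \<alpha>)" if "\<alpha> < r" for \<alpha> using mat that by (simp add: has_matrix_def)
  define x where "x \<alpha> = \<psi> (dd \<alpha>) - \<phi> (dd \<alpha>)" for \<alpha>
  define y where "y = \<psi> (arr Arr_a_star) - \<phi> (arr Arr_a_star)"
  have e1x: "e1 \<star> x \<alpha> = x \<alpha>" if "\<alpha> < r" for \<alpha>
    using endoD(3)[OF e(1), of e1 "dd \<alpha>"] endoD(3)[OF e(2), of e1 "dd \<alpha>"] that
    by (simp add: x_def pmul_distrib endoD(5)[OF e(1)] endoD(5)[OF e(2)])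
  have "(\<Sum>\<alpha><r. \<psi> (bb \<alpha>) \<star> \<psi> (dd \<alpha>)) = (\<Sum>\<alpha><r. \<phi> (bb \<alpha>) \<star> \<phi> (dd \<alpha>))"
    using c unfolding symplectic_components[OF e(1)] symplectic_components[OF e(2)] by simp
  \<comment> \<open>With b the row of the \<open>b\<close> and x the column of the differences, this
    reads b A x = 0. Independence gives A x = 0, and multiplication by \<open>B\<close> gives x =
    0.\<close>
  then have "(\<Sum>\<alpha><r. \<phi> (bb \<alpha>) \<star> x \<alpha>) = 0"
    by (simp add: x_def pmul_distrib sum_subtractf b)
  moreover have "(\<Sum>\<alpha><r. \<phi> (bb \<alpha>) \<star> x \<alpha>)
    = (\<Sum>\<beta><r. bb \<beta> \<star> (\<Sum>\<alpha><r. poly_path (A $$ (\<beta>, \<alpha>)) \<star> x \<alpha>))"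
    using mat(2) by (simp add: has_matrix_def sum_pmul pmul_sum pmul_assoc) (rule sum.swap)
  ultimately have "(\<Sum>\<beta><r. bb \<beta> \<star> (\<Sum>\<alpha><r. poly_path (A $$ (\<beta>, \<alpha>)) \<star> x \<alpha>)) = 0" by simp
  then have Ax: "(\<Sum>\<alpha><r. poly_path (A $$ (\<beta>, \<alpha>)) \<star> x \<alpha>) = 0" if "\<beta> < r" for \<beta>
    by (rule bb_independent) (use that in \<open>auto simp: pmul_sum pmul_assoc[symmetric]\<close>)
  have x0: "x \<gamma> = 0" if "\<gamma> < r" for \<gamma>
  proof -
    have "(\<Sum>\<beta><r. poly_path (B $$ (\<gamma>, \<beta>)) \<star> (\<Sum>\<alpha><r. poly_path (A $$ (\<beta>, \<alpha>)) \<star> x \<alpha>))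
      = (\<Sum>\<alpha><r. poly_path (\<Sum>\<beta><r. B $$ (\<gamma>, \<beta>) * A $$ (\<beta>, \<alpha>)) \<star> x \<alpha>)"
      by (simp add: pmul_sum sum_pmul poly_path_sum pmul_assoc) (rule sum.swap)
    also have "\<dots> = (\<Sum>\<alpha><r. if \<alpha> = \<gamma> then x \<alpha> else 0)"
    proof (rule sum.cong[OF refl])
      fix \<alpha> assume "\<alpha> \<in> {..<r}"
      then have "(\<Sum>\<beta><r. B $$ (\<gamma>, \<beta>) * A $$ (\<beta>, \<alpha>)) = (if \<gamma> = \<alpha> then 1 else 0)"
        using index_mult_mat_sum[OF AB(2,1), of \<gamma> \<alpha>] that AB by simp
      then show "poly_path (\<Sum>\<beta><r. B $$ (\<gamma>, \<beta>) * A $$ (\<beta>, \<alpha>)) \<star> x \<alpha> = (if \<alpha> = \<gamma> then x \<alpha> else 0)"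
        using e1x that by auto
    qed
    finally show ?thesis using Ax that by simp
  qed
  then have d: "\<psi> (dd \<alpha>) = \<phi> (dd \<alpha>)" if "\<alpha> < r" for \<alpha> using that by (simp add: x_def)
  let ?S = "\<lambda>\<psi>. \<Sum>\<alpha><r. \<psi> (dd \<alpha>) \<star> \<psi> (bb \<alpha>)"
  have "arr Arr_a \<star> \<psi> (arr Arr_a_star) - \<psi> (arr Arr_a_star) \<star> arr Arr_a - ?S \<psi>
    = arr Arr_a \<star> \<phi> (arr Arr_a_star) - \<phi> (arr Arr_a_star) \<star> arr Arr_a - ?S \<phi>"
    using c unfolding symplectic_components[OF e(1)] symplectic_components[OF e(2)] a by (elim conjE) simp
  moreover have "?S \<psi> = ?S \<phi>" by (simp add: b d)
  ultimately have "arr Arr_a \<star> \<psi> (arr Arr_a_star) - \<psi> (arr Arr_a_star) \<star> arr Arr_a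
    = arr Arr_a \<star> \<phi> (arr Arr_a_star) - \<phi> (arr Arr_a_star) \<star> arr Arr_a"
    by simp
  then have "arr Arr_a \<star> y = y \<star> arr Arr_a"
    by (simp add: y_def pmul_distrib algebra_simps)
  moreover have "y \<in> ideal_I r"
  proof -
    have "(\<psi> (arr Arr_a_star) - arr Arr_a_star) - (\<phi> (arr Arr_a_star) - arr Arr_a_star) \<in> ideal_I r"
      by (rule ideal_I_closed(4))
        (use \<psi> \<phi> in \<open>auto simp: poly_aut_def reduced_aut_iff[OF e(1)] reduced_aut_iff[OF e(2)]\<close>)
    then show ?thesis by (simp add: y_def)
  qed
  moreover have "y \<in> carrier (A1 r)"
    using endoD(3)[OF e(1), of e1 "arr Arr_a_star"] endoD(3)[OF e(2), of e1 "arr Arr_a_star"]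
      endoD(3)[OF e(1), of "arr Arr_a_star" e1] endoD(3)[OF e(2), of "arr Arr_a_star" e1]
    by (simp add: carrier_A1 y_def pmul_distrib endoD[OF e(1)] endoD[OF e(2)] trivial_arr arr_trivial)
  ultimately have "y = 0" by (rule commute_a_ideal_I_eq_0)
  then have star: "\<psi> (arr Arr_a_star) = \<phi> (arr Arr_a_star)" by (simp add: y_def)
  show "\<psi> (arr \<eta>) = \<phi> (arr \<eta>)" if "\<eta> \<in> arcs (Qr r)" for \<eta>
    using that by (cases rule: arcs_cases) (simp_all add: a b d star)
qed

text \<open>\<open>A * B = 1\<^sub>m r\<close> settles the component at the vertex 2. At the vertex
  1 the commutator of \<open>a\<close> with \<open>q\<close> has to balance the change in the sum of
  the \<open>dd \<alpha> \<star> bb \<alpha>\<close>, which is \<open>comm\<close>.\<close>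

lemma symplectic_twist_aut:
  assumes A: "A \<in> carrier_mat r r" and B: "B \<in> carrier_mat r r" and AB: "A * B = 1\<^sub>m r"
    and q: "q \<in> carrier (A1 r)"
    and comm: "arr Arr_a \<star> q - q \<star> arr Arr_a =
      (\<Sum>\<alpha><r. (\<Sum>\<delta><r. poly_path (B $$ (\<alpha>, \<delta>)) \<star> dd \<delta>) \<star> (\<Sum>\<gamma><r. bb \<gamma> \<star> poly_path (A $$ (\<gamma>, \<alpha>)))
        - dd \<alpha> \<star> bb \<alpha>)"
  shows "twist_hom r A B q (el_c r) = el_c r"
proof -
  let ?T = "twist_hom r A B q"
  have "(\<Sum>\<alpha><r. ?T (bb \<alpha>) \<star> ?T (dd \<alpha>))
    = (\<Sum>\<beta><r. bb \<beta> \<star> (\<Sum>\<alpha><r. poly_path (A $$ (\<beta>, \<alpha>)) \<star> (\<Sum>\<gamma><r. poly_path (B $$ (\<alpha>, \<gamma>)) \<star> dd \<gamma>)))"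
    by (simp add: twist_bb[OF q] twist_dd[OF q] sum_pmul pmul_sum[of "bb _"] pmul_assoc) (rule sum.swap)
  also have "\<dots> = (\<Sum>\<beta><r. bb \<beta> \<star> dd \<beta>)"
    by (rule sum.cong) (auto simp: dd_mat_mult[OF A B] AB dd_one_mat)
  finally have 1: "(\<Sum>\<alpha><r. ?T (bb \<alpha>) \<star> ?T (dd \<alpha>)) = (\<Sum>\<beta><r. bb \<beta> \<star> dd \<beta>)" .
  have "arr Arr_a \<star> q - q \<star> arr Arr_a = (\<Sum>\<alpha><r. ?T (dd \<alpha>) \<star> ?T (bb \<alpha>)) - (\<Sum>\<alpha><r. dd \<alpha> \<star> bb \<alpha>)"
    unfolding comm by (simp add: twist_bb[OF q] twist_dd[OF q] sum_subtractf)
  then show ?thesis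
    unfolding symplectic_components[OF twist_endo[OF q]]
    using 1 by (simp add: twist_a[OF q] twist_a_star[OF q] pmul_distrib algebra_simps)
qed

lemma twist_aut_poly_aut:
  assumes A: "A \<in> carrier_mat r r" and B: "B \<in> carrier_mat r r"
    and AB: "A * B = 1\<^sub>m r" "B * A = 1\<^sub>m r" and q: "q \<in> carrier (A1 r)" "q \<in> ideal_I r"
    and fix_q: "twist_hom r A B q q = q" "twist_hom r B A (- q) q = q"
    and comm: "arr Arr_a \<star> q - q \<star> arr Arr_a =
      (\<Sum>\<alpha><r. (\<Sum>\<delta><r. poly_path (B $$ (\<alpha>, \<delta>)) \<star> dd \<delta>) \<star> (\<Sum>\<gamma><r. bb \<gamma> \<star> poly_path (A $$ (\<gamma>, \<alpha>)))
        - dd \<alpha> \<star> bb \<alpha>)"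
  shows "twist_aut r A B q \<in> poly_aut r"
proof -
  have T: "twist_aut r A B q \<in> carrier (AutCQ r)"
    by (rule twist_aut_carrier) fact+
  then have e: "endo r (twist_aut r A B q)" by (simp add: AutCQ_iff)
  have "twist_aut r A B q (arr \<eta>) - arr \<eta> \<in> ideal_I r" if "\<eta> \<in> arcs (Qr r)" for \<eta>
    using that
  proof (cases rule: arcs_cases)
    case (b \<alpha>)
    then show ?thesis
      by (auto simp: twist_aut_def twist_bb[OF q(1)] intro!: ideal_I_closed(4,5) ideal_I_sum ideal_I_bb)
  next
    case (d \<alpha>)
    then show ?thesis
      by (auto simp: twist_aut_def twist_dd[OF q(1)] intro!: ideal_I_closed(4,6) ideal_I_sum ideal_I_dd)
  qed (use q in \<open>auto simp: twist_aut_def twist_a twist_a_star ideal_I_closed\<close>)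
  then have "reduced_aut r (twist_aut r A B q)"
    unfolding reduced_aut_iff[OF e] using reduced_endoI[OF e] by blast
  moreover have "symplectic_aut r (twist_aut r A B q)"
    using symplectic_twist_aut[OF A B AB(1) q(1) comm] by (simp add: symplectic_aut_def twist_aut_def)
  ultimately show ?thesis
    using T A B AB twist_aut_has_matrix[OF A q(1), of B]
    by (auto simp: poly_aut_def twist_aut_def twist_a[OF q(1)])
qed


section \<open>Affine automorphisms\<close>

abbreviation const_mat :: "complex mat \<Rightarrow> complex poly mat" where
  "const_mat \<equiv> map_mat (\<lambda>c. [:c:])"

lemma const_mat_mult_eq_one:
  assumes "C \<in> carrier_mat r r" "D \<in> carrier_mat r r" "C * D = 1\<^sub>m r"
  shows "const_mat C * const_mat D = 1\<^sub>m r"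
proof -
  interpret const: comm_ring_hom "\<lambda>c::complex. [:c:]"
    by unfold_locales (auto simp: one_pCons)
  show ?thesis
    using const.mat_hom_mult[OF assms(1,2)] assms(3) by (simp add: const.mat_hom_one)
qed

text \<open>Scalar entries can be collected in front of
  \<open>dd \<delta> \<star> bb \<gamma>\<close>, where they form an entry of \<open>C * D\<close>;
  hence the sum of the \<open>dd \<alpha> \<star> bb \<alpha>\<close> is invariant and no correction
  of \<open>a\<^sup>*\<close> is required.\<close>

lemma const_twist_poly_aut:
  assumes C: "C \<in> carrier_mat r r" and D: "D \<in> carrier_mat r r" and CD: "C * D = 1\<^sub>m r"
  shows "twist_aut r (const_mat C) (const_mat D) 0 \<in> poly_aut r"
proof -
  have DC: "D * C = 1\<^sub>m r" by (rule mat_mult_left_right_inverse[OF C D CD])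
  have 0: "0 \<in> carrier (A1 r)" by (simp add: carrier_A1)
  have prod: "(\<Sum>\<delta><r. f \<delta>) \<star> (\<Sum>\<gamma><r. g \<gamma>) = (\<Sum>\<delta><r. \<Sum>\<gamma><r. f \<delta> \<star> g \<gamma>)" for f g :: "nat \<Rightarrow> qelem"
    by (subst sum_pmul) (simp only: pmul_sum)
  have "(\<Sum>\<alpha><r. (\<Sum>\<delta><r. poly_path (const_mat D $$ (\<alpha>, \<delta>)) \<star> dd \<delta>) \<star>
      (\<Sum>\<gamma><r. bb \<gamma> \<star> poly_path (const_mat C $$ (\<gamma>, \<alpha>))))
    = (\<Sum>\<alpha><r. \<Sum>\<delta><r. \<Sum>\<gamma><r. scale (C $$ (\<gamma>, \<alpha>) * D $$ (\<alpha>, \<delta>)) (dd \<delta> \<star> bb \<gamma>))"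
    unfolding prod by (intro sum.cong refl) (use C D in \<open>simp add: trivial_arr arr_trivial ac_simps\<close>)
  \<comment> \<open>The sum over \<alpha> moves innermost, where it becomes a matrix
    product.\<close>
  also have "\<dots> = (\<Sum>\<delta><r. \<Sum>\<gamma><r. \<Sum>\<alpha><r. scale (C $$ (\<gamma>, \<alpha>) * D $$ (\<alpha>, \<delta>)) (dd \<delta> \<star> bb \<gamma>))"
    by (subst sum.swap) (intro sum.cong refl sum.swap)
  also have "\<dots> = (\<Sum>\<delta><r. \<Sum>\<gamma><r. if \<gamma> = \<delta> then dd \<delta> \<star> bb \<delta> else 0)"
  proof (intro sum.cong refl)
    fix \<delta> \<gamma> assume "\<delta> \<in> {..<r}" "\<gamma> \<in> {..<r}"
    then have "(\<Sum>\<alpha><r. C $$ (\<gamma>, \<alpha>) * D $$ (\<alpha>, \<delta>)) = (if \<gamma> = \<delta> then 1 else 0)"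
      using index_mult_mat_sum[OF C D, of \<gamma> \<delta>] by (simp add: CD)
    moreover have "(\<Sum>\<alpha><r. scale (f \<alpha>) x) = scale (\<Sum>\<alpha><r. f \<alpha>) x" for f and x :: qelem
      by (rule poly_mapping_eqI) (simp add: lookup_sum sum_distrib_right)
    ultimately show "(\<Sum>\<alpha><r. scale (C $$ (\<gamma>, \<alpha>) * D $$ (\<alpha>, \<delta>)) (dd \<delta> \<star> bb \<gamma>))
      = (if \<gamma> = \<delta> then dd \<delta> \<star> bb \<delta> else 0)" by simp
  qed
  also have "\<dots> = (\<Sum>\<delta><r. dd \<delta> \<star> bb \<delta>)" by simp
  finally show ?thesis
    using C D const_mat_mult_eq_one[OF C D CD] const_mat_mult_eq_one[OF D C DC]
    by (intro twist_aut_poly_aut)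
      (auto simp: 0 ideal_I_closed sum_subtractf endo_simps(1)[OF twist_endo[OF 0]])
qed

lemma const_twist_affine:
  assumes "C \<in> carrier_mat r r" "D \<in> carrier_mat r r"
  shows "affine_aut r (twist_aut r (const_mat C) (const_mat D) 0)"
  unfolding affine_aut_def
proof
  let ?T = "twist_aut r (const_mat C) (const_mat D) 0"
  have 0: "0 \<in> carrier (A1 r)" by (simp add: carrier_A1)
  fix \<eta> assume \<eta>: "\<eta> \<in> arcs (Qr r)"
  have "length (fst (snd x)) \<le> 1" if "x \<in> Poly_Mapping.keys (?T (arr \<eta>))" for x
  proof (rule ccontr)
    assume len: "\<not> length (fst (snd x)) \<le> 1"
    have arr: "coef (arr e) x = 0" for e
      using len by (cases x) (auto simp: arr_def lookup_single when_def)
    from \<eta> have "coef (?T (arr \<eta>)) x = 0"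
    proof (cases rule: arcs_cases)
      case (b \<alpha>)
      then show ?thesis using assms
        by (simp add: twist_aut_def twist_bb[OF 0] lookup_sum arr)
    next
      case (d \<alpha>)
      then show ?thesis using assms
        by (simp add: twist_aut_def twist_dd[OF 0] lookup_sum arr)
    qed (simp_all add: twist_aut_def twist_a[OF 0] twist_a_star[OF 0] arr)
    with that show False by (simp add: in_keys_iff)
  qed
  moreover have "?T (arr \<eta>) \<in> carrier (CQ r)"
    using \<eta> by (simp add: twist_aut_def endoD(1)[OF twist_endo[OF 0]] del: Qr_simps)
  ultimately show "Poly_Mapping.keys (?T (arrow_path (Qr r) \<eta>)) \<subseteq> {(u, p, v) \<in> paths (Qr r). length p \<le> 1}"
    by (fastforce simp: carrier_CQ arrow_path_Qr)
qed

lemma const_twist_Aff: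
  assumes "C \<in> carrier_mat r r" "D \<in> carrier_mat r r" "C * D = 1\<^sub>m r"
  shows "twist_aut r (const_mat C) (const_mat D) 0 \<in> Aff_c_red r"
  using const_twist_poly_aut[OF assms] const_twist_affine[OF assms(1,2)]
  by (simp add: Aff_c_red_def poly_aut_def)

lemma coef_trivial_pmul:
  "coef (trivial_path t \<star> f) (u, p, v) = (if v = t then coef f (u, p, v) else 0)"
  "coef (f \<star> trivial_path t) (u, p, v) = (if u = t then coef f (u, p, v) else 0)"
  by (simp_all add: trivial_path_def coef_single_pmul coef_pmul_single)

text \<open>The only paths of length at most 1 from the vertex 1 to itself are \<open>e1\<close> and
  the two loops, and all three are excluded from \<open>no_loop_part r\<close>.\<close>

lemma affine_loop_eq_0:
  assumes "f \<in> no_loop_part r" "e1 \<star> f = f" "f \<star> e1 = f"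
    "\<And>x. x \<in> Poly_Mapping.keys f \<Longrightarrow> length (fst (snd x)) \<le> 1"
  shows "f = 0"
proof (rule ccontr)
  assume "f \<noteq> 0"
  then obtain x where "x \<in> Poly_Mapping.keys f" by (metis all_not_in_conv keys_eq_empty)
  then obtain u p v where x: "(u, p, v) \<in> Poly_Mapping.keys f" by (metis prod_cases3)
  have "u = V1" "v = V1"
    using x coef_trivial_pmul(1)[of V1 f u p v] coef_trivial_pmul(2)[of f V1 u p v] assms(2,3)
    by (auto simp: in_keys_iff split: if_splits)
  moreover have "(u, p, v) \<in> paths (Qr r)" "\<not> loop_path (u, p, v)"
    using x assms(1) by (auto simp: no_loop_part_def carrier_CQ)
  moreover have "length p \<le> 1" using assms(4)[OF x] by simp
  ultimately show False
    by (cases p) (auto simp: mem_paths_Qr loop_path_def)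
qed

text \<open>The only paths of length at most 1 from the vertex 1 to the vertex 2 are the arrows
  \<open>b\<close>.\<close>

lemma affine_bb_expansion:
  assumes "f \<in> carrier (CQ r)" "e2 \<star> f = f" "f \<star> e1 = f"
    "\<And>x. x \<in> Poly_Mapping.keys f \<Longrightarrow> length (fst (snd x)) \<le> 1"
  shows "f = (\<Sum>\<beta><r. scale (coef f (V1, [Arr_b (Suc \<beta>)], V2)) (bb \<beta>))"
proof (rule poly_mapping_eqI)
  fix x :: "(vertex, arrow) path"
  obtain u p v where x: "x = (u, p, v)" by (metis prod_cases3)
  let ?R = "\<Sum>\<beta><r. scale (coef f (V1, [Arr_b (Suc \<beta>)], V2)) (bb \<beta>)"
  show "coef f x = coef ?R x"
  proof (cases "\<exists>\<alpha><r. x = (V1, [Arr_b (Suc \<alpha>)], V2)")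
    case True
    then obtain \<alpha> where \<alpha>: "\<alpha> < r" "x = (V1, [Arr_b (Suc \<alpha>)], V2)" by blast
    have "coef ?R x = (\<Sum>\<beta><r. if \<beta> = \<alpha> then coef f (V1, [Arr_b (Suc \<beta>)], V2) else 0)"
      unfolding lookup_sum by (rule sum.cong) (auto simp: \<alpha> arr_def lookup_single when_def)
    then show ?thesis using \<alpha> by simp
  next
    case False
    then have "coef ?R x = 0"
      unfolding lookup_sum by (intro sum.neutral) (auto simp: arr_def lookup_single when_def)
    moreover have "coef f x = 0"
    proof (rule ccontr)
      assume "coef f x \<noteq> 0"
      then have k: "(u, p, v) \<in> Poly_Mapping.keys f" by (simp add: x in_keys_iff)
      have "u = V1" "v = V2"
        using k coef_trivial_pmul(1)[of V2 f u p v] coef_trivial_pmul(2)[of f V1 u p v] assms(2,3)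
        by (auto simp: in_keys_iff split: if_splits)
      moreover have "(u, p, v) \<in> paths (Qr r)" using k assms(1) by (auto simp: carrier_CQ)
      moreover have "length p \<le> 1" using assms(4)[OF k] by simp
      ultimately show False
        using False by (cases p; auto simp: x mem_paths_Qr Suc_le_eq dest!: gr0_implies_Suc; blast)
    qed
    ultimately show ?thesis by simp
  qed
qed

lemma affine_dd_expansion:
  assumes "f \<in> carrier (CQ r)" "e1 \<star> f = f" "f \<star> e2 = f"
    "\<And>x. x \<in> Poly_Mapping.keys f \<Longrightarrow> length (fst (snd x)) \<le> 1"
  shows "f = (\<Sum>\<beta><r. scale (coef f (V2, [Arr_d (Suc \<beta>)], V1)) (dd \<beta>))"
proof (rule poly_mapping_eqI)
  fix x :: "(vertex, arrow) path"
  obtain u p v where x: "x = (u, p, v)" by (metis prod_cases3)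
  let ?R = "\<Sum>\<beta><r. scale (coef f (V2, [Arr_d (Suc \<beta>)], V1)) (dd \<beta>)"
  show "coef f x = coef ?R x"
  proof (cases "\<exists>\<alpha><r. x = (V2, [Arr_d (Suc \<alpha>)], V1)")
    case True
    then obtain \<alpha> where \<alpha>: "\<alpha> < r" "x = (V2, [Arr_d (Suc \<alpha>)], V1)" by blast
    have "coef ?R x = (\<Sum>\<beta><r. if \<beta> = \<alpha> then coef f (V2, [Arr_d (Suc \<beta>)], V1) else 0)"
      unfolding lookup_sum by (rule sum.cong) (auto simp: \<alpha> arr_def lookup_single when_def)
    then show ?thesis using \<alpha> by simp
  next
    case False
    then have "coef ?R x = 0"
      unfolding lookup_sum by (intro sum.neutral) (auto simp: arr_def lookup_single when_def)
    moreover have "coef f x = 0"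
    proof (rule ccontr)
      assume "coef f x \<noteq> 0"
      then have k: "(u, p, v) \<in> Poly_Mapping.keys f" by (simp add: x in_keys_iff)
      have "u = V2" "v = V1"
        using k coef_trivial_pmul(1)[of V1 f u p v] coef_trivial_pmul(2)[of f V2 u p v] assms(2,3)
        by (auto simp: in_keys_iff split: if_splits)
      moreover have "(u, p, v) \<in> paths (Qr r)" using k assms(1) by (auto simp: carrier_CQ)
      moreover have "length p \<le> 1" using assms(4)[OF k] by simp
      ultimately show False
        using False by (cases p; auto simp: x mem_paths_Qr Suc_le_eq dest!: gr0_implies_Suc; blast)
    qed
    ultimately show ?thesis by simp
  qed
qed

text \<open>For degree reasons, reducedness fixes both loops, while the \<open>b\<close> and the
  \<open>d\<close> are transformed by constant matrices. Preservation of the sum of the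
  \<open>bb \<alpha> \<star> dd \<alpha>\<close> makes these matrices inverse to each other.\<close>

lemma Aff_c_red_subset: "Aff_c_red r \<subseteq> poly_aut r"
proof
  fix \<psi> assume \<psi>: "\<psi> \<in> Aff_c_red r"
  then have car: "\<psi> \<in> carrier (AutCQ r)" and c: "\<psi> (el_c r) = el_c r" and red: "reduced_aut r \<psi>"
    and aff: "affine_aut r \<psi>"
    by (auto simp: Aff_c_red_def symplectic_aut_def)
  then have e: "endo r \<psi>" by (simp add: AutCQ_iff)
  have len: "length (fst (snd x)) \<le> 1" if "\<eta> \<in> arcs (Qr r)" "x \<in> Poly_Mapping.keys (\<psi> (arr \<eta>))" for \<eta> x
    using aff that unfolding affine_aut_def arrow_path_Qr by fastforce
  have head: "trivial_path (arrow_head \<eta>) \<star> \<psi> (arr \<eta>) = \<psi> (arr \<eta>)"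
    and tail: "\<psi> (arr \<eta>) \<star> trivial_path (arrow_tail \<eta>) = \<psi> (arr \<eta>)"
    and arr_car: "\<psi> (arr \<eta>) \<in> carrier (CQ r)"
    if "\<eta> \<in> arcs (Qr r)" for \<eta>
    using endoD(3)[OF e, of "trivial_path (arrow_head \<eta>)" "arr \<eta>"]
      endoD(3)[OF e, of "arr \<eta>" "trivial_path (arrow_tail \<eta>)"] carrier_arr[OF that]
    by (simp_all add: endoD[OF e] trivial_arr arr_trivial)
  have loop: "\<psi> (arr \<eta>) = arr \<eta>" if "\<eta> \<in> {Arr_a, Arr_a_star}" for \<eta>
  proof -
    have \<eta>: "\<eta> \<in> arcs (Qr r)" "arrow_tail \<eta> = V1" "arrow_head \<eta> = V1" using that by auto
    have "\<psi> (arr \<eta>) - arr \<eta> = 0"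
    proof (rule affine_loop_eq_0)
      show "\<psi> (arr \<eta>) - arr \<eta> \<in> no_loop_part r"
        using red carrier_arr[OF \<eta>(1)] ideal_I_subset_no_loop_part unfolding reduced_aut_iff[OF e] by blast
      show "e1 \<star> (\<psi> (arr \<eta>) - arr \<eta>) = \<psi> (arr \<eta>) - arr \<eta>" "(\<psi> (arr \<eta>) - arr \<eta>) \<star> e1 = \<psi> (arr \<eta>) - arr \<eta>"
        using head[OF \<eta>(1)] tail[OF \<eta>(1)] \<eta> by (simp_all add: pmul_distrib trivial_arr arr_trivial)
      fix x assume "x \<in> Poly_Mapping.keys (\<psi> (arr \<eta>) - arr \<eta>)"
      then have "x \<in> Poly_Mapping.keys (\<psi> (arr \<eta>)) \<or> x \<in> Poly_Mapping.keys (arr \<eta>)"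
        by (auto simp: in_keys_iff lookup_minus)
      then show "length (fst (snd x)) \<le> 1"
        by (elim disjE) (use len[OF \<eta>(1), of x] in \<open>auto simp: arr_def\<close>)
    qed
    then show ?thesis by simp
  qed
  define C where "C = mat r r (\<lambda>(\<beta>, \<alpha>). coef (\<psi> (bb \<alpha>)) (V1, [Arr_b (Suc \<beta>)], V2))"
  define D where "D = mat r r (\<lambda>(\<alpha>, \<beta>). coef (\<psi> (dd \<alpha>)) (V2, [Arr_d (Suc \<beta>)], V1))"
  have CD: "C \<in> carrier_mat r r" "D \<in> carrier_mat r r" by (simp_all add: C_def D_def)
  have b: "\<psi> (bb \<alpha>) = (\<Sum>\<beta><r. scale (C $$ (\<beta>, \<alpha>)) (bb \<beta>))" if "\<alpha> < r" for \<alpha>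
  proof -
    have \<eta>: "Arr_b (Suc \<alpha>) \<in> arcs (Qr r)" using that by auto
    have "\<psi> (bb \<alpha>) = (\<Sum>\<beta><r. scale (coef (\<psi> (bb \<alpha>)) (V1, [Arr_b (Suc \<beta>)], V2)) (bb \<beta>))"
      by (rule affine_bb_expansion[OF arr_car[OF \<eta>]]) (use head[OF \<eta>] tail[OF \<eta>] len[OF \<eta>] in auto)
    then show ?thesis using that by (simp add: C_def)
  qed
  have d: "\<psi> (dd \<alpha>) = (\<Sum>\<beta><r. scale (D $$ (\<alpha>, \<beta>)) (dd \<beta>))" if "\<alpha> < r" for \<alpha>
  proof -
    have \<eta>: "Arr_d (Suc \<alpha>) \<in> arcs (Qr r)" using that by auto
    have "\<psi> (dd \<alpha>) = (\<Sum>\<beta><r. scale (coef (\<psi> (dd \<alpha>)) (V2, [Arr_d (Suc \<beta>)], V1)) (dd \<beta>))"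
      by (rule affine_dd_expansion[OF arr_car[OF \<eta>]]) (use head[OF \<eta>] tail[OF \<eta>] len[OF \<eta>] in auto)
    then show ?thesis using that by (simp add: D_def)
  qed
  have bbdd: "coef (bb \<beta> \<star> dd \<gamma>) (V2, [Arr_d (Suc \<gamma>'), Arr_b (Suc \<beta>')], V2)
    = (if \<beta> = \<beta>' then if \<gamma> = \<gamma>' then 1 else 0 else 0)" for \<beta> \<gamma> \<beta>' \<gamma>'
    by (auto simp: arr_def path_mult_simp lookup_single when_def)
  have sympl: "(\<Sum>\<alpha><r. \<psi> (bb \<alpha>) \<star> \<psi> (dd \<alpha>)) = (\<Sum>\<alpha><r. bb \<alpha> \<star> dd \<alpha>)"
    using c symplectic_components[OF e] by simp
  have "C * D = 1\<^sub>m r"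
  proof (rule eq_matI)
    fix i j assume "i < dim_row (1\<^sub>m r)" "j < dim_col (1\<^sub>m r)"
    then have ij: "i < r" "j < r" by auto
    \<comment> \<open>The word of the path \<open>bb i \<star> dd j\<close>, which traverses the
      \<open>d\<close> first. Its coefficient in the transformed sum is the entry (i, j) of
      \<open>C * D\<close>, and in the original sum it is the Kronecker delta.\<close>
    let ?x = "(V2, [Arr_d (Suc j), Arr_b (Suc i)], V2)"
    have "coef (\<Sum>\<alpha><r. \<psi> (bb \<alpha>) \<star> \<psi> (dd \<alpha>)) ?x
      = (\<Sum>\<alpha><r. \<Sum>\<gamma><r. \<Sum>\<beta><r. if \<beta> = i then if \<gamma> = j then C $$ (\<beta>, \<alpha>) * D $$ (\<alpha>, \<gamma>) else 0 else 0)"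
      by (simp add: b d sum_pmul pmul_sum lookup_sum bbdd if_distrib[of "\<lambda>x. _ * x"] ac_simps cong: if_cong)
    also have "\<dots> = (\<Sum>\<alpha><r. C $$ (i, \<alpha>) * D $$ (\<alpha>, j))"
      using ij by (simp cong: if_cong)
    also have "\<dots> = (C * D) $$ (i, j)"
      by (rule index_mult_mat_sum[symmetric]) (use CD ij in auto)
    finally have "(C * D) $$ (i, j) = coef (\<Sum>\<alpha><r. bb \<alpha> \<star> dd \<alpha>) ?x" by (simp add: sympl)
    also have "\<dots> = (if i = j then 1 else 0)"
      using ij by (simp add: lookup_sum bbdd)
    finally show "(C * D) $$ (i, j) = 1\<^sub>m r $$ (i, j)" using ij by simp
  qed (use CD in auto)
  note inv = const_mat_mult_eq_one[OF CD this]
    const_mat_mult_eq_one[OF CD(2,1) mat_mult_left_right_inverse[OF CD this]]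
  have "has_matrix r \<psi> (const_mat C)"
    using CD by (auto simp: has_matrix_def b arr_trivial)
  moreover have "const_mat C \<in> carrier_mat r r" "const_mat D \<in> carrier_mat r r" using CD by auto
  ultimately have "\<exists>A\<in>carrier_mat r r. \<exists>B\<in>carrier_mat r r. A * B = 1\<^sub>m r \<and> B * A = 1\<^sub>m r \<and> has_matrix r \<psi> A"
    using inv by blast
  then show "\<psi> \<in> poly_aut r"
    using car c red loop by (simp add: poly_aut_def symplectic_aut_def)
qed


section \<open>Triangular automorphisms\<close>

lemma poly_path_monom_Suc: "poly_path (monom 1 (Suc n)) = arr Arr_a \<star> poly_path (monom 1 n)"
  by (simp add: monom_Suc poly_path_pCons)

lemma el_x_1: "r \<ge> 1 \<Longrightarrow> el_x r (Suc 0) = - dd 0"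
  by (simp add: el_x_def el_d_def arrow_path_Qr a_inv_CQ)

lemma el_y_1: "el_y r (Suc 0) = bb (Suc 0)"
  by (simp add: el_y_def el_b_def arrow_path_Qr numeral_2_eq_2)

text \<open>The necklace derivative of \<open>p(a) X\<close>; its commutator with \<open>a\<close> telescopes to \<open>[p(a), X]\<close>.\<close>

definition sum_rotations :: "complex poly \<Rightarrow> qelem \<Rightarrow> qelem" where
  "sum_rotations p X = (\<Sum>k\<le>degree p. \<Sum>i<k.
     scale (coeff p k) (poly_path (monom 1 (k - Suc i)) \<star> X \<star> poly_path (monom 1 i)))"

text \<open>Removing the letter at position i from the cyclic word
  \<open>a\<^sup>k b\<^sub>1\<^sub>1\<close> and reading on from there leaves k - 1 - i letters
  \<open>a\<close>, then \<open>b\<^sub>1\<^sub>1\<close>, then i letters \<open>a\<close>.\<close>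

lemma necklace_deriv_p_b11:
  "necklace_deriv_a (p_b11 p) = (\<Sum>k\<le>degree p. \<Sum>i<k.
     Poly_Mapping.single (replicate (k - Suc i) Letter_a @ Letter_b11 # replicate i Letter_a) (coeff p k))"
proof -
  define w where "w k = replicate k Letter_a @ [Letter_b11]" for k
  define g where "g v c = (\<Sum>i\<in>{i. i < length v \<and> v ! i = Letter_a}.
     Poly_Mapping.single (drop (Suc i) v @ take i v) c)" for v and c :: complex
  \<comment> \<open>Words with coefficient 0 are not keys of \<open>p_b11 p\<close>; since they
    contribute nothing, the sum may run over all exponents up to the degree.\<close>
  have g0: "g v 0 = 0" for v by (simp add: g_def)
  have inj: "inj w" by (auto simp: w_def inj_def dest: arg_cong[of _ _ length])
  have lk: "Poly_Mapping.lookup (p_b11 p) v = (\<Sum>k\<le>degree p. if w k = v then coeff p k else 0)" for v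
    by (simp add: p_b11_def w_def lookup_sum lookup_single when_def)
  have lw: "Poly_Mapping.lookup (p_b11 p) (w k) = coeff p k" for k
    unfolding lk using inj by (simp add: inj_eq coeff_eq_0)
  have "Poly_Mapping.keys (p_b11 p) \<subseteq> w ` {..degree p}"
  proof
    fix v assume "v \<in> Poly_Mapping.keys (p_b11 p)"
    then have "(\<Sum>k\<le>degree p. if w k = v then coeff p k else 0) \<noteq> 0"
      by (simp add: in_keys_iff lk)
    then obtain k where "k \<le> degree p" "w k = v"
      by (auto elim!: sum.not_neutral_contains_not_neutral split: if_splits)
    then show "v \<in> w ` {..degree p}" by auto
  qed
  then have "necklace_deriv_a (p_b11 p) = (\<Sum>v\<in>w ` {..degree p}. g v (Poly_Mapping.lookup (p_b11 p) v))"
    unfolding necklace_deriv_a_def g_def[symmetric]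
    by (intro sum.mono_neutral_left) (auto simp: g0 in_keys_iff)
  also have "\<dots> = (\<Sum>k\<le>degree p. g (w k) (coeff p k))"
    by (subst sum.reindex) (auto simp: lw intro: inj_on_subset[OF inj])
  also have "\<dots> = (\<Sum>k\<le>degree p. \<Sum>i<k.
     Poly_Mapping.single (replicate (k - Suc i) Letter_a @ Letter_b11 # replicate i Letter_a) (coeff p k))"
  proof (rule sum.cong[OF refl])
    fix k
    have "{i. i < length (w k) \<and> w k ! i = Letter_a} = {..<k}"
      by (auto simp: w_def nth_append split: if_splits)
    then show "g (w k) (coeff p k) = (\<Sum>i<k. Poly_Mapping.single
        (replicate (k - Suc i) Letter_a @ Letter_b11 # replicate i Letter_a) (coeff p k))"
      unfolding g_def by (intro sum.cong) (auto simp: w_def min_def)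
  qed
  finally show ?thesis .
qed

lemma letter_val_b11: "r \<ge> 1 \<Longrightarrow> letter_val r Letter_b11 = - (dd 0 \<star> bb (Suc 0))"
  using el_x_1[of r] by (simp add: el_y_1)

lemma word_val_e1: "r \<ge> 1 \<Longrightarrow> e1 \<star> word_val r w = word_val r w"
proof (cases w)
  case (Cons l w')
  assume "r \<ge> 1"
  then have "e1 \<star> letter_val r l = letter_val r l"
    using letter_val_b11[of r]
    by (cases l) (auto simp: el_a_def arrow_path_Qr trivial_arr pmul_assoc[symmetric] simp del: letter_val.simps(2))
  then show ?thesis by (simp add: Cons word_val_def pmul_assoc[symmetric])
qed (simp add: word_val_def)

lemma word_val_replicate_a:
  "r \<ge> 1 \<Longrightarrow> word_val r (replicate n Letter_a @ w) = poly_path (monom 1 n) \<star> word_val r w"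
proof (induction n)
  case 0
  then show ?case by (simp add: word_val_e1 one_pCons[symmetric] monom_0)
next
  case (Suc n)
  then show ?case
    by (simp add: word_val_def poly_path_monom_Suc pmul_assoc el_a_def arrow_path_Qr)
qed

lemma carrier_word_val: "r \<ge> 2 \<Longrightarrow> word_val r w \<in> carrier (CQ r)"
proof (induction w)
  case (Cons l w)
  have "letter_val r l \<in> carrier (CQ r)"
    using Cons.prems letter_val_b11[of r]
    by (cases l) (auto simp del: letter_val.simps(2) simp: el_a_def arrow_path_Qr)
  with Cons show ?case by (simp add: word_val_def)
qed (simp add: word_val_def)

lemma letters_val_eq_lin_ext: "r \<ge> 2 \<Longrightarrow> letters_val r f = lin_ext (word_val r) f"
  unfolding letters_val_def lin_ext_def
  by (subst finsum_CQ) (auto intro!: carrier_closed(5) carrier_word_val)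

lemma letters_val_necklace_deriv:
  assumes "r \<ge> 2"
  shows "letters_val r (necklace_deriv_a (p_b11 p)) = sum_rotations p (- (dd 0 \<star> bb (Suc 0)))"
proof -
  have "word_val r (replicate m Letter_a @ Letter_b11 # replicate i Letter_a)
    = poly_path (monom 1 m) \<star> (- (dd 0 \<star> bb (Suc 0))) \<star> poly_path (monom 1 i)" for m i
  proof -
    have "word_val r (Letter_b11 # replicate i Letter_a) = - (dd 0 \<star> bb (Suc 0)) \<star> word_val r (replicate i Letter_a)"
      using letter_val_b11[of r] assms by (simp add: word_val_def del: letter_val.simps(2))
    also have "word_val r (replicate i Letter_a) = poly_path (monom 1 i)"
      using word_val_replicate_a[of r i "[]"] assms by (simp add: word_val_def)
    finally show ?thesis using assms by (simp add: word_val_replicate_a pmul_assoc)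
  qed
  then show ?thesis
    unfolding letters_val_eq_lin_ext[OF assms] necklace_deriv_p_b11 sum_rotations_def
    by (simp only: linear_map_simps(4)[OF linear_map_lin_ext] lin_ext_single)
qed

lemma poly_path_expansion: "poly_path p = (\<Sum>k\<le>degree p. scale (coeff p k) (poly_path (monom 1 k)))"
proof -
  have "p = (\<Sum>k\<le>degree p. Polynomial.smult (coeff p k) (monom 1 k))"
    by (simp add: smult_monom poly_as_sum_of_monoms)
  then have "poly_path p = poly_path (\<Sum>k\<le>degree p. Polynomial.smult (coeff p k) (monom 1 k))" by simp
  then show ?thesis by (simp only: poly_path_sum poly_path_simps)
qed

lemma commutator_sum_rotations:
  assumes X: "X \<in> carrier (A1 r)"
  shows "arr Arr_a \<star> sum_rotations p X - sum_rotations p X \<star> arr Arr_a = poly_path p \<star> X - X \<star> poly_path p"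
proof -
  have e: "e1 \<star> X = X" "X \<star> e1 = X" using X by (auto simp: carrier_A1)
  let ?a = "\<lambda>n. poly_path (monom 1 n)"
  have r: "?a n \<star> arr Arr_a = ?a (Suc n)" for n
    by (simp add: poly_path_arr_a poly_path_monom_Suc)
  have "(\<Sum>i<k. arr Arr_a \<star> (?a (k - Suc i) \<star> X \<star> ?a i) - (?a (k - Suc i) \<star> X \<star> ?a i) \<star> arr Arr_a)
    = ?a k \<star> X - X \<star> ?a k" for k
  proof -
    \<comment> \<open>Absorbing the outer \<open>a\<close> into the adjacent power turns each
      summand into the difference of \<open>?a (k - i) \<star> X \<star> ?a i\<close> at two
      consecutive values of i.\<close>
    have "(\<Sum>i<k. arr Arr_a \<star> (?a (k - Suc i) \<star> X \<star> ?a i) - (?a (k - Suc i) \<star> X \<star> ?a i) \<star> arr Arr_a)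
      = (\<Sum>i<k. ?a (k - i) \<star> X \<star> ?a i - ?a (k - Suc i) \<star> X \<star> ?a (Suc i))"
      by (intro sum.cong refl)
        (simp add: pmul_assoc r poly_path_monom_Suc[symmetric] pmul_assoc[symmetric, of "arr Arr_a"] Suc_diff_Suc)
    also have "\<dots> = ?a k \<star> X \<star> ?a 0 - ?a 0 \<star> X \<star> ?a k"
      using sum_lessThan_telescope'[of "\<lambda>i. ?a (k - i) \<star> X \<star> ?a i" k] by simp
    finally show ?thesis by (simp add: monom_0 one_pCons[symmetric] pmul_assoc e)
  qed
  then have "(\<Sum>k\<le>degree p. scale (coeff p k)
      (\<Sum>i<k. arr Arr_a \<star> (?a (k - Suc i) \<star> X \<star> ?a i) - (?a (k - Suc i) \<star> X \<star> ?a i) \<star> arr Arr_a))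
    = (\<Sum>k\<le>degree p. scale (coeff p k) (?a k \<star> X - X \<star> ?a k))" by simp
  then show ?thesis
    unfolding poly_path_expansion[of p] sum_rotations_def
    by (simp add: sum_pmul pmul_sum scale_sum_right scale_diff_right sum_subtractf)
qed

lemma sum_rotations_A1:
  assumes "X \<in> carrier (A1 r)"
  shows "sum_rotations p X \<in> carrier (A1 r)"
  using assms unfolding carrier_A1 sum_rotations_def
  by (auto simp: sum_pmul pmul_sum pmul_assoc[symmetric] intro!: carrier_sum carrier_pmul carrier_closed(5))
    (auto simp: pmul_assoc)

lemma sum_rotations_ideal_I: "X \<in> ideal_I r \<Longrightarrow> sum_rotations p X \<in> ideal_I r"
  unfolding sum_rotations_def
  by (intro ideal_I_sum ideal_I_closed(7) ideal_I_closed(5,6)) auto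

text \<open>Supplies the hypotheses \<open>fix_q\<close> of \<open>twist_aut_carrier\<close>,
  because the correction is built from \<open>a\<close> and X alone.\<close>

lemma endo_sum_rotations:
  assumes \<psi>: "endo r \<psi>" "\<psi> (arr Arr_a) = arr Arr_a" and X: "\<psi> X = X" "X \<in> carrier (CQ r)"
  shows "\<psi> (sum_rotations p X) = sum_rotations p X"
  unfolding sum_rotations_def using X
  by (simp add: endo_simps(4)[OF \<psi>(1)] endoD(3,4)[OF \<psi>(1)] endo_poly_path[OF \<psi>])

lemma addrow_bb:
  assumes "r \<ge> 2" "\<alpha> < r"
  shows "(\<Sum>\<beta><r. bb \<beta> \<star> poly_path (addrow_mat r p (Suc 0) 0 $$ (\<beta>, \<alpha>)))
    = (if \<alpha> = 0 then bb 0 + bb (Suc 0) \<star> poly_path p else bb \<alpha>)"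
proof -
  have "(\<Sum>\<beta><r. bb \<beta> \<star> poly_path (addrow_mat r p (Suc 0) 0 $$ (\<beta>, \<alpha>)))
    = (\<Sum>\<beta><r. (if \<beta> = \<alpha> then bb \<beta> else 0) + (if \<beta> = Suc 0 then if \<alpha> = 0 then bb (Suc 0) \<star> poly_path p else 0 else 0))"
    by (rule sum.cong) (use assms in \<open>auto simp: pmul_distrib\<close>)
  also have "\<dots> = (if \<alpha> = 0 then bb 0 + bb (Suc 0) \<star> poly_path p else bb \<alpha>)"
    using assms by (simp add: sum.distrib)
  finally show ?thesis .
qed

lemma addrow_dd:
  assumes "r \<ge> 2" "\<alpha> < r"
  shows "(\<Sum>\<beta><r. poly_path (addrow_mat r p (Suc 0) 0 $$ (\<alpha>, \<beta>)) \<star> dd \<beta>)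
    = (if \<alpha> = Suc 0 then dd (Suc 0) + poly_path p \<star> dd 0 else dd \<alpha>)"
proof -
  have "(\<Sum>\<beta><r. poly_path (addrow_mat r p (Suc 0) 0 $$ (\<alpha>, \<beta>)) \<star> dd \<beta>)
    = (\<Sum>\<beta><r. (if \<beta> = \<alpha> then dd \<beta> else 0) + (if \<beta> = 0 then if \<alpha> = Suc 0 then poly_path p \<star> dd 0 else 0 else 0))"
    by (rule sum.cong) (use assms in \<open>auto simp: pmul_distrib\<close>)
  also have "\<dots> = (if \<alpha> = Suc 0 then dd (Suc 0) + poly_path p \<star> dd 0 else dd \<alpha>)"
    using assms by (simp add: sum.distrib)
  finally show ?thesis .
qed

text \<open>The twist by \<open>1 + p E\<^sub>2\<^sub>1\<close> with the necklace derivative as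
  correction meets the description in \<open>Lambda\<close>, and values on arrows determine an
  automorphism. Since \<open>x\<^sub>1\<close> is the negative of \<open>d\<^sub>1\<close>, the
  prescribed change of \<open>y\<^sub>1\<^sup>*\<close> is subtraction of
  \<open>p d\<^sub>1\<close>, in accordance with the inverse matrix.\<close>

lemma
  assumes r: "r \<ge> 2"
  shows Lambda_poly_aut: "Lambda r p \<in> poly_aut r"
    and Lambda_has_matrix: "has_matrix r (Lambda r p) (addrow_mat r p (Suc 0) 0)"
proof -
  define X where "X = - (dd 0 \<star> bb (Suc 0))"
  define q where "q = sum_rotations p X"
  let ?A = "addrow_mat r p (Suc 0) 0" and ?B = "addrow_mat r (- p) (Suc 0) 0"
  have car: "dd 0 \<in> carrier (CQ r)" "dd (Suc 0) \<in> carrier (CQ r)" "bb 0 \<in> carrier (CQ r)" "bb (Suc 0) \<in> carrier (CQ r)"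
    using r by (auto intro!: carrier_bb carrier_dd)
  have X: "X \<in> carrier (A1 r)" "X \<in> carrier (CQ r)"
    using car by (auto simp: X_def carrier_A1 pmul_assoc trivial_arr arr_trivial pmul_assoc[symmetric, of e1])
  have X_I: "X \<in> ideal_I r"
    unfolding X_def using r car by (intro ideal_I_closed(3,5) ideal_I_dd) auto
  have q: "q \<in> carrier (A1 r)" "- q \<in> carrier (A1 r)"
    using sum_rotations_A1[OF X(1), of p] by (auto simp: q_def carrier_A1)
  have q_I: "q \<in> ideal_I r" unfolding q_def by (rule sum_rotations_ideal_I[OF X_I])
  have AB: "?A * ?B = 1\<^sub>m r" "?B * ?A = 1\<^sub>m r"
    using addrow_mat_inv[of "Suc 0" r 0 p] addrow_mat_inv[of "Suc 0" r 0 "- p"] r by auto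
  \<comment> \<open>Each twist of this shape changes among the \<open>b\<close> only
    \<open>bb 0\<close> and among the \<open>d\<close> only \<open>dd (Suc 0)\<close>, so both
    factors of \<open>X\<close> are fixed. The parameter \<open>s\<close> covers the map and its
    inverse.\<close>
  have fix_q: "twist_hom r (addrow_mat r s (Suc 0) 0) (addrow_mat r (- s) (Suc 0) 0) q' q = q"
    if "q' \<in> carrier (A1 r)" for q' s
  proof -
    let ?T = "twist_hom r (addrow_mat r s (Suc 0) 0) (addrow_mat r (- s) (Suc 0) 0) q'"
    have "?T (dd 0) = dd 0" "?T (bb (Suc 0)) = bb (Suc 0)"
      using r by (simp_all add: twist_bb[OF that] twist_dd[OF that] addrow_bb addrow_dd del: index_mat_addrow_mat)
    then have "?T X = X"
      using car by (simp add: X_def endo_simps(2)[OF twist_endo[OF that]] endoD(3)[OF twist_endo[OF that]])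
    then show ?thesis
      unfolding q_def by (intro endo_sum_rotations[OF twist_endo[OF that] twist_a[OF that] _ X(2)])
  qed
  \<comment> \<open>Only the indices 0 and 1 contribute to the defect, and together they give the
    commutator of \<open>poly_path p\<close> with \<open>X\<close>.\<close>
  have "(\<Sum>\<alpha><r. (\<Sum>\<delta><r. poly_path (?B $$ (\<alpha>, \<delta>)) \<star> dd \<delta>) \<star> (\<Sum>\<gamma><r. bb \<gamma> \<star> poly_path (?A $$ (\<gamma>, \<alpha>)))
        - dd \<alpha> \<star> bb \<alpha>)
    = (\<Sum>\<alpha><r. (if \<alpha> = 0 then dd 0 \<star> bb (Suc 0) \<star> poly_path p else 0)
        + (if \<alpha> = Suc 0 then - (poly_path p \<star> dd 0 \<star> bb (Suc 0)) else 0))" (is "?L = _")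
    by (rule sum.cong) (use r in \<open>auto simp: addrow_bb addrow_dd pmul_distrib pmul_assoc
      simp del: index_mat_addrow_mat\<close>)
  also have "\<dots> = dd 0 \<star> bb (Suc 0) \<star> poly_path p - poly_path p \<star> dd 0 \<star> bb (Suc 0)"
    using r by (simp add: sum.distrib)
  also have "\<dots> = arr Arr_a \<star> q - q \<star> arr Arr_a"
    unfolding q_def commutator_sum_rotations[OF X(1)] by (simp add: X_def pmul_assoc)
  finally have comm: "arr Arr_a \<star> q - q \<star> arr Arr_a = ?L" by (rule sym)
  let ?T = "twist_aut r ?A ?B q"
  have T: "?T \<in> poly_aut r"
    using fix_q[of q p] fix_q[of "- q" "- p"] q q_I AB by (intro twist_aut_poly_aut comm) auto
  have T_arr: "?T (arr Arr_a) = arr Arr_a" "?T (arr Arr_a_star) = arr Arr_a_star + q"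
    "\<And>\<alpha>. \<alpha> < r \<Longrightarrow> ?T (bb \<alpha>) = (if \<alpha> = 0 then bb 0 + bb (Suc 0) \<star> poly_path p else bb \<alpha>)"
    "\<And>\<alpha>. \<alpha> < r \<Longrightarrow> ?T (dd \<alpha>) = (if \<alpha> = Suc 0 then dd (Suc 0) - poly_path p \<star> dd 0 else dd \<alpha>)"
    using r by (simp_all add: twist_aut_def twist_a[OF q(1)] twist_a_star[OF q(1)] twist_bb[OF q(1)]
        twist_dd[OF q(1)] addrow_bb addrow_dd del: index_mat_addrow_mat)
  have els: "el_a_star r = arr Arr_a_star" "el_x_star r 1 = bb 0" "el_y_star r 1 = dd (Suc 0)"
    by (simp_all add: el_a_star_def el_x_star_def el_y_star_def el_b_def el_d_def arrow_path_Qr numeral_2_eq_2)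
  note xy = el_x_1[of r] el_y_1[of r] letters_val_necklace_deriv[OF r, of p, folded X_def q_def]
  have "Lambda r p = ?T"
    unfolding Lambda_def
  proof (rule the_equality)
    have "?T (arr \<eta>) = arr \<eta>" if "\<eta> \<in> arcs (Qr r) - {Arr_a_star, Arr_b 1, Arr_d 2}" for \<eta>
    proof -
      from that have "\<eta> \<in> arcs (Qr r)" by blast
      then show ?thesis
        by (cases rule: arcs_cases) (use that in \<open>auto simp: T_arr numeral_2_eq_2\<close>)
    qed
    moreover have "?T (bb 0) = bb 0 + bb (Suc 0) \<star> poly_path p" "?T (dd (Suc 0)) = dd (Suc 0) + poly_path p \<star> (- dd 0)"
      using T_arr(3)[of 0] T_arr(4)[of "Suc 0"] r by auto
    ultimately show "?T \<in> carrier (AutCQ r) \<and> symplectic_aut r ?T \<and>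
     ?T (el_a_star r) = el_a_star r \<oplus>\<^bsub>CQ r\<^esub> letters_val r (necklace_deriv_a (p_b11 p)) \<and>
     ?T (el_x_star r 1) = el_x_star r 1 \<oplus>\<^bsub>CQ r\<^esub> (el_y r 1 \<otimes>\<^bsub>CQ r\<^esub> poly_at_a r p) \<and>
     ?T (el_y_star r 1) = el_y_star r 1 \<oplus>\<^bsub>CQ r\<^esub> (poly_at_a r p \<otimes>\<^bsub>CQ r\<^esub> el_x r 1) \<and>
     (\<forall>\<eta> \<in> arcs (Qr r) - {Arr_a_star, Arr_b 1, Arr_d 2}.
        ?T (arrow_path (Qr r) \<eta>) = arrow_path (Qr r) \<eta>)"
      using T r T_arr(2) unfolding els xy arrow_path_Qr poly_at_a_eq
      by (simp add: poly_aut_def xy del: Qr_simps)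
  next
    fix \<psi>
    assume *: "\<psi> \<in> carrier (AutCQ r) \<and> symplectic_aut r \<psi> \<and>
     \<psi> (el_a_star r) = el_a_star r \<oplus>\<^bsub>CQ r\<^esub> letters_val r (necklace_deriv_a (p_b11 p)) \<and>
     \<psi> (el_x_star r 1) = el_x_star r 1 \<oplus>\<^bsub>CQ r\<^esub> (el_y r 1 \<otimes>\<^bsub>CQ r\<^esub> poly_at_a r p) \<and>
     \<psi> (el_y_star r 1) = el_y_star r 1 \<oplus>\<^bsub>CQ r\<^esub> (poly_at_a r p \<otimes>\<^bsub>CQ r\<^esub> el_x r 1) \<and>
     (\<forall>\<eta> \<in> arcs (Qr r) - {Arr_a_star, Arr_b 1, Arr_d 2}.
        \<psi> (arrow_path (Qr r) \<eta>) = arrow_path (Qr r) \<eta>)"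
    have \<psi>: "\<psi> (arr Arr_a_star) = arr Arr_a_star + q" "\<psi> (bb 0) = bb 0 + bb (Suc 0) \<star> poly_path p"
      "\<psi> (dd (Suc 0)) = dd (Suc 0) - poly_path p \<star> dd 0"
      using * r unfolding els xy arrow_path_Qr poly_at_a_eq by (simp_all add: xy del: Qr_simps)
    have fixed: "\<psi> (arr \<eta>) = arr \<eta>" if "\<eta> \<in> arcs (Qr r) - {Arr_a_star, Arr_b 1, Arr_d 2}" for \<eta>
      using * that by (simp add: arrow_path_Qr del: Qr_simps)
    show "\<psi> = ?T"
    proof (rule AutCQ_eqI)
      fix \<eta> assume \<eta>: "\<eta> \<in> arcs (Qr r)"
      then show "\<psi> (arr \<eta>) = ?T (arr \<eta>)"
      proof (cases rule: arcs_cases)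
        case a
        then show ?thesis using fixed[OF DiffI, OF \<eta>] by (simp add: T_arr)
      next
        case a_star
        then show ?thesis by (simp add: T_arr \<psi>)
      next
        case (b \<alpha>)
        then show ?thesis using fixed[OF DiffI, OF \<eta>] by (cases "\<alpha> = 0") (auto simp: T_arr \<psi>)
      next
        case (d \<alpha>)
        then show ?thesis using fixed[OF DiffI, OF \<eta>] \<psi>(3)
          by (cases "\<alpha> = Suc 0") (auto simp: T_arr numeral_2_eq_2)
      qed
    qed (use * T in \<open>auto simp: poly_aut_def\<close>)
  qed
  then show "Lambda r p \<in> poly_aut r" "has_matrix r (Lambda r p) ?A"
    using T twist_aut_has_matrix[OF _ q(1), of ?A ?B] by simp_all
qed

section \<open>Generation of the general linear group over a polynomial ring\<close>

text \<open>Generation is phrased through an arbitrary set closed under products, so that it can be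
  instantiated with the set of matrices realised by \<open>P_group r\<close>. The constant diagonal
  matrices account for determinants other than 1.\<close>

locale elementary_closed =
  fixes n :: nat and S :: "'a :: field poly mat set"
  assumes one_in: "1\<^sub>m n \<in> S"
    and mult_in: "A \<in> S \<Longrightarrow> B \<in> S \<Longrightarrow> A * B \<in> S"
    and addrow_in: "i < n \<Longrightarrow> j < n \<Longrightarrow> i \<noteq> j \<Longrightarrow> addrow_mat n p i j \<in> S"
    and multrow_in: "i < n \<Longrightarrow> c \<noteq> 0 \<Longrightarrow> multrow_mat n i [:c:] \<in> S"
begin

definition reduced_upto :: "nat \<Rightarrow> 'a poly mat \<Rightarrow> bool" where
  "reduced_upto k A \<longleftrightarrow> A \<in> carrier_mat n n \<and> (\<exists>B \<in> carrier_mat n n. B * A = 1\<^sub>m n) \<and>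
    (\<forall>i<n. \<forall>j<k. A $$ (i, j) = (if i = j then 1 else 0))"

text \<open>Row \<open>j\<close> vanishes in the first k columns because \<open>k \<le> j\<close>,
  so adding a multiple of it leaves these columns intact. Membership is transported backwards, as
  \<open>A\<close> is an elementary matrix times the new one.\<close>

lemma addrow_step:
  assumes A: "reduced_upto k A" and ij: "i < n" "j < n" "i \<noteq> j" "k \<le> j" and k: "k \<le> n"
  shows "reduced_upto k (addrow p i j A)" "addrow p i j A \<in> S \<Longrightarrow> A \<in> S"
proof -
  from A obtain B where B: "A \<in> carrier_mat n n" "B \<in> carrier_mat n n" "B * A = 1\<^sub>m n"
    by (auto simp: reduced_upto_def)
  let ?E = "addrow_mat n p i j" and ?E' = "addrow_mat n (- p) i j"
  have E: "addrow p i j A = ?E * A" using B ij by (intro addrow_mat) auto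
  have inv: "?E' * ?E = 1\<^sub>m n" using addrow_mat_inv[OF ij(1-3), of "- p"] by simp
  have car: "?E \<in> carrier_mat n n" "?E' \<in> carrier_mat n n" by auto
  have E'E: "?E' * (?E * A) = A"
  proof -
    have "?E' * (?E * A) = (?E' * ?E) * A" using car B(1) by (simp add: assoc_mult_mat[of _ n n _ n _ n])
    then show ?thesis using B(1) by (simp add: inv)
  qed
  have "(B * ?E') * (?E * A) = B * (?E' * (?E * A))"
    by (rule assoc_mult_mat[of _ n n _ n _ n]) (use car B(1,2) in auto)
  then have "(B * ?E') * (?E * A) = 1\<^sub>m n" by (simp add: E'E B)
  moreover have "B * ?E' \<in> carrier_mat n n" using B car by auto
  moreover have "addrow p i j A $$ (x, y) = (if x = y then 1 else 0)" if "x < n" "y < k" for x y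
    using A ij k that by (auto simp: reduced_upto_def)
  ultimately show "reduced_upto k (addrow p i j A)"
    unfolding reduced_upto_def E[symmetric] using B by auto
  show "addrow p i j A \<in> S \<Longrightarrow> A \<in> S"
    using mult_in[OF addrow_in[OF ij(1-3), of "- p"], of "addrow p i j A"] by (simp add: E E'E)
qed

lemma multrow_step:
  assumes A: "reduced_upto k A" and k: "k < n" and c: "c \<noteq> 0"
  shows "reduced_upto k (multrow k [:c:] A)" "multrow k [:c:] A \<in> S \<Longrightarrow> A \<in> S"
proof -
  from A obtain B where B: "A \<in> carrier_mat n n" "B \<in> carrier_mat n n" "B * A = 1\<^sub>m n"
    by (auto simp: reduced_upto_def)
  let ?E = "multrow_mat n k [:c:]" and ?E' = "multrow_mat n k [:inverse c:]"
  have E: "multrow k [:c:] A = ?E * A" using B by (intro multrow_mat) auto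
  have car: "?E \<in> carrier_mat n n" "?E' \<in> carrier_mat n n" by auto
  have E'E: "?E' * (?E * A) = A"
  proof -
    have "?E' * (?E * A) = multrow k [:inverse c:] (multrow k [:c:] A)"
      unfolding E by (rule multrow_mat[symmetric, of _ n n]) (use B car in auto)
    also have "\<dots> = A"
      using c by (intro eq_matI) auto
    finally show ?thesis .
  qed
  have "(B * ?E') * (?E * A) = B * (?E' * (?E * A))"
    by (rule assoc_mult_mat[of _ n n _ n _ n]) (use car B(1,2) in auto)
  then have "(B * ?E') * (?E * A) = 1\<^sub>m n" by (simp add: E'E B)
  moreover have "B * ?E' \<in> carrier_mat n n" using B car by auto
  moreover have "multrow k [:c:] A $$ (x, y) = (if x = y then 1 else 0)" if "x < n" "y < k" for x y
    using A k that by (auto simp: reduced_upto_def)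
  ultimately show "reduced_upto k (multrow k [:c:] A)"
    unfolding reduced_upto_def E[symmetric] using B by auto
  show "multrow k [:c:] A \<in> S \<Longrightarrow> A \<in> S"
    using mult_in[OF multrow_in[OF k, of "inverse c"], of "multrow k [:c:] A"] c by (simp add: E E'E)
qed

text \<open>With pivot 1 in place, subtracting multiples of row k removes the other entries of the
  column, above and below the diagonal, one at a time; their number is the induction
  measure.\<close>

lemma clear_column:
  assumes "reduced_upto k A" "k < n" "A $$ (k, k) = 1"
    and next_column: "\<And>A. reduced_upto (Suc k) A \<Longrightarrow> A \<in> S"
  shows "A \<in> S"
  using assms(1,3)
proof (induction "card {i. i < n \<and> i \<noteq> k \<and> A $$ (i, k) \<noteq> 0}" arbitrary: A)
  case 0
  then have "A $$ (i, k) = 0" if "i < n" "i \<noteq> k" for i using that by auto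
  with 0(2,3) have "reduced_upto (Suc k) A" by (auto simp: reduced_upto_def less_Suc_eq)
  then show ?case by (rule next_column)
next
  case (Suc m)
  let ?Z = "\<lambda>A. {i. i < n \<and> i \<noteq> k \<and> A $$ (i, k) \<noteq> 0}"
  from Suc(2) have "?Z A \<noteq> {}" by (metis card.empty Zero_not_Suc)
  then obtain i where i: "i < n" "i \<noteq> k" "A $$ (i, k) \<noteq> 0" by blast
  let ?A = "addrow (- (A $$ (i, k))) i k A"
  have A: "A \<in> carrier_mat n n" using Suc.prems by (simp add: reduced_upto_def)
  have "?Z ?A = ?Z A - {i}" using A i \<open>k < n\<close> Suc.prems(2) by (auto split: if_splits)
  then have "m = card (?Z ?A)" using Suc(2) i by simp
  moreover have "?A $$ (k, k) = 1" using A i \<open>k < n\<close> Suc.prems(2) by auto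
  ultimately have "?A \<in> S"
    using addrow_step(1)[OF Suc.prems(1)] i \<open>k < n\<close> by (intro Suc(1)) auto
  then show ?case using addrow_step(2)[OF Suc.prems(1)] i \<open>k < n\<close> by auto
qed

text \<open>Euclid's algorithm by row operations lowers this size until at most one entry of column \<open>k\<close>
  on or below the diagonal is nonzero; left invertibility then forces that entry to be a constant.\<close>

definition column_size :: "nat \<Rightarrow> 'a poly mat \<Rightarrow> nat" where
  "column_size k A = (\<Sum>i\<in>{k..<n}. if A $$ (i, k) = 0 then 0 else Suc (degree (A $$ (i, k))))"

lemma reduce_column:
  assumes "reduced_upto k A" "k < n"
    and next_column: "\<And>A. reduced_upto (Suc k) A \<Longrightarrow> A \<in> S"
  shows "A \<in> S"
  using assms(1)
proof (induction "column_size k A" arbitrary: A rule: less_induct)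
  case less
  then obtain B where B: "A \<in> carrier_mat n n" "B \<in> carrier_mat n n" "B * A = 1\<^sub>m n"
    by (auto simp: reduced_upto_def)
  show ?case
  proof (cases "\<exists>i j. k \<le> i \<and> i < n \<and> k \<le> j \<and> j < n \<and> i \<noteq> j \<and> A $$ (i, k) \<noteq> 0 \<and>
      A $$ (j, k) \<noteq> 0 \<and> degree (A $$ (j, k)) \<le> degree (A $$ (i, k))")
    case True
    then obtain i j where ij: "k \<le> i" "i < n" "k \<le> j" "j < n" "i \<noteq> j" "A $$ (i, k) \<noteq> 0"
      "A $$ (j, k) \<noteq> 0" "degree (A $$ (j, k)) \<le> degree (A $$ (i, k))" by blast
    let ?A = "addrow (- (A $$ (i, k) div A $$ (j, k))) i j A"
    \<comment> \<open>Subtracting the quotient leaves a remainder that is zero or of smaller degree,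
      and no other entry of the column changes; hence the size drops.\<close>
    have ik: "?A $$ (i, k) = A $$ (i, k) mod A $$ (j, k)"
      using B ij \<open>k < n\<close> by (simp add: minus_div_mult_eq_mod[symmetric])
    have other: "?A $$ (l, k) = A $$ (l, k)" if "l < n" "l \<noteq> i" for l
      using B that ij \<open>k < n\<close> by simp
    have "column_size k ?A < column_size k A"
      unfolding column_size_def
    proof (rule sum_strict_mono_ex1)
      show "\<forall>l\<in>{k..<n}. (if ?A $$ (l, k) = 0 then 0 else Suc (degree (?A $$ (l, k))))
          \<le> (if A $$ (l, k) = 0 then 0 else Suc (degree (A $$ (l, k))))"
      proof
        fix l assume "l \<in> {k..<n}"
        then show "(if ?A $$ (l, k) = 0 then 0 else Suc (degree (?A $$ (l, k))))
          \<le> (if A $$ (l, k) = 0 then 0 else Suc (degree (A $$ (l, k))))"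
          using other[of l] ik ij degree_mod_less[of "A $$ (j, k)" "A $$ (i, k)"]
          by (cases "l = i") (auto simp del: index_mat_addrow)
      qed
      show "\<exists>l\<in>{k..<n}. (if ?A $$ (l, k) = 0 then 0 else Suc (degree (?A $$ (l, k))))
          < (if A $$ (l, k) = 0 then 0 else Suc (degree (A $$ (l, k))))"
        using ik ij degree_mod_less[of "A $$ (j, k)" "A $$ (i, k)"]
        by (intro bexI[of _ i]) (auto simp del: index_mat_addrow)
    qed simp
    then have "?A \<in> S"
      using addrow_step(1)[OF less.prems] ij \<open>k < n\<close> by (intro less.hyps) auto
    then show ?thesis using addrow_step(2)[OF less.prems] ij \<open>k < n\<close> by auto
  next
    case False
    have BA: "(\<Sum>l<n. B $$ (k, l) * A $$ (l, j)) = (if k = j then 1 else 0)" if "j < n" for j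
      using index_mult_mat_sum[OF B(2,1) \<open>k < n\<close> that] B(3) \<open>k < n\<close> that by simp
    \<comment> \<open>The first k columns of \<open>A\<close> are unit vectors, so row k of
      \<open>B * A = 1\<^sub>m n\<close> shows that row k of \<open>B\<close> starts with k zeros.
      Only entries on or below the diagonal therefore count in column k.\<close>
    have Bk: "B $$ (k, j) = 0" if "j < k" for j
    proof -
      have "(\<Sum>l<n. B $$ (k, l) * A $$ (l, j)) = (\<Sum>l<n. if l = j then B $$ (k, l) else 0)"
        using less.prems that by (intro sum.cong) (auto simp: reduced_upto_def)
      then show ?thesis using BA[of j] that \<open>k < n\<close> by simp
    qed
    have "\<exists>i. k \<le> i \<and> i < n \<and> A $$ (i, k) \<noteq> 0"
    proof (rule ccontr)
      assume "\<not> (\<exists>i. k \<le> i \<and> i < n \<and> A $$ (i, k) \<noteq> 0)"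
      then have "(\<Sum>l<n. B $$ (k, l) * A $$ (l, k)) = 0"
        using Bk by (intro sum.neutral) (metis lessThan_iff mult_eq_0_iff not_le)
      then show False using BA[OF \<open>k < n\<close>] by simp
    qed
    then obtain i where i: "k \<le> i" "i < n" "A $$ (i, k) \<noteq> 0" by blast
    have zero: "A $$ (j, k) = 0" if "k \<le> j" "j < n" "j \<noteq> i" for j
      using False i that by (metis linear)
    have "(\<Sum>l<n. B $$ (k, l) * A $$ (l, k)) = (\<Sum>l<n. if l = i then B $$ (k, i) * A $$ (i, k) else 0)"
      using Bk zero by (intro sum.cong refl) (metis lessThan_iff mult_eq_0_iff not_le)
    then have "B $$ (k, i) * A $$ (i, k) = 1" using BA[OF \<open>k < n\<close>] i by simp
    then have "A $$ (i, k) dvd 1" by (metis dvd_triv_right)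
    then obtain c where c: "A $$ (i, k) = [:c:]" "c \<noteq> 0"
      using i(3) by (auto simp: is_unit_poly_iff)
    show ?thesis
    proof (cases "i = k")
      case True
      let ?A = "multrow k [:inverse c:] A"
      have "?A $$ (k, k) = 1" using c B \<open>k < n\<close> True by (simp add: one_pCons)
      then have "?A \<in> S"
        using multrow_step(1)[OF less.prems \<open>k < n\<close>] c \<open>k < n\<close> by (intro clear_column[OF _ \<open>k < n\<close> _ next_column]) auto
      then show ?thesis using multrow_step(2)[OF less.prems \<open>k < n\<close>, of "inverse c"] c by auto
    next
      case False
      \<comment> \<open>The single nonzero entry on or below the diagonal is not at the pivot
        position. Adding a multiple of its row to row k creates the pivot 1; the old entry is left
        to \<open>clear_column\<close>.\<close>
      let ?A = "addrow [:inverse c:] k i A"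
      have "?A $$ (k, k) = 1"
        using c B \<open>k < n\<close> i zero[of k] False by (simp add: one_pCons)
      then have "?A \<in> S"
        using addrow_step(1)[OF less.prems] i False \<open>k < n\<close> by (intro clear_column[OF _ \<open>k < n\<close> _ next_column]) auto
      then show ?thesis using addrow_step(2)[OF less.prems, of k i] i False \<open>k < n\<close> by auto
    qed
  qed
qed

lemma left_invertible_mem:
  assumes "A \<in> carrier_mat n n" "B \<in> carrier_mat n n" "B * A = 1\<^sub>m n"
  shows "A \<in> S"
proof -
  have "A \<in> S" if "reduced_upto k A" "k \<le> n" for k A
    using that
  proof (induction "n - k" arbitrary: k A)
    case 0
    then have "k = n" by simp
    have "A = 1\<^sub>m n"
      using "0.prems"(1)[unfolded reduced_upto_def \<open>k = n\<close>] by (intro eq_matI) auto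
    then show ?case by (simp add: one_in)
  next
    case (Suc m)
    show ?case
    proof (rule reduce_column[OF Suc.prems(1)])
      show "k < n" using Suc(2) by simp
      show "A \<in> S" if "reduced_upto (Suc k) A" for A
        using that Suc(2) by (intro Suc(1)) auto
    qed
  qed
  moreover have "reduced_upto 0 A" using assms by (auto simp: reduced_upto_def)
  ultimately show ?thesis by blast
qed

end

text \<open>Conjugation by a permutation matrix permutes the indices of an elementary matrix. The
  degenerate case \<open>k = l\<close>, with t the identity, occurs when an index is already in
  place.\<close>

lemma swaprows_conj_addrow:
  fixes p :: "'a :: comm_ring_1"
  assumes kl: "k < n" "l < n" and ij: "i < n" "j < n"
  defines "t \<equiv> \<lambda>x. if x = k then l else if x = l then k else x"
  shows "swaprows_mat n k l * addrow_mat n p i j * swaprows_mat n k l = addrow_mat n p (t i) (t j)"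
proof -
  let ?P = "swaprows_mat n k l :: 'a mat" and ?E = "addrow_mat n p i j" and ?F = "addrow_mat n p (t i) (t j)"
  have t: "t i < n" "t j < n" using kl ij by (auto simp: t_def)
  have "?P * ?E = swaprows k l ?E" by (rule swaprows_mat[symmetric]) (use kl in auto)
  also have "\<dots> = addrow p (t i) (t j) ?P"
  proof (rule eq_matI)
    fix x y assume "x < dim_row (addrow p (t i) (t j) ?P)" "y < dim_col (addrow p (t i) (t j) ?P)"
    then have xy: "x < n" "y < n" "t x < n" using kl by (auto simp: t_def)
    have "swaprows k l ?E $$ (x, y) = ?E $$ (t x, y)"
      using xy by (auto simp: mat_swaprows_def t_def simp del: index_mat_addrow_mat(1))
    also have "\<dots> = (if i = t x \<and> j = y then p else 0) + (if t x = y then 1 else 0)"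
      using xy by (simp add: id_def)
    finally have L: "swaprows k l ?E $$ (x, y) = \<dots>" .
    have P: "?P $$ (x, y) = (if t x = y then 1 else 0)" if "x < n" for x
      using that xy kl by (simp add: t_def)
    have tt: "i = t x \<longleftrightarrow> t i = x" "t (t j) = j" by (auto simp: t_def)
    have "addrow p (t i) (t j) ?P $$ (x, y) = (if t i = x then p * ?P $$ (t j, y) + ?P $$ (x, y) else ?P $$ (x, y))"
      using xy by simp
    then show "swaprows k l ?E $$ (x, y) = addrow p (t i) (t j) ?P $$ (x, y)"
      using L xy t by (simp add: P tt del: index_mat_swaprows_mat(1))
  qed simp_all
  also have "\<dots> = ?F * ?P" by (rule addrow_mat) (use t in auto)
  finally have "?P * ?E * ?P = ?F * (?P * ?P)"
    by (simp add: assoc_mult_mat[of _ n n _ n _ n])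
  then show ?thesis using swaprows_mat_inv[OF kl, where ?'a = 'a]
    by (simp add: right_mult_one_mat[of _ n n])
qed


section \<open>The isomorphism\<close>

lemma P_generators: "Tri_l_c r \<union> Aff_c_red r \<subseteq> poly_aut r"
  using Aff_c_red_subset[of r] Lambda_poly_aut[of r] subgroup.one_closed[OF subgroup_poly_aut[of r]]
  by (auto simp: Tri_l_c_def)

lemma carrier_P_group: "carrier (P_group r) = generate (AutCQ r) (Tri_l_c r \<union> Aff_c_red r)"
  and mult_P_group: "mult (P_group r) = mult (AutCQ r)"
  by (simp_all add: P_group_def)

lemma P_group_subset: "carrier (P_group r) \<subseteq> poly_aut r"
  unfolding carrier_P_group
  by (rule group.generate_subgroup_incl[OF group_AutCQ P_generators subgroup_poly_aut])

lemma subgroup_P_group: "subgroup (carrier (P_group r)) (AutCQ r)"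
  unfolding carrier_P_group
  by (rule group.generate_is_subgroup[OF group_AutCQ])
    (use P_generators subgroup.subset[OF subgroup_poly_aut] in blast)

lemma const_mat_multrow: "const_mat (multrow_mat n k c) = multrow_mat n k [:c:]"
  and const_mat_swaprows: "const_mat (swaprows_mat n k l) = swaprows_mat n k l"
  by (auto intro!: eq_matI simp: one_pCons)

lemma P_group_surjective:
  assumes "A \<in> carrier_mat r r" "B \<in> carrier_mat r r" "B * A = 1\<^sub>m r"
  shows "\<exists>\<psi>\<in>carrier (P_group r). has_matrix r \<psi> A"
proof -
  define S where "S = {A. \<exists>\<psi>\<in>carrier (P_group r). has_matrix r \<psi> A}"
  have const: "const_mat C \<in> S" if "C \<in> carrier_mat r r" "D \<in> carrier_mat r r" "C * D = 1\<^sub>m r" for C D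
  proof -
    have "twist_aut r (const_mat C) (const_mat D) 0 \<in> carrier (P_group r)"
      unfolding carrier_P_group using const_twist_Aff[OF that] by (blast intro: generate.incl)
    moreover have "has_matrix r (twist_aut r (const_mat C) (const_mat D) 0) (const_mat C)"
      using that by (intro twist_aut_has_matrix) (auto simp: carrier_A1)
    ultimately show ?thesis by (auto simp: S_def)
  qed
  have mult: "A * B \<in> S" if AB: "A \<in> S" "B \<in> S" for A B
  proof -
    obtain \<psi> \<phi> where *: "\<psi> \<in> carrier (P_group r)" "\<phi> \<in> carrier (P_group r)"
      "has_matrix r \<psi> A" "has_matrix r \<phi> B"
      using AB by (auto simp: S_def)
    then have "\<psi> \<in> poly_aut r" "\<phi> \<in> poly_aut r" using P_group_subset by auto
    with * have "has_matrix r (\<psi> \<otimes>\<^bsub>AutCQ r\<^esub> \<phi>) (A * B)"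
      by (intro has_matrix_mult) (auto simp: poly_aut_def)
    moreover have "\<psi> \<otimes>\<^bsub>AutCQ r\<^esub> \<phi> \<in> carrier (P_group r)"
      using * by (intro subgroup.m_closed[OF subgroup_P_group])
    ultimately show ?thesis by (auto simp: S_def)
  qed
  have swap: "swaprows_mat r k l \<in> S" if "k < r" "l < r" for k l
    using const[of "swaprows_mat r k l" "swaprows_mat r k l"] swaprows_mat_inv[OF that]
    by (simp add: const_mat_swaprows)
  interpret elementary_closed r S
  proof
    show "1\<^sub>m r \<in> S"
    proof -
      have "const_mat (1\<^sub>m r) = 1\<^sub>m r" by (auto intro!: eq_matI simp: one_pCons)
      then show ?thesis using const[of "1\<^sub>m r" "1\<^sub>m r"] by simp
    qed
    show "A \<in> S \<Longrightarrow> B \<in> S \<Longrightarrow> A * B \<in> S" for A B by (rule mult)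
    show "multrow_mat r i [:c:] \<in> S" if "i < r" "c \<noteq> 0" for i c
    proof -
      have "multrow_mat r i c * multrow_mat r i (inverse c) = multrow i c (multrow_mat r i (inverse c))"
        by (rule multrow_mat[symmetric, of _ r r]) simp
      also have "\<dots> = 1\<^sub>m r" using that by (intro eq_matI) auto
      finally show ?thesis
        using const[of "multrow_mat r i c" "multrow_mat r i (inverse c)"] by (simp add: const_mat_multrow)
    qed
    show "addrow_mat r p i j \<in> S" if "i < r" "j < r" "i \<noteq> j" for i j p
    proof -
      have r: "r \<ge> 2" using that by auto
      then have "Lambda r p \<in> carrier (P_group r)"
        unfolding carrier_P_group by (intro generate.incl) (auto simp: Tri_l_c_def)
      then have 10: "addrow_mat r p (Suc 0) 0 \<in> S" using Lambda_has_matrix[OF r] by (auto simp: S_def)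
      \<comment> \<open>The image of 1 under the exchange of 0 and \<open>j\<close>. The first
        conjugation carries the position (1, 0) to (m, j); the second exchanges m and i and keeps j,
        which differs from both.\<close>
      define m where "m = (if j = Suc 0 then 0 else Suc 0)"
      have m: "m < r" "m \<noteq> j" using r by (auto simp: m_def)
      have "swaprows_mat r 0 j * addrow_mat r p (Suc 0) 0 * swaprows_mat r 0 j \<in> S"
        using 10 r that by (intro mult swap) auto
      then have mj: "addrow_mat r p m j \<in> S"
        using swaprows_conj_addrow[of 0 r j "Suc 0" 0 p] r that by (simp add: m_def split: if_splits)
      have "swaprows_mat r m i * addrow_mat r p m j * swaprows_mat r m i \<in> S"
        using mj m that by (intro mult swap) auto
      then show ?thesis
        using swaprows_conj_addrow[of m r i m j p] m that by simp
    qed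
  qed
  have "A \<in> S" by (rule left_invertible_mem[OF assms])
  then show ?thesis by (simp add: S_def)
qed

theorem theorem6:
  fixes r :: nat
  assumes "r \<ge> 1"
  shows "restrict (N_mat r) (carrier (P_group r)) \<in> iso (P_group r) (GL r (C_a r))"
proof -
  \<comment> \<open>Three properties of \<open>?P\<close> enter: it lies in
    \<open>poly_aut r\<close>, it is closed under composition, and it realises every invertible
    matrix.\<close>
  let ?P = "carrier (P_group r)"
  have mat: "\<exists>A\<in>carrier_mat r r. \<exists>B\<in>carrier_mat r r. A * B = 1\<^sub>m r \<and> B * A = 1\<^sub>m r \<and> has_matrix r \<psi> A"
    if "\<psi> \<in> ?P" for \<psi>
    using that P_group_subset by (auto simp: poly_aut_def)
  have GL: "N_mat r \<psi> \<in> carrier (GL r (C_a r))" if \<psi>: "\<psi> \<in> ?P" for \<psi>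
    using mat[OF \<psi>] N_mat_eq unfolding carrier_GL_C_a by blast
  have "N_mat r (\<psi> \<otimes>\<^bsub>AutCQ r\<^esub> \<phi>) = N_mat r \<psi> \<otimes>\<^bsub>mat_monoid r (C_a r)\<^esub> N_mat r \<phi>"
    if \<psi>: "\<psi> \<in> ?P" and \<phi>: "\<phi> \<in> ?P" for \<psi> \<phi>
  proof -
    obtain A B where AB: "A \<in> carrier_mat r r" "has_matrix r \<psi> A" "B \<in> carrier_mat r r" "has_matrix r \<phi> B"
      using mat[OF \<psi>] mat[OF \<phi>] by blast
    have "\<psi> \<in> poly_aut r" "\<phi> \<in> poly_aut r" using \<psi> \<phi> P_group_subset by auto
    then have "has_matrix r (\<psi> \<otimes>\<^bsub>AutCQ r\<^esub> \<phi>) (A * B)"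
      using AB by (intro has_matrix_mult) (auto simp: poly_aut_def)
    then show ?thesis using AB by (simp add: N_mat_eq embed_mat_mult)
  qed
  moreover have "\<psi> \<otimes>\<^bsub>AutCQ r\<^esub> \<phi> \<in> ?P" if "\<psi> \<in> ?P" "\<phi> \<in> ?P" for \<psi> \<phi>
    using that by (rule subgroup.m_closed[OF subgroup_P_group])
  ultimately have hom: "restrict (N_mat r) ?P \<in> hom (P_group r) (GL r (C_a r))"
    using GL by (auto simp: hom_def mult_P_group mult_GL)
  have "inj_on (N_mat r) ?P"
  proof (rule inj_onI)
    fix \<psi> \<phi> assume \<psi>: "\<psi> \<in> ?P" and \<phi>: "\<phi> \<in> ?P" and eq: "N_mat r \<psi> = N_mat r \<phi>"
    obtain A B where A: "A \<in> carrier_mat r r" "B \<in> carrier_mat r r" "B * A = 1\<^sub>m r" "has_matrix r \<psi> A"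
      using mat[OF \<psi>] by blast
    obtain A' where A': "A' \<in> carrier_mat r r" "has_matrix r \<phi> A'"
      using mat[OF \<phi>] by blast
    have "A' = A"
      by (rule embed_mat_inject) (use A A' eq in \<open>auto simp: N_mat_eq\<close>)
    then show "\<psi> = \<phi>"
      using \<psi> \<phi> P_group_subset A A' by (intro poly_aut_eqI[of \<psi> r \<phi> A B]) auto
  qed
  moreover have "N_mat r ` ?P = carrier (GL r (C_a r))"
  proof
    show "N_mat r ` ?P \<subseteq> carrier (GL r (C_a r))" using GL by blast
    show "carrier (GL r (C_a r)) \<subseteq> N_mat r ` ?P"
    proof
      fix M assume "M \<in> carrier (GL r (C_a r))"
      then obtain A B where A: "A \<in> carrier_mat r r" "B \<in> carrier_mat r r" "B * A = 1\<^sub>m r" "M = embed_mat r A"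
        unfolding carrier_GL_C_a by blast
      obtain \<psi> where "\<psi> \<in> ?P" "has_matrix r \<psi> A" using P_group_surjective[OF A(1-3)] by blast
      then show "M \<in> N_mat r ` ?P" using A(4) by (intro image_eqI[of _ _ \<psi>]) (simp_all add: N_mat_eq)
    qed
  qed
  ultimately have "bij_betw (restrict (N_mat r) ?P) ?P (carrier (GL r (C_a r)))"
    by (simp add: bij_betw_def inj_on_restrict_eq)
  with hom show ?thesis by (simp add: iso_def)
qed

end
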